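(* Let $k\ge 1$ and let $\rho\colon\mathbb Z^k\to\mathcal U(\ell^2(\mathbb Z^k))$ be the right regular representation. Let $S\subseteq\mathbb T^k$ be an open dense subset of full Haar measure, and let $$\mathcal R_S:=\{\xi\in\ell^2(\mathbb Z^k):\widehat\xi\in C_c^\infty(S)\},$$ where $\widehat\xi\in L^2(\mathbb T^k)$ is the Fourier transform of $\xi$ and $C_c^\infty(S)$ is the space of smooth functions with compact support in $S$. Then $\mathcal R_S$ is a dense relatively $L^1$ subspace of the $\mathbb Z^k$-equivariant Hilbert $\mathbb C$-module $(\ell^2(\mathbb Z^k),\rho)$, so that the action $\mathrm{Ad}\rho\colon\mathbb Z^k\to\mathrm{Aut}(\mathcal K(\ell^2(\mathbb Z^k)))$ is Rieffel proper with respect to $\mathcal R_{S,\mathcal K}:=\mathrm{span}\{|\xi\rangle\langle\eta|:\xi\in\mathcal R_S,\ \eta\in\ell^2(\mathbb Z^k)\}$, and the corresponding generalised fixed-point algebra $\mathcal K(\ell^2(\mathbb Z^k))^{\mathbb Z^k,\mathrm{Ad}\rho}=\mathrm{Fix}(\ell^2(\mathbb Z^k),\mathcal R_S)$ is isomorphic to $C_0(S)$. Consequently, there exist infinitely many pairwise non-isomorphic generalised fixed-point algebras for the Rieffel proper action $\mathrm{Ad}\rho$ of $\mathbb Z^k$ on $\mathcal K(\ell^2(\mathbb Z^k))$ (arising from different choices of the dense subspace implementing Rieffel properness).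
   Context: $\mathcal K(\mathcal H)$ denotes the compact operators on a Hilbert space $\mathcal H$, and $|\xi\rangle\langle\eta|\in\mathcal K(\mathcal H)$ is the operator $\zeta\mapsto\xi\langle\eta\mid\zeta\rangle$ (inner products are linear in the second variable). $(\rho_m\xi)(\nu)=\xi(\nu+m)$. Let $G$ be a discrete (hence unimodular) group. For a unitary representation $u$ of $G$ on $\mathcal H$, a subspace $\mathcal R\subseteq\mathcal H$ is relatively $L^1$ if $\big(t\mapsto\langle\xi\mid u_t\eta\rangle\big)\in\ell^1(G)$ for all $\xi,\eta\in\mathcal R$. For an action $\alpha$ of $G$ on a $C^*$-algebra $A$, the action is Rieffel proper with respect to a dense subspace $\mathcal R\subseteq A$ if $\big(t\mapsto\xi^*\alpha_t(\eta)\big)\in\ell^1(G,A)$ for all $\xi,\eta\in\mathcal R$. In that case put $\tilde{\mathcal R}:=\mathrm{span}\{\sum_{t}\alpha_t(\xi f(t^{-1})):\xi\in\mathcal R,\ f\in\ell^1(G,A)\}$; the generalised fixed-point algebra with respect to $\mathcal R$ is the $C^*$-subalgebra $\overline{\mathrm{span}}\{\int_G^{\mathrm{su}}\alpha_t(\xi\eta^* )\,dt:\xi,\eta\in\tilde{\mathcal R}\}$ of $\mathcal M(A)$, where $\int^{\mathrm{su}}_G$ denotes the strict limit in $\mathcal M(A)$ of the sums over finite subsets of $G$. For a dense relatively $L^1$ subspace $\mathcal R\subseteq\mathcal H$, $\mathrm{Fix}(\mathcal H,\mathcal R)$ is the $C^*$-subalgebra of $\mathcal M(\mathcal K(\mathcal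 H))=\mathcal B(\mathcal H)$ generated by the operators $\int_G^{\mathrm{su}}|u_t\xi\rangle\langle u_t\eta|\,dt$ with $\xi,\eta\in\mathcal R$; it coincides with the generalised fixed-point algebra of $(\mathcal K(\mathcal H),\mathrm{Ad}u)$ with respect to $\mathrm{span}\{|\xi\rangle\langle\eta|:\xi\in\mathcal R,\eta\in\mathcal H\}$. *)

theory Defs
  imports "HOL-Analysis.Analysis"
begin

section \<open>The Hilbert space of square summable functions\<close>

typedef 'i ell2 = "{f :: 'i \<Rightarrow> complex. (\<lambda>i. (cmod (f i))\<^sup>2) summable_on UNIV}"
  morphisms coeff Abs_ell2
  by (rule exI[of _ "\<lambda>_. 0"]) simp

setup_lifting type_definition_ell2

lemma square_summable_add:
  assumes "(\<lambda>i. (cmod (f i))\<^sup>2) summable_on A" "(\<lambda>i. (cmod (g i))\<^sup>2) summable_on A"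
  shows "(\<lambda>i. (cmod (f i + g i))\<^sup>2) summable_on A"
proof (rule summable_on_comparison_test)
  show "(\<lambda>i. 2 * (cmod (f i))\<^sup>2 + 2 * (cmod (g i))\<^sup>2) summable_on A"
    by (intro summable_on_add summable_on_cmult_right assms)
  fix i
  have "(cmod (f i + g i))\<^sup>2 \<le> (cmod (f i) + cmod (g i))\<^sup>2"
    by (intro power_mono norm_triangle_ineq) auto
  also have "\<dots> \<le> 2 * (cmod (f i))\<^sup>2 + 2 * (cmod (g i))\<^sup>2"
    using sum_squares_bound[of "cmod (f i)" "cmod (g i)"] by (simp add: power2_sum)
  finally show "(cmod (f i + g i))\<^sup>2 \<le> 2 * (cmod (f i))\<^sup>2 + 2 * (cmod (g i))\<^sup>2" .
qed auto

lemma square_summable_scale: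
  assumes "(\<lambda>i. (cmod (f i))\<^sup>2) summable_on A"
  shows "(\<lambda>i. (cmod (c * f i))\<^sup>2) summable_on A"
  using summable_on_cmult_right[OF assms, of "(cmod c)\<^sup>2"]
  by (simp add: norm_mult power_mult_distrib)

lemma square_summable_mult:
  fixes f g :: "'i \<Rightarrow> complex"
  assumes "(\<lambda>i. (cmod (f i))\<^sup>2) summable_on A" "(\<lambda>i. (cmod (g i))\<^sup>2) summable_on A"
  shows "(\<lambda>i. cmod (cnj (f i) * g i)) summable_on A"
proof (rule summable_on_comparison_test)
  show "(\<lambda>i. (cmod (f i))\<^sup>2 + (cmod (g i))\<^sup>2) summable_on A"
    by (intro summable_on_add assms)
  fix i
  have "0 \<le> cmod (f i) * cmod (g i)" by simp
  with sum_squares_bound[of "cmod (f i)" "cmod (g i)"]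
  have "cmod (f i) * cmod (g i) \<le> (cmod (f i))\<^sup>2 + (cmod (g i))\<^sup>2" by linarith
  then show "cmod (cnj (f i) * g i) \<le> (cmod (f i))\<^sup>2 + (cmod (g i))\<^sup>2"
    by (simp add: norm_mult)
qed auto

instantiation ell2 :: (type) real_vector
begin

lift_definition zero_ell2 :: "'a ell2" is "\<lambda>_. 0" by simp
lift_definition plus_ell2 :: "'a ell2 \<Rightarrow> 'a ell2 \<Rightarrow> 'a ell2" is "\<lambda>f g i. f i + g i"
  by (rule square_summable_add)
lift_definition uminus_ell2 :: "'a ell2 \<Rightarrow> 'a ell2" is "\<lambda>f i. - f i" by simp
lift_definition minus_ell2 :: "'a ell2 \<Rightarrow> 'a ell2 \<Rightarrow> 'a ell2" is "\<lambda>f g i. f i - g i"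
  using square_summable_add[OF _ square_summable_scale[of _ UNIV "-1"]] by simp
lift_definition scaleR_ell2 :: "real \<Rightarrow> 'a ell2 \<Rightarrow> 'a ell2" is "\<lambda>r f i. complex_of_real r * f i"
  by (rule square_summable_scale)

instance
  by standard (transfer; auto simp: algebra_simps)+

end

lift_definition scaleC :: "complex \<Rightarrow> 'i ell2 \<Rightarrow> 'i ell2" is "\<lambda>c f i. c * f i"
  by (rule square_summable_scale)

definition cinner :: "'i ell2 \<Rightarrow> 'i ell2 \<Rightarrow> complex" where
  "cinner x y = (\<Sum>\<^sub>\<infinity>i. cnj (coeff x i) * coeff y i)"

lemma coeff_simps [simp]:
  "coeff 0 i = 0" "coeff (x + y) i = coeff x i + coeff y i" "coeff (- x) i = - coeff x i"
  "coeff (x - y) i = coeff x i - coeff y i" "coeff (r *\<^sub>R x) i = complex_of_real r * coeff x i"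
  "coeff (scaleC c x) i = c * coeff x i"
  by (simp_all add: zero_ell2.rep_eq plus_ell2.rep_eq uminus_ell2.rep_eq minus_ell2.rep_eq
      scaleR_ell2.rep_eq scaleC.rep_eq)

lemma ell2_eqI: "(\<And>i. coeff x i = coeff y i) \<Longrightarrow> x = y"
  by (simp add: coeff_inject[symmetric] fun_eq_iff)

lemma square_summable_coeff: "(\<lambda>i. (cmod (coeff x i))\<^sup>2) summable_on UNIV"
  using coeff[of x] by simp

lemma cinner_summable: "(\<lambda>i. cnj (coeff x i) * coeff y i) summable_on UNIV"
  by (rule abs_summable_summable) (intro square_summable_mult square_summable_coeff)

lemma cinner_commute: "cinner x y = cnj (cinner y x)"
  unfolding cinner_def by (subst infsum_cnj[symmetric]) (simp add: mult.commute)

lemma cinner_add_right: "cinner x (y + z) = cinner x y + cinner x z"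
  unfolding cinner_def by (simp add: distrib_left infsum_add cinner_summable)

lemma cinner_scaleC_right: "cinner x (scaleC c y) = c * cinner x y"
proof -
  have "cinner x (scaleC c y) = (\<Sum>\<^sub>\<infinity>i. c * (cnj (coeff x i) * coeff y i))"
    unfolding cinner_def by (simp add: mult_ac)
  then show ?thesis unfolding cinner_def by (simp add: infsum_cmult_right')
qed

lemma cinner_add_left: "cinner (x + y) z = cinner x z + cinner y z"
  by (simp add: cinner_commute[of _ z] cinner_add_right)

lemma cinner_scaleC_left: "cinner (scaleC c x) y = cnj c * cinner x y"
  by (simp add: cinner_commute[of _ y] cinner_scaleC_right)

lemma scaleR_scaleC: "r *\<^sub>R x = scaleC (complex_of_real r) x" for x :: "'i ell2"
  by (rule ell2_eqI) simp

lemma cinner_self: "cinner x x = complex_of_real (\<Sum>\<^sub>\<infinity>i. (cmod (coeff x i))\<^sup>2)"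
proof -
  have "cinner x x = (\<Sum>\<^sub>\<infinity>i. complex_of_real ((cmod (coeff x i))\<^sup>2))"
    unfolding cinner_def
    by (rule infsum_cong) (subst complex_norm_square, rule mult.commute)
  also have "\<dots> = complex_of_real (\<Sum>\<^sub>\<infinity>i. (cmod (coeff x i))\<^sup>2)"
    by (intro infsumI has_sum_bounded_linear[OF bounded_linear_of_real] has_sum_infsum
        square_summable_coeff)
  finally show ?thesis .
qed

instantiation ell2 :: (type) real_inner
begin

definition norm_ell2 :: "'a ell2 \<Rightarrow> real" where
  "norm_ell2 x = sqrt (\<Sum>\<^sub>\<infinity>i. (cmod (coeff x i))\<^sup>2)"
definition inner_ell2 :: "'a ell2 \<Rightarrow> 'a ell2 \<Rightarrow> real" where "inner_ell2 x y = Re (cinner x y)"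
definition dist_ell2 :: "'a ell2 \<Rightarrow> 'a ell2 \<Rightarrow> real" where "dist_ell2 x y = norm (x - y)"
definition sgn_ell2 :: "'a ell2 \<Rightarrow> 'a ell2" where "sgn_ell2 x = x /\<^sub>R norm x"
definition uniformity_ell2 :: "('a ell2 \<times> 'a ell2) filter" where
  "uniformity_ell2 = (INF e\<in>{0<..}. principal {(x, y). dist x y < e})"
definition open_ell2 :: "'a ell2 set \<Rightarrow> bool" where
  "open_ell2 U \<longleftrightarrow> (\<forall>x\<in>U. eventually (\<lambda>(x', y). x' = x \<longrightarrow> y \<in> U) uniformity)"

instance
proof
  fix x y z :: "'a ell2" and r :: real and U :: "'a ell2 set"
  show "dist x y = norm (x - y)" by (fact dist_ell2_def)
  show "sgn x = x /\<^sub>R norm x" by (fact sgn_ell2_def)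
  show "uniformity = (INF e\<in>{0<..}. principal {(x :: 'a ell2, y). dist x y < e})"
    by (fact uniformity_ell2_def)
  show "open U \<longleftrightarrow> (\<forall>x\<in>U. eventually (\<lambda>(x', y). x' = x \<longrightarrow> y \<in> U) uniformity)"
    by (fact open_ell2_def)
  show "inner x y = inner y x"
    unfolding inner_ell2_def by (subst cinner_commute) simp
  show "inner (x + y) z = inner x z + inner y z"
    by (simp add: inner_ell2_def cinner_add_left)
  show "inner (r *\<^sub>R x) y = r * inner x y"
    by (simp add: inner_ell2_def scaleR_scaleC cinner_scaleC_left)
  show "0 \<le> inner x x"
    by (simp add: inner_ell2_def cinner_self infsum_nonneg)
  show "norm x = sqrt (inner x x)"
    by (simp add: inner_ell2_def cinner_self norm_ell2_def)
  show "inner x x = 0 \<longleftrightarrow> x = 0"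
  proof
    assume "inner x x = 0"
    then have "(\<Sum>\<^sub>\<infinity>i. (cmod (coeff x i))\<^sup>2) = 0"
      by (simp add: inner_ell2_def cinner_self)
    then have "(cmod (coeff x i))\<^sup>2 = 0" for i
      using nonneg_infsum_le_0D[of "\<lambda>i. (cmod (coeff x i))\<^sup>2" UNIV i] square_summable_coeff[of x]
      by simp
    then show "x = 0" by (intro ell2_eqI) simp
  qed (simp add: inner_ell2_def cinner_def)
qed

end

lemma norm_ell2_square: "(norm x)\<^sup>2 = (\<Sum>\<^sub>\<infinity>i. (cmod (coeff x i))\<^sup>2)"
  by (simp add: norm_ell2_def infsum_nonneg)

lemma sum_coeff_le_norm: "finite F \<Longrightarrow> (\<Sum>i\<in>F. (cmod (coeff x i))\<^sup>2) \<le> (norm x)\<^sup>2"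
  unfolding norm_ell2_square by (rule finite_sum_le_infsum) (auto simp: square_summable_coeff)

lemma cmod_coeff_le_norm: "cmod (coeff x i) \<le> norm x"
  using sum_coeff_le_norm[of "{i}" x] by (simp add: power2_le_iff_abs_le)

lemma norm_scaleC [simp]: "norm (scaleC c x) = cmod c * norm x"
proof -
  have "(\<Sum>\<^sub>\<infinity>i. (cmod (coeff (scaleC c x) i))\<^sup>2) = (cmod c)\<^sup>2 * (\<Sum>\<^sub>\<infinity>i. (cmod (coeff x i))\<^sup>2)"
    by (simp add: norm_mult power_mult_distrib infsum_cmult_right')
  then show ?thesis
    by (simp add: norm_ell2_def real_sqrt_mult)
qed

lemma cmod_cinner_le: "cmod (cinner x y) \<le> norm x * norm y"
proof (cases "cinner x y = 0")
  case False
  define c where "c = cnj (cinner x y) / cmod (cinner x y)"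
  have "cmod c = 1" using False by (simp add: c_def norm_divide)
  have "c * cinner x y = complex_of_real (cmod (cinner x y))"
    using False by (simp add: c_def mult.commute[of "cnj _"] complex_norm_square[symmetric] power2_eq_square)
  then have "cmod (cinner x y) = inner x (scaleC c y)"
    by (simp add: inner_ell2_def cinner_scaleC_right)
  also have "\<dots> \<le> norm x * norm (scaleC c y)" by (rule norm_cauchy_schwarz)
  finally show ?thesis using \<open>cmod c = 1\<close> by simp
qed simp

instance ell2 :: (type) complete_space
proof
  fix X :: "nat \<Rightarrow> 'a ell2"
  assume "Cauchy X"
  have "Cauchy (\<lambda>n. coeff (X n) i)" for i
  proof (rule metric_CauchyI)
    fix e :: real assume "e > 0"
    then obtain N where N: "\<And>m n. m \<ge> N \<Longrightarrow> n \<ge> N \<Longrightarrow> dist (X m) (X n) < e"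
      using \<open>Cauchy X\<close> by (meson metric_CauchyD)
    have "dist (coeff (X m) i) (coeff (X n) i) < e" if "m \<ge> N" "n \<ge> N" for m n
      using cmod_coeff_le_norm[of "X m - X n" i] N[OF that] by (simp add: dist_norm)
    then show "\<exists>M. \<forall>m\<ge>M. \<forall>n\<ge>M. dist (coeff (X m) i) (coeff (X n) i) < e" by blast
  qed
  then have "\<exists>l. (\<lambda>n. coeff (X n) i) \<longlonglongrightarrow> l" for i
    by (simp add: Cauchy_convergent_iff convergent_def)
  then obtain l where l: "\<And>i. (\<lambda>n. coeff (X n) i) \<longlonglongrightarrow> l i" by metis
  have bound: "(\<Sum>i\<in>F. (cmod (coeff (X n) i - l i))\<^sup>2) \<le> e\<^sup>2"
    if "finite F" "n \<ge> N" "\<And>m n. m \<ge> N \<Longrightarrow> n \<ge> N \<Longrightarrow> dist (X m) (X n) < e" for F n N e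
  proof (rule Lim_bounded)
    show "(\<lambda>m. \<Sum>i\<in>F. (cmod (coeff (X n) i - coeff (X m) i))\<^sup>2)
        \<longlonglongrightarrow> (\<Sum>i\<in>F. (cmod (coeff (X n) i - l i))\<^sup>2)"
      by (intro tendsto_intros l)
    show "\<forall>m\<ge>N. (\<Sum>i\<in>F. (cmod (coeff (X n) i - coeff (X m) i))\<^sup>2) \<le> e\<^sup>2"
    proof (intro allI impI)
      fix m assume "m \<ge> N"
      then have "norm (X n - X m) \<le> e" using that(3)[of n m] that(2) by (simp add: dist_norm)
      then have "(norm (X n - X m))\<^sup>2 \<le> e\<^sup>2" by (intro power_mono) auto
      then show "(\<Sum>i\<in>F. (cmod (coeff (X n) i - coeff (X m) i))\<^sup>2) \<le> e\<^sup>2"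
        using sum_coeff_le_norm[OF that(1), of "X n - X m"] by simp
    qed
  qed
  have ex: "\<exists>N. \<forall>m\<ge>N. \<forall>n\<ge>N. dist (X m) (X n) < e" if "e > 0" for e
    using \<open>Cauchy X\<close> that by (meson metric_CauchyD)
  have diff: "(\<lambda>i. (cmod (coeff (X n) i - l i))\<^sup>2) summable_on UNIV"
    if "n \<ge> N" "\<And>m n. m \<ge> N \<Longrightarrow> n \<ge> N \<Longrightarrow> dist (X m) (X n) < e" for n N e
    using bound[OF _ that] by (intro nonneg_bdd_above_summable_on) (auto simp: bdd_above_def)
  obtain N where N: "\<And>m n. m \<ge> N \<Longrightarrow> n \<ge> N \<Longrightarrow> dist (X m) (X n) < 1"
    using ex[of 1] by auto
  have "(\<lambda>i. (cmod (coeff (X N) i - l i))\<^sup>2) summable_on UNIV"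
    by (rule diff[OF order_refl N])
  from square_summable_add[OF square_summable_scale[OF this, of "-1"] square_summable_coeff[of "X N"]]
  have "(\<lambda>i. (cmod (l i))\<^sup>2) summable_on UNIV" by simp
  then have L: "coeff (Abs_ell2 l) = l" by (simp add: Abs_ell2_inverse)
  have "X \<longlonglongrightarrow> Abs_ell2 l"
  proof (rule metric_LIMSEQ_I)
    fix e :: real assume "e > 0"
    then obtain N where N: "\<And>m n. m \<ge> N \<Longrightarrow> n \<ge> N \<Longrightarrow> dist (X m) (X n) < e / 2"
      using ex[of "e / 2"] by auto
    have "dist (X n) (Abs_ell2 l) < e" if "n \<ge> N" for n
    proof -
      have "(norm (X n - Abs_ell2 l))\<^sup>2 \<le> (e / 2)\<^sup>2"
        unfolding norm_ell2_square using bound[OF _ that N] diff[OF that N]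
        by (intro infsum_le_finite_sums) (auto simp: L)
      then have "norm (X n - Abs_ell2 l) \<le> e / 2"
        using \<open>e > 0\<close> by (simp add: power2_le_iff_abs_le)
      then show ?thesis using \<open>e > 0\<close> by (simp add: dist_norm)
    qed
    then show "\<exists>N. \<forall>n\<ge>N. dist (X n) (Abs_ell2 l) < e" by blast
  qed
  then show "convergent X" by (auto simp: convergent_def)
qed

instance ell2 :: (type) banach ..

interpretation ell2: vector_space "scaleC :: complex \<Rightarrow> 'i ell2 \<Rightarrow> 'i ell2"
  by standard (auto intro!: ell2_eqI simp: algebra_simps)


section \<open>Operators\<close>

text \<open>Elements of type \<open>'i op\<close> are only real-linear; \<open>bounded_ops\<close> singles out the
  complex-linear ones.\<close>

type_synonym 'i op = "'i ell2 \<Rightarrow>\<^sub>L 'i ell2"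

definition bounded_ops :: "'i op set" where
  "bounded_ops = {T. \<forall>c x. blinfun_apply T (scaleC c x) = scaleC c (blinfun_apply T x)}"

definition compact_ops :: "'i op set" where
  "compact_ops = {T \<in> bounded_ops. compact (closure (blinfun_apply T ` cball 0 1))}"

lift_definition homothety :: "complex \<Rightarrow> 'i op" is scaleC
  by (rule bounded_linear_intro[of _ "cmod c" for c])
     (auto intro!: ell2_eqI simp: algebra_simps)

definition scale_op :: "complex \<Rightarrow> 'i op \<Rightarrow> 'i op" where
  "scale_op c T = homothety c o\<^sub>L T"

lemma scale_op_apply [simp]: "blinfun_apply (scale_op c T) x = scaleC c (blinfun_apply T x)"
  by (simp add: scale_op_def homothety.rep_eq)

interpretation op: vector_space "scale_op :: complex \<Rightarrow> 'i op \<Rightarrow> 'i op"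
  by standard
    (auto intro!: blinfun_eqI ell2_eqI simp: plus_blinfun.rep_eq algebra_simps)

definition adj :: "'i op \<Rightarrow> 'i op" where
  "adj T = (THE S. \<forall>x y. cinner (blinfun_apply S x) y = cinner x (blinfun_apply T y))"

lift_definition ketbra :: "'i ell2 \<Rightarrow> 'i ell2 \<Rightarrow> 'i op" is "\<lambda>\<xi> \<eta> \<zeta>. scaleC (cinner \<eta> \<zeta>) \<xi>"
proof -
  fix \<xi> \<eta> :: "'i ell2"
  show "bounded_linear (\<lambda>\<zeta>. scaleC (cinner \<eta> \<zeta>) \<xi>)"
  proof (rule bounded_linear_intro[of _ "norm \<eta> * norm \<xi>"])
    show "norm (scaleC (cinner \<eta> x) \<xi>) \<le> norm x * (norm \<eta> * norm \<xi>)" for x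
      using mult_right_mono[OF cmod_cinner_le[of \<eta> x] norm_ge_zero[of \<xi>]]
      by (simp add: mult_ac)
  qed (auto intro!: ell2_eqI
        simp: cinner_add_right cinner_scaleC_right scaleR_scaleC algebra_simps)
qed

definition cstar_subalgebra :: "'i op set \<Rightarrow> bool" where
  "cstar_subalgebra B \<longleftrightarrow> B \<subseteq> bounded_ops \<and> op.subspace B \<and> closed B \<and>
     (\<forall>S\<in>B. \<forall>T\<in>B. S o\<^sub>L T \<in> B) \<and> (\<forall>T\<in>B. adj T \<in> B)"


section \<open>Isomorphism of C*-algebras\<close>

record 'a star_algebra =
  alg_carrier :: "'a set"
  alg_add :: "'a \<Rightarrow> 'a \<Rightarrow> 'a"
  alg_scale :: "complex \<Rightarrow> 'a \<Rightarrow> 'a"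
  alg_mult :: "'a \<Rightarrow> 'a \<Rightarrow> 'a"
  alg_star :: "'a \<Rightarrow> 'a"

definition star_isomorphism :: "('a \<Rightarrow> 'b) \<Rightarrow> 'a star_algebra \<Rightarrow> 'b star_algebra \<Rightarrow> bool" where
  "star_isomorphism \<phi> A B \<longleftrightarrow> bij_betw \<phi> (alg_carrier A) (alg_carrier B) \<and>
     (\<forall>x\<in>alg_carrier A. \<forall>y\<in>alg_carrier A.
        \<phi> (alg_add A x y) = alg_add B (\<phi> x) (\<phi> y) \<and>
        \<phi> (alg_mult A x y) = alg_mult B (\<phi> x) (\<phi> y)) \<and>
     (\<forall>x\<in>alg_carrier A.
        (\<forall>c. \<phi> (alg_scale A c x) = alg_scale B c (\<phi> x)) \<and>
        \<phi> (alg_star A x) = alg_star B (\<phi> x))"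

text \<open>No condition on norms is needed: a *-isomorphism between C*-algebras is isometric.\<close>

definition star_isomorphic :: "'a star_algebra \<Rightarrow> 'b star_algebra \<Rightarrow> bool" where
  "star_isomorphic A B \<longleftrightarrow> (\<exists>\<phi>. star_isomorphism \<phi> A B)"

definition op_alg :: "'i op set \<Rightarrow> 'i op star_algebra" where
  "op_alg A = \<lparr>alg_carrier = A, alg_add = (+), alg_scale = scale_op, alg_mult = (o\<^sub>L), alg_star = adj\<rparr>"

text \<open>The continuous functions on \<open>S\<close> vanishing at infinity; the value \<open>0\<close> outside \<open>S\<close> is only
  a convention that makes equality of functions on \<open>S\<close> the equality of HOL.\<close>

definition C0 :: "'a::topological_space set \<Rightarrow> ('a \<Rightarrow> complex) set" where
  "C0 S = {f. continuous_on S f \<and> (\<forall>e>0. compact {x\<in>S. e \<le> cmod (f x)}) \<and> (\<forall>x. x \<notin> S \<longrightarrow> f x = 0)}"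

definition C0_alg :: "'a::topological_space set \<Rightarrow> ('a \<Rightarrow> complex) star_algebra" where
  "C0_alg S = \<lparr>alg_carrier = C0 S, alg_add = (\<lambda>f g x. f x + g x), alg_scale = (\<lambda>c f x. c * f x),
     alg_mult = (\<lambda>f g x. f x * g x), alg_star = (\<lambda>f x. cnj (f x))\<rparr>"


section \<open>Rieffel proper actions and generalised fixed-point algebras\<close>

text \<open>The discrete group is a type of class \<open>group_add\<close> (additive, not necessarily
  commutative). The C*-algebra \<open>A\<close> is represented nondegenerately on a Hilbert space, and its
  multiplier algebra is the idealizer of \<open>A\<close> in the bounded operators.\<close>

definition multipliers :: "'i op set \<Rightarrow> 'i op set" where
  "multipliers A = {T \<in> bounded_ops. \<forall>a\<in>A. T o\<^sub>L a \<in> A \<and> a o\<^sub>L T \<in> A}"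

definition has_su_sum :: "'i op set \<Rightarrow> ('g \<Rightarrow> 'i op) \<Rightarrow> 'i op \<Rightarrow> bool" where
  "has_su_sum A f X \<longleftrightarrow> X \<in> multipliers A \<and>
     (\<forall>a\<in>A. ((\<lambda>t. f t o\<^sub>L a) has_sum (X o\<^sub>L a)) UNIV \<and> ((\<lambda>t. a o\<^sub>L f t) has_sum (a o\<^sub>L X)) UNIV)"

definition su_sum :: "'i op set \<Rightarrow> ('g \<Rightarrow> 'i op) \<Rightarrow> 'i op" where
  "su_sum A f = (THE X. has_su_sum A f X)"

definition unitary_rep :: "('g::group_add \<Rightarrow> 'i op) \<Rightarrow> bool" where
  "unitary_rep u \<longleftrightarrow> u 0 = id_blinfun \<and> (\<forall>s t. u (s + t) = u s o\<^sub>L u t) \<and>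
     (\<forall>t. u t \<in> bounded_ops \<and> adj (u t) o\<^sub>L u t = id_blinfun \<and> u t o\<^sub>L adj (u t) = id_blinfun)"

definition relatively_L1 :: "('g::group_add \<Rightarrow> 'i op) \<Rightarrow> 'i ell2 set \<Rightarrow> bool" where
  "relatively_L1 u R \<longleftrightarrow> ell2.subspace R \<and>
     (\<forall>\<xi>\<in>R. \<forall>\<eta>\<in>R. (\<lambda>t. cmod (cinner \<xi> (blinfun_apply (u t) \<eta>))) summable_on UNIV)"

definition Ad :: "('g \<Rightarrow> 'i op) \<Rightarrow> 'g \<Rightarrow> 'i op \<Rightarrow> 'i op" where
  "Ad u t T = u t o\<^sub>L T o\<^sub>L adj (u t)"

definition is_action :: "('g::group_add \<Rightarrow> 'i op \<Rightarrow> 'i op) \<Rightarrow> 'i op set \<Rightarrow> bool" where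
  "is_action \<alpha> A \<longleftrightarrow> (\<forall>t. star_isomorphism (\<alpha> t) (op_alg A) (op_alg A)) \<and>
     (\<forall>a\<in>A. \<alpha> 0 a = a \<and> (\<forall>s t. \<alpha> (s + t) a = \<alpha> s (\<alpha> t a)))"

definition dense_subspace :: "'i op set \<Rightarrow> 'i op set \<Rightarrow> bool" where
  "dense_subspace A R \<longleftrightarrow> op.subspace R \<and> R \<subseteq> A \<and> A \<subseteq> closure R"

definition rieffel_proper :: "('g::group_add \<Rightarrow> 'i op \<Rightarrow> 'i op) \<Rightarrow> 'i op set \<Rightarrow> 'i op set \<Rightarrow> bool" where
  "rieffel_proper \<alpha> A R \<longleftrightarrow> is_action \<alpha> A \<and> dense_subspace A R \<and>
     (\<forall>\<xi>\<in>R. \<forall>\<eta>\<in>R. (\<lambda>t. norm (adj \<xi> o\<^sub>L \<alpha> t \<eta>)) summable_on UNIV)"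

definition l1_functions :: "'i op set \<Rightarrow> ('g \<Rightarrow> 'i op) set" where
  "l1_functions A = {f. range f \<subseteq> A \<and> (\<lambda>t. norm (f t)) summable_on UNIV}"

definition saturation :: "('g::group_add \<Rightarrow> 'i op \<Rightarrow> 'i op) \<Rightarrow> 'i op set \<Rightarrow> 'i op set \<Rightarrow> 'i op set" where
  "saturation \<alpha> A R = op.span {\<Sum>\<^sub>\<infinity>t. \<alpha> t (\<xi> o\<^sub>L f (- t)) | \<xi> f. \<xi> \<in> R \<and> f \<in> l1_functions A}"

definition gen_fixed_point_algebra ::
    "('g::group_add \<Rightarrow> 'i op \<Rightarrow> 'i op) \<Rightarrow> 'i op set \<Rightarrow> 'i op set \<Rightarrow> 'i op set" where
  "gen_fixed_point_algebra \<alpha> A R = closure (op.span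
     {su_sum A (\<lambda>t. \<alpha> t (\<xi> o\<^sub>L adj \<eta>)) | \<xi> \<eta>. \<xi> \<in> saturation \<alpha> A R \<and> \<eta> \<in> saturation \<alpha> A R})"

definition Fix :: "('g::group_add \<Rightarrow> 'i op) \<Rightarrow> 'i ell2 set \<Rightarrow> 'i op set" where
  "Fix u R = cstar_subalgebra hull
     {su_sum compact_ops (\<lambda>t. ketbra (blinfun_apply (u t) \<xi>) (blinfun_apply (u t) \<eta>)) | \<xi> \<eta>. \<xi> \<in> R \<and> \<eta> \<in> R}"

definition ketbra_span :: "'i ell2 set \<Rightarrow> 'i op set" where
  "ketbra_span R = op.span {ketbra \<xi> \<eta> | \<xi> \<eta>. \<xi> \<in> R}"

lemma bij_add_right: "bij (\<lambda>\<nu>::'g::group_add. \<nu> + m)"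
  by (rule bij_betw_byWitness[where f' = "\<lambda>\<nu>. \<nu> - m"]) auto

lift_definition translate :: "'g::group_add \<Rightarrow> 'g ell2 \<Rightarrow> 'g ell2" is "\<lambda>m \<xi> \<nu>. \<xi> (\<nu> + m)"
proof -
  fix m :: 'g and \<xi> :: "'g \<Rightarrow> complex"
  assume "(\<lambda>\<nu>. (cmod (\<xi> \<nu>))\<^sup>2) summable_on UNIV"
  then show "(\<lambda>\<nu>. (cmod (\<xi> (\<nu> + m)))\<^sup>2) summable_on UNIV"
    using summable_on_reindex_bij_betw[OF bij_add_right[of m], of "\<lambda>\<nu>. (cmod (\<xi> \<nu>))\<^sup>2"] by simp
qed

lift_definition right_regular :: "'g::group_add \<Rightarrow> 'g op" is translate
proof -
  fix m :: 'g
  have "norm (translate m \<xi>) = norm \<xi>" for \<xi>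
    using infsum_reindex_bij_betw[OF bij_add_right[of m], of "\<lambda>\<nu>. (cmod (coeff \<xi> \<nu>))\<^sup>2"]
    by (simp add: norm_ell2_def translate.rep_eq)
  then show "bounded_linear (translate m)"
    by (intro bounded_linear_intro[of _ 1]) (auto intro!: ell2_eqI simp: translate.rep_eq)
qed


section \<open>The torus and the Fourier transform\<close>

definition torus :: "(complex ^ 'k) set" where
  "torus = {z. \<forall>i. cmod (z $ i) = 1}"

definition torus_exp :: "real ^ 'k \<Rightarrow> complex ^ 'k" where
  "torus_exp t = (\<chi> i. cis (2 * pi * (t $ i)))"

definition haar_torus :: "(complex ^ 'k) measure" where
  "haar_torus = distr (restrict_space lborel (cbox 0 1)) borel (torus_exp :: real ^ 'k \<Rightarrow> _)"

definition character :: "int ^ 'k \<Rightarrow> complex ^ 'k \<Rightarrow> complex" where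
  "character m z = (\<Prod>i\<in>UNIV. (z $ i) powi (m $ i))"

text \<open>\<open>is_fourier_transform \<xi> f\<close>: the function \<open>f\<close> represents the class of the Fourier transform
  of \<open>\<xi>\<close> in \<open>L\<^sup>2\<close> of the torus, that is, the sum over all \<open>m\<close> of \<open>\<xi>(m)\<close> times the conjugate of
  \<open>z\<^sup>m\<close> converges to \<open>f\<close> in \<open>L\<^sup>2\<close>.\<close>

definition is_fourier_transform :: "(int ^ 'k) ell2 \<Rightarrow> (complex ^ 'k \<Rightarrow> complex) \<Rightarrow> bool" where
  "is_fourier_transform \<xi> f \<longleftrightarrow> f \<in> borel_measurable haar_torus \<and>
     integrable haar_torus (\<lambda>z. (cmod (f z))\<^sup>2) \<and>
     ((\<lambda>F. \<integral>z. (cmod (f z - (\<Sum>m\<in>F. coeff \<xi> m * cnj (character m z))))\<^sup>2 \<partial>haar_torus) \<longlongrightarrow> 0)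
       (finite_subsets_at_top UNIV)"

primrec Ck :: "nat \<Rightarrow> ('a::real_normed_vector \<Rightarrow> 'b::real_normed_vector) \<Rightarrow> bool" where
  "Ck 0 f \<longleftrightarrow> continuous_on UNIV f"
| "Ck (Suc n) f \<longleftrightarrow> (\<forall>x. f differentiable (at x)) \<and>
     (\<forall>v. Ck n (\<lambda>x. frechet_derivative f (at x) v))"

definition smooth :: "('a::real_normed_vector \<Rightarrow> 'b::real_normed_vector) \<Rightarrow> bool" where
  "smooth f \<longleftrightarrow> (\<forall>n. Ck n f)"

text \<open>Smooth functions with compact support in the open subset \<open>S\<close> of the torus, extended by
  zero. Since \<open>torus_exp\<close> is a smooth covering, smoothness on the torus is smoothness of the
  lift.\<close>

definition Cc_smooth :: "(complex ^ 'k) set \<Rightarrow> (complex ^ 'k \<Rightarrow> complex) set" where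
  "Cc_smooth S = {f. smooth (f \<circ> torus_exp) \<and> (\<exists>K. compact K \<and> K \<subseteq> S \<and> (\<forall>z. z \<notin> K \<longrightarrow> f z = 0))}"

definition RS :: "(complex ^ 'k) set \<Rightarrow> (int ^ 'k) ell2 set" where
  "RS S = {\<xi>. \<exists>f \<in> Cc_smooth S. is_fourier_transform \<xi> f}"

end

theory Submission
  imports Defs
begin

text \<open>The Fourier transform turns the right regular representation into multiplication by
  characters of the torus, so for \<open>\<xi>, \<eta> \<in> \<R>\<^sub>S\<close> the strict sum of
  \<open>|\<rho>\<^sub>t \<xi>\<rangle>\<langle>\<rho>\<^sub>t \<eta>|\<close> is multiplication by the transform of \<open>\<xi>\<close> times the
  conjugate transform of \<open>\<eta>\<close>. Multiplication operators are isometric for the supremum norm on the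
  torus, and such products are dense in \<open>C\<^sub>0(S)\<close>. The strict sums converge because smooth
  functions have summable Fourier coefficients: an operator \<open>|\<xi>\<rangle>\<langle>\<eta>|\<close> with summable
  coefficients is an absolutely convergent combination of the operators
  \<open>|\<delta>\<^sub>i\<rangle>\<langle>\<delta>\<^sub>j|\<close>, whose translates sum to a translation.

  Removing \<open>n\<close> parallel subtori leaves an open dense set of full measure with \<open>n\<close> components, and
  the *-algebra \<open>C\<^sub>0(S)\<close> remembers the number of components.\<close>

section \<open>Square summable functions and their bounded operators\<close>

text \<open>The saturation is what makes one inclusion delicate. Its elements are combinations of
  series of operators |rho_t a><w_t| in which \<open>a\<close> comes from R_S, but the vectors w_t
  are merely norm-summable, so their coefficients need not be summable and the strict sum of such an
  operator is not obviously convergent. What rescues the argument is that only products V W* are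
  summed strictly: there the vectors w_t and v_s enter through the scalars <v_s, w_t> alone, and the
  remaining operators |rho_t a><rho_s c| share a single bound on all their partial sums. For this
  reason every strict sum is carried along with such a bound.

  The space L^2 of the torus is not built. Functions on the torus are lifted to periodic functions
  of real variables, and a multiplication operator is an operator on the sequence space whose matrix
  entries are the Fourier coefficients of a function. Strict convergence delivers exactly matrix
  entries, and Parseval's identity recognises them.\<close>

lift_definition delta :: "'i \<Rightarrow> 'i ell2" is "\<lambda>i j. if j = i then 1 else 0"
proof -
  fix i :: 'i
  show "(\<lambda>j. (cmod (if j = i then 1 else 0))\<^sup>2) summable_on UNIV"
    by (rule finite_nonzero_values_imp_summable_on) (rule finite_subset[of _ "{i}"], auto)
qed

lemma coeff_delta: "coeff (delta i) j = (if j = i then 1 else 0)"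
  by (simp add: delta.rep_eq)

lemma coeff_sum: "coeff (\<Sum>i\<in>A. f i) j = (\<Sum>i\<in>A. coeff (f i) j)"
  by (induction A rule: infinite_finite_induct) auto

lemma cinner_delta: "cinner (delta i) x = coeff x i"
proof -
  have "cinner (delta i) x = (\<Sum>\<^sub>\<infinity>j\<in>{i}. cnj (coeff (delta i) j) * coeff x j)"
    unfolding cinner_def by (rule infsum_cong_neutral) (auto simp: coeff_delta)
  then show ?thesis by (simp add: coeff_delta)
qed

lemma cinner_delta_right: "cinner x (delta i) = cnj (coeff x i)"
  by (subst cinner_commute) (simp add: cinner_delta)

lemma norm_eq_cinner: "(norm x)\<^sup>2 = Re (cinner x x)"
  by (simp add: cinner_self norm_ell2_square)

lemma bounded_linear_cinner_right: "bounded_linear (cinner x)"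
  by (rule bounded_linear_intro[of _ "norm x"])
     (auto simp: cinner_add_right scaleR_scaleC cinner_scaleC_right scaleR_conv_of_real
        cmod_cinner_le mult.commute[of "norm _" "norm x"])

lemma bounded_linear_scaleC: "bounded_linear (scaleC c)"
  by (rule bounded_linear_intro[of _ "cmod c"]) (auto intro!: ell2_eqI simp: algebra_simps)

lemma bounded_linear_scaleC_left: "bounded_linear (\<lambda>c. scaleC c x)"
  by (rule bounded_linear_intro[of _ "norm x"]) (auto intro!: ell2_eqI simp: algebra_simps scaleR_conv_of_real)

lemma bounded_linear_coeff: "bounded_linear (\<lambda>x. coeff x i)"
proof -
  have "cinner (delta i) = (\<lambda>x. coeff x i)" by (auto simp: cinner_delta)
  then show ?thesis using bounded_linear_cinner_right[of "delta i"] by metis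
qed

lemma cinner_diff_right: "cinner x (y - z) = cinner x y - cinner x z"
  by (rule linear_diff[OF bounded_linear.linear[OF bounded_linear_cinner_right]])

lemma cinner_diff_left: "cinner (x - y) z = cinner x z - cinner y z"
  by (subst (1 2 3) cinner_commute) (simp add: cinner_diff_right)

lemma cinner_sum_right: "cinner x (\<Sum>i\<in>A. f i) = (\<Sum>i\<in>A. cinner x (f i))"
  by (rule linear_sum[OF bounded_linear.linear[OF bounded_linear_cinner_right]])

text \<open>Pythagoras: truncating \<open>x\<close> to \<open>F\<close> leaves an error whose square
  is the squared norm minus the partial sum of squares, and this tends to 0.\<close>

lemma has_sum_delta: "((\<lambda>i. scaleC (coeff x i) (delta i)) has_sum x) UNIV"
proof -
  have *: "(norm (x - (\<Sum>i\<in>F. scaleC (coeff x i) (delta i))))\<^sup>2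
      = (norm x)\<^sup>2 - (\<Sum>i\<in>F. (cmod (coeff x i))\<^sup>2)" if "finite F" for F
  proof -
    let ?y = "\<Sum>i\<in>F. scaleC (coeff x i) (delta i)"
    have c: "coeff (x - ?y) i = (if i \<in> F then 0 else coeff x i)" for i
      using that by (auto simp: coeff_sum coeff_delta if_distrib cong: if_cong)
    have "(norm (x - ?y))\<^sup>2 = (\<Sum>\<^sub>\<infinity>i. (cmod (if i \<in> F then 0 else coeff x i))\<^sup>2)"
      unfolding norm_ell2_square c ..
    also have "\<dots> = (\<Sum>\<^sub>\<infinity>i\<in>UNIV - F. (cmod (coeff x i))\<^sup>2)"
      by (rule infsum_cong_neutral) auto
    also have "\<dots> = (norm x)\<^sup>2 - (\<Sum>i\<in>F. (cmod (coeff x i))\<^sup>2)"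
      using that by (subst infsum_Diff) (auto simp: square_summable_coeff norm_ell2_square)
    finally show ?thesis .
  qed
  have "((\<lambda>F. (norm x)\<^sup>2 - (\<Sum>i\<in>F. (cmod (coeff x i))\<^sup>2)) \<longlongrightarrow> (norm x)\<^sup>2 - (norm x)\<^sup>2) (finite_subsets_at_top UNIV)"
    unfolding norm_ell2_square
    by (intro tendsto_intros infsum_tendsto square_summable_coeff)
  then have "((\<lambda>F. (norm x)\<^sup>2 - (\<Sum>i\<in>F. (cmod (coeff x i))\<^sup>2)) \<longlongrightarrow> 0) (finite_subsets_at_top UNIV)"
    by (simp only: diff_self)
  then have "((\<lambda>F. (norm (x - (\<Sum>i\<in>F. scaleC (coeff x i) (delta i))))\<^sup>2) \<longlongrightarrow> 0) (finite_subsets_at_top UNIV)"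
    by (rule Lim_transform_eventually[OF _ eventually_finite_subsets_at_top_weakI])
       (auto simp: *)
  from tendsto_real_sqrt[OF this]
  have "((\<lambda>F. norm (x - (\<Sum>i\<in>F. scaleC (coeff x i) (delta i)))) \<longlongrightarrow> 0) (finite_subsets_at_top UNIV)"
    by simp
  then show ?thesis unfolding has_sum_def
    by (subst tendsto_dist_iff) (simp add: dist_norm norm_minus_commute)
qed

lemma cinner_eqI: assumes "\<And>z. cinner x z = cinner y z" shows "x = y"
proof (rule ell2_eqI)
  fix i show "coeff x i = coeff y i"
    using assms[of "delta i"] by (simp add: cinner_delta_right)
qed

lemma bounded_opsD: "T \<in> bounded_ops \<Longrightarrow> T (scaleC c x) = scaleC c (T x)"
  by (simp add: bounded_ops_def)

text \<open>Continuity and \<open>has_sum_delta\<close> reduce to the basis. Elements of the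
  operator type are only real-linear, so \<open>bounded_ops\<close> is what allows complex
  coefficients to be pulled out.\<close>

lemma op_eqI_delta:
  assumes "S \<in> bounded_ops" "T \<in> bounded_ops" "\<And>i. S (delta i) = T (delta i)"
  shows "S = T"
proof (rule blinfun_eqI)
  fix x
  have "((\<lambda>i. S (scaleC (coeff x i) (delta i))) has_sum S x) UNIV"
       "((\<lambda>i. T (scaleC (coeff x i) (delta i))) has_sum T x) UNIV"
    by (intro has_sum_bounded_linear[OF blinfun.bounded_linear_right] has_sum_delta)+
  then show "S x = T x"
    using assms by (simp add: bounded_opsD has_sum_unique)
qed

lemma bounded_ops_simps [simp, intro]:
  "0 \<in> bounded_ops" "id_blinfun \<in> bounded_ops"
  "S \<in> bounded_ops \<Longrightarrow> T \<in> bounded_ops \<Longrightarrow> S + T \<in> bounded_ops"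
  "S \<in> bounded_ops \<Longrightarrow> T \<in> bounded_ops \<Longrightarrow> S - T \<in> bounded_ops"
  "S \<in> bounded_ops \<Longrightarrow> T \<in> bounded_ops \<Longrightarrow> S o\<^sub>L T \<in> bounded_ops"
  "T \<in> bounded_ops \<Longrightarrow> scale_op c T \<in> bounded_ops"
  "ketbra \<xi> \<eta> \<in> bounded_ops"
  by (auto simp: bounded_ops_def blinfun.bilinear_simps ketbra.rep_eq cinner_scaleC_right
      intro!: ell2_eqI simp: algebra_simps)

lemma bounded_ops_sum: "(\<And>i. i \<in> A \<Longrightarrow> f i \<in> bounded_ops) \<Longrightarrow> (\<Sum>i\<in>A. f i) \<in> bounded_ops"
  by (induction A rule: infinite_finite_induct) auto

lemma closed_bounded_ops: "closed (bounded_ops :: 'i op set)"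
proof -
  have "bounded_ops = (\<Inter>c. \<Inter>x. {T :: 'i op. T (scaleC c x) = scaleC c (T x)})"
    by (auto simp: bounded_ops_def)
  also have "closed \<dots>"
    by (intro closed_INT ballI closed_Collect_eq continuous_intros
        bounded_linear.continuous_on[OF bounded_linear_scaleC])
  finally show ?thesis .
qed

lemma bounded_ops_has_sum:
  assumes "(f has_sum X) A" "\<And>i. i \<in> A \<Longrightarrow> f i \<in> bounded_ops"
  shows "X \<in> bounded_ops"
proof -
  have "(sum f \<longlongrightarrow> X) (finite_subsets_at_top A)" using assms(1) by (simp add: has_sum_def)
  then show ?thesis
    by (rule Lim_in_closed_set[OF closed_bounded_ops _ finite_subsets_at_top_neq_bot, rotated])
       (auto intro!: eventually_finite_subsets_at_top_weakI bounded_ops_sum assms)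
qed

section \<open>Adjoints\<close>

text \<open>Riesz representation by hand. The coefficients \<open>g\<close> of the representing
  vector are forced. For a truncation \<open>v\<close> of \<open>g\<close> the number
  \<open>s\<close> is both the squared norm of \<open>v\<close> and the value <x, T v>, so
  Cauchy-Schwarz bounds all partial sums of squares at once.\<close>

lemma adjoint_vector:
  fixes T :: "'i op"
  assumes T: "T \<in> bounded_ops"
  shows "\<exists>y. norm y \<le> norm x * norm T \<and> (\<forall>z. cinner y z = cinner x (T z))"
proof -
  define g where "g i = cnj (cinner x (T (delta i)))" for i
  have bd: "(\<Sum>i\<in>F. (cmod (g i))\<^sup>2) \<le> (norm x * norm T)\<^sup>2" if F: "finite F" for F
  proof -
    define s where "s = (\<Sum>i\<in>F. (cmod (g i))\<^sup>2)"
    define v where "v = (\<Sum>i\<in>F. scaleC (g i) (delta i))"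
    have cv: "coeff v i = (if i \<in> F then g i else 0)" for i
      using F by (auto simp: v_def coeff_sum coeff_delta if_distrib cong: if_cong)
    have "(norm v)\<^sup>2 = (\<Sum>\<^sub>\<infinity>i. (cmod (if i \<in> F then g i else 0))\<^sup>2)"
      by (simp add: norm_ell2_square cv)
    also have "\<dots> = (\<Sum>\<^sub>\<infinity>i\<in>F. (cmod (g i))\<^sup>2)" by (rule infsum_cong_neutral) auto
    finally have nv: "(norm v)\<^sup>2 = s" using F by (simp add: s_def)
    have "cinner x (T v) = (\<Sum>i\<in>F. g i * cinner x (T (delta i)))"
      by (simp add: v_def blinfun.sum_right bounded_opsD[OF T] cinner_sum_right cinner_scaleC_right)
    also have "\<dots> = (\<Sum>i\<in>F. complex_of_real ((cmod (g i))\<^sup>2))"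
      by (intro sum.cong refl) (subst complex_norm_square, simp add: g_def mult.commute)
    finally have "cinner x (T v) = complex_of_real s" by (simp add: s_def)
    moreover have s0: "s \<ge> 0" by (simp add: s_def sum_nonneg)
    ultimately have "s \<le> norm x * norm (T v)" using cmod_cinner_le[of x "T v"] by simp
    also have "\<dots> \<le> norm x * (norm T * norm v)"
      by (intro mult_left_mono norm_blinfun) auto
    finally have "norm v * norm v \<le> (norm x * norm T) * norm v"
      by (simp add: nv[symmetric] power2_eq_square mult_ac)
    then have "norm v \<le> norm x * norm T"
      by (cases "norm v = 0") (auto simp: mult_le_cancel_right)
    then have "(norm v)\<^sup>2 \<le> (norm x * norm T)\<^sup>2" by (intro power_mono) auto
    then show ?thesis by (simp add: nv s_def)
  qed
  have sg: "(\<lambda>i. (cmod (g i))\<^sup>2) summable_on UNIV"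
    using bd by (intro nonneg_bdd_above_summable_on) (auto simp: bdd_above_def)
  define y where "y = Abs_ell2 g"
  have cy: "coeff y = g" using sg by (simp add: y_def Abs_ell2_inverse)
  have "(norm y)\<^sup>2 \<le> (norm x * norm T)\<^sup>2"
    unfolding norm_ell2_square cy using bd sg by (intro infsum_le_finite_sums) auto
  then have "norm y \<le> norm x * norm T" by (simp add: power2_le_iff_abs_le)
  moreover have "cinner y z = cinner x (T z)" for z
  proof -
    have "((\<lambda>i. cinner x (T (scaleC (coeff z i) (delta i)))) has_sum cinner x (T z)) UNIV"
      by (intro has_sum_bounded_linear[OF bounded_linear_cinner_right]
          has_sum_bounded_linear[OF blinfun.bounded_linear_right] has_sum_delta)
    moreover have "cinner x (T (scaleC (coeff z i) (delta i))) = cnj (coeff y i) * coeff z i" for i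
      by (simp add: bounded_opsD[OF T] cinner_scaleC_right cy g_def mult.commute)
    ultimately show ?thesis by (simp add: cinner_def infsumI)
  qed
  ultimately show ?thesis by blast
qed

lemma adjoint_exists:
  fixes T :: "'i op"
  assumes T: "T \<in> bounded_ops"
  shows "\<exists>S :: 'i op. norm S \<le> norm T \<and> (\<forall>x y. cinner (blinfun_apply S x) y = cinner x (blinfun_apply T y))"
proof -
  obtain f where f: "\<And>x. norm (f x) \<le> norm x * norm T" "\<And>x z. cinner (f x) z = cinner x (T z)"
    using adjoint_vector[OF T] by metis
  have "bounded_linear f"
  proof (rule bounded_linear_intro[OF _ _ f(1)])
    show "f (x + y) = f x + f y" for x y
      by (rule cinner_eqI) (simp add: f cinner_add_left)
    show "f (r *\<^sub>R x) = r *\<^sub>R f x" for r x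
      by (rule cinner_eqI) (simp add: f scaleR_scaleC cinner_scaleC_left)
  qed
  then have "blinfun_apply (Blinfun f) = f" by (rule bounded_linear_Blinfun_apply)
  moreover have "norm (Blinfun f) \<le> norm T"
    by (rule norm_blinfun_bound) (simp_all add: calculation f mult.commute[of "norm T"])
  ultimately show ?thesis using f(2) by (intro exI[of _ "Blinfun f"]) auto
qed

text \<open>Resolves the definite description in \<open>adj\<close>: every later computation of an
  adjoint exhibits a candidate and checks the pairing.\<close>

lemma adjoint_unique:
  fixes S T :: "'i op"
  assumes "\<And>x y. cinner (blinfun_apply S x) y = cinner x (blinfun_apply T y)"
  shows "adj T = S"
  unfolding adj_def
proof (rule the_equality)
  show "\<forall>x y. cinner (S x) y = cinner x (T y)" using assms by blast
  fix S' assume "\<forall>x y. cinner (blinfun_apply S' x) y = cinner x (T y)"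
  then show "S' = S" by (intro blinfun_eqI cinner_eqI) (simp add: assms)
qed

lemma
  assumes "T \<in> bounded_ops"
  shows cinner_adj_left: "cinner (adj T x) y = cinner x (T y)"
    and norm_adj_le: "norm (adj T) \<le> norm T"
  using adjoint_exists[OF assms] adjoint_unique by metis+

lemma cinner_adj_right: "T \<in> bounded_ops \<Longrightarrow> cinner x (adj T y) = cinner (T x) y"
  by (subst (1 2) cinner_commute) (simp add: cinner_adj_left)

lemma adj_bounded_ops [simp, intro]: "T \<in> bounded_ops \<Longrightarrow> adj T \<in> bounded_ops"
  by (auto simp: bounded_ops_def[of] intro!: cinner_eqI simp: cinner_adj_left cinner_scaleC_left)

lemma adj_adj [simp]: "T \<in> bounded_ops \<Longrightarrow> adj (adj T) = T"
  by (rule adjoint_unique) (simp add: cinner_adj_right)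

lemma norm_adj [simp]: "T \<in> bounded_ops \<Longrightarrow> norm (adj T) = norm T"
  by (metis adj_adj adj_bounded_ops norm_adj_le order_antisym)

lemma adj_compose: "S \<in> bounded_ops \<Longrightarrow> T \<in> bounded_ops \<Longrightarrow> adj (S o\<^sub>L T) = adj T o\<^sub>L adj S"
  by (rule adjoint_unique) (simp add: cinner_adj_left)

lemma adj_add: "S \<in> bounded_ops \<Longrightarrow> T \<in> bounded_ops \<Longrightarrow> adj (S + T) = adj S + adj T"
  by (rule adjoint_unique)
     (simp add: cinner_adj_left blinfun.bilinear_simps cinner_add_left cinner_add_right)

lemma adj_scale: "T \<in> bounded_ops \<Longrightarrow> adj (scale_op c T) = scale_op (cnj c) (adj T)"
  by (rule adjoint_unique) (simp add: cinner_adj_left cinner_scaleC_left cinner_scaleC_right)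

lemma adj_zero [simp]: "adj 0 = 0"
  by (rule adjoint_unique) (simp add: cinner_def)

lemma adj_sum: "(\<And>i. i \<in> A \<Longrightarrow> f i \<in> bounded_ops) \<Longrightarrow> adj (\<Sum>i\<in>A. f i) = (\<Sum>i\<in>A. adj (f i))"
  by (induction A rule: infinite_finite_induct) (auto simp: adj_add bounded_ops_sum)

lemma adj_ketbra [simp]: "adj (ketbra x y) = ketbra y x"
  by (rule adjoint_unique)
     (simp add: ketbra.rep_eq cinner_scaleC_left cinner_scaleC_right mult.commute
       cinner_commute[of _ x, symmetric])

lemma compose_ketbra: "T \<in> bounded_ops \<Longrightarrow> T o\<^sub>L ketbra x y = ketbra (T x) y"
  by (rule blinfun_eqI) (simp add: ketbra.rep_eq bounded_opsD)

lemma ketbra_compose: "T \<in> bounded_ops \<Longrightarrow> ketbra x y o\<^sub>L T = ketbra x (adj T y)"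
  by (rule blinfun_eqI) (simp add: ketbra.rep_eq cinner_adj_left)

lemma ketbra_simps:
  "ketbra (x + x') y = ketbra x y + ketbra x' y" "ketbra (x - x') y = ketbra x y - ketbra x' y"
  "ketbra x (y + y') = ketbra x y + ketbra x y'" "ketbra x (y - y') = ketbra x y - ketbra x y'"
  "ketbra (scaleC c x) y = scale_op c (ketbra x y)" "ketbra x (scaleC c y) = scale_op (cnj c) (ketbra x y)"
  "ketbra 0 y = 0"
  by (auto intro!: blinfun_eqI ell2_eqI simp: ketbra.rep_eq blinfun.bilinear_simps cinner_add_left
      cinner_diff_left cinner_scaleC_left algebra_simps)

lemma norm_ketbra_le: "norm (ketbra x y) \<le> norm x * norm y"
proof (rule norm_blinfun_bound)
  fix z
  have "cmod (cinner y z) * norm x \<le> norm y * norm z * norm x"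
    by (intro mult_right_mono cmod_cinner_le) auto
  then show "norm (ketbra x y z) \<le> norm x * norm y * norm z" by (simp add: ketbra.rep_eq mult_ac)
qed auto

lemma norm_scale_op [simp]: "norm (scale_op c T) = cmod c * norm T"
proof -
  have le: "norm (scale_op c T) \<le> cmod c * norm T" for c and T :: "'a op"
    by (rule norm_blinfun_bound) (auto simp: mult.assoc intro!: mult_left_mono norm_blinfun)
  show ?thesis
  proof (cases "c = 0")
    case False
    have "cmod c * norm T = cmod c * norm (scale_op (inverse c) (scale_op c T))" using False by simp
    also have "\<dots> \<le> cmod c * (cmod (inverse c) * norm (scale_op c T))"
      by (intro mult_left_mono le) auto
    also have "\<dots> = norm (scale_op c T)" using False by (simp add: norm_inverse)
    finally show ?thesis using le[of c T] by simp
  qed simp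
qed

lemma bounded_linear_scale_op: "bounded_linear (scale_op c)"
  unfolding scale_op_def by (rule bounded_bilinear.bounded_linear_right[OF bounded_bilinear_blinfun_compose])

lemma scale_op_compose_left: "scale_op c S o\<^sub>L T = scale_op c (S o\<^sub>L T)"
  by (rule blinfun_eqI) simp

lemma scale_op_compose_right: "S \<in> bounded_ops \<Longrightarrow> S o\<^sub>L scale_op c T = scale_op c (S o\<^sub>L T)"
  by (rule blinfun_eqI) (simp add: bounded_opsD)

interpretation blinfun_compose: bounded_bilinear "(o\<^sub>L)"
  by (rule bounded_bilinear_blinfun_compose)

lemma bounded_linear_ketbra_left: "bounded_linear (\<lambda>x. ketbra x y)"
  by (rule bounded_linear_intro[of _ "norm y"])
     (auto simp: ketbra_simps scaleR_scaleC norm_ketbra_le intro!: blinfun_eqI simp: blinfun.bilinear_simps)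

lemma bounded_linear_ketbra_right: "bounded_linear (\<lambda>y. ketbra x y)"
  by (rule bounded_linear_intro[of _ "norm x"])
     (auto simp: ketbra_simps scaleR_scaleC norm_ketbra_le mult.commute[of "norm x"] intro!: blinfun_eqI simp: blinfun.bilinear_simps norm_ketbra_le[of x, unfolded mult.commute[of "norm x"]])

section \<open>Compact operators\<close>

text \<open>Trades the closure of the image of the ball for any compact set containing that image;
  such sets are easy to push through sums and compositions.\<close>

lemma compact_opsI:
  assumes "T \<in> bounded_ops" "compact K" "\<And>x. norm x \<le> 1 \<Longrightarrow> T x \<in> K"
  shows "T \<in> compact_ops"
proof -
  have "closure (T ` cball 0 1) \<subseteq> K"
    using assms(2,3) by (intro closure_minimal compact_imp_closed) auto
  then have "compact (closure (T ` cball 0 1))"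
    using assms(2) by (metis closed_closure compact_Int_closed inf.absorb_iff2)
  then show ?thesis using assms(1) by (simp add: compact_ops_def)
qed

lemma compact_opsE:
  assumes "T \<in> compact_ops"
  obtains K where "T \<in> bounded_ops" "compact K" "\<And>x. norm x \<le> 1 \<Longrightarrow> T x \<in> K"
  using assms closure_subset[of "T ` cball 0 1"]
  by (intro that[of "closure (T ` cball 0 1)"]) (auto simp: compact_ops_def)

lemma compact_ops_bounded: "T \<in> compact_ops \<Longrightarrow> T \<in> bounded_ops"
  by (simp add: compact_ops_def)

lemma ketbra_compact [simp]: "ketbra x y \<in> compact_ops"
proof (rule compact_opsI)
  show "compact ((\<lambda>c. scaleC c x) ` cball 0 (norm y))"
    by (intro compact_continuous_image bounded_linear.continuous_on[OF bounded_linear_scaleC_left]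
        continuous_on_id compact_cball)
  fix z :: "'a ell2" assume "norm z \<le> 1"
  then have "norm y * norm z \<le> norm y" by (simp add: mult_left_le)
  then have "cmod (cinner y z) \<le> norm y" using cmod_cinner_le[of y z] by linarith
  then show "ketbra x y z \<in> (\<lambda>c. scaleC c x) ` cball 0 (norm y)"
    by (auto simp: ketbra.rep_eq)
qed auto

lemma compact_ops_add: assumes "S \<in> compact_ops" "T \<in> compact_ops" shows "S + T \<in> compact_ops"
proof -
  obtain K where K: "S \<in> bounded_ops" "compact K" "\<And>x. norm x \<le> 1 \<Longrightarrow> S x \<in> K"
    using assms(1) by (rule compact_opsE) blast
  obtain L where L: "T \<in> bounded_ops" "compact L" "\<And>x. norm x \<le> 1 \<Longrightarrow> T x \<in> L"
    using assms(2) by (rule compact_opsE) blast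
  show ?thesis
    by (rule compact_opsI[OF _ compact_sums[OF K(2) L(2)]]) (use K L in \<open>auto simp: blinfun.add_left\<close>)
qed

lemma compact_ops_compose_left:
  assumes "S \<in> bounded_ops" "T \<in> compact_ops" shows "S o\<^sub>L T \<in> compact_ops"
proof -
  obtain L where L: "T \<in> bounded_ops" "compact L" "\<And>x. norm x \<le> 1 \<Longrightarrow> T x \<in> L"
    using assms(2) by (rule compact_opsE) blast
  show ?thesis
  proof (rule compact_opsI)
    show "compact (blinfun_apply S ` L)"
      by (intro compact_continuous_image L continuous_intros)
  qed (use L assms in auto)
qed

lemma compact_ops_compose_right:
  assumes "S \<in> compact_ops" "T \<in> bounded_ops" shows "S o\<^sub>L T \<in> compact_ops"
proof -
  obtain L where L: "S \<in> bounded_ops" "compact L" "\<And>x. norm x \<le> 1 \<Longrightarrow> S x \<in> L"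
    using assms(1) by (rule compact_opsE) blast
  \<comment> \<open>\<open>T\<close> maps the unit ball into the ball of radius \<open>r\<close>, so
    the image under \<open>S\<close> lies in \<open>r\<close> times \<open>L\<close>. Adding 1 keeps
    \<open>r\<close> invertible even if \<open>T\<close> is zero.\<close>
  define r where "r = norm T + 1"
  have r: "r > 0" by (simp add: r_def add_nonneg_pos)
  show ?thesis
  proof (rule compact_opsI)
    show "compact ((\<lambda>x. r *\<^sub>R x) ` L)"
      by (intro compact_scaling L)
    fix x :: "'a ell2" assume "norm x \<le> 1"
    have "norm (T x) \<le> norm T * norm x" by (rule norm_blinfun)
    also have "\<dots> \<le> r" using \<open>norm x \<le> 1\<close> mult_left_le[of "norm x" "norm T"] by (simp add: r_def)
    finally have "norm (inverse r *\<^sub>R T x) \<le> 1" using r by (simp add: field_simps)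
    from L(3)[OF this] have "S (inverse r *\<^sub>R T x) \<in> L" .
    moreover have "(S o\<^sub>L T) x = r *\<^sub>R S (inverse r *\<^sub>R T x)"
      using r by (simp add: blinfun.scaleR_right)
    ultimately show "(S o\<^sub>L T) x \<in> (\<lambda>x. r *\<^sub>R x) ` L" by blast
  qed (use L assms in auto)
qed

lemma homothety_bounded_ops [simp]: "homothety c \<in> bounded_ops"
  by (auto simp: bounded_ops_def homothety.rep_eq mult_ac)

lemma compact_ops_scale: "T \<in> compact_ops \<Longrightarrow> scale_op c T \<in> compact_ops"
  unfolding scale_op_def by (rule compact_ops_compose_left) auto

lemma zero_compact [simp]: "0 \<in> compact_ops"
  using ketbra_compact[of 0 0] by (simp add: ketbra_simps)

lemma compact_ops_subspace: "op.subspace compact_ops"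
  by (rule op.subspaceI) (auto intro: compact_ops_add compact_ops_scale)

text \<open>The compact operators form a two-sided ideal, so a strict sum may take any bounded
  complex-linear operator as its value.\<close>

lemma multipliers_compact: "multipliers compact_ops = bounded_ops"
  by (auto simp: multipliers_def intro: compact_ops_compose_left compact_ops_compose_right)

text \<open>Coordinate projections converge uniformly on the compact image of the unit ball.\<close>

lemma compact_approx:
  fixes T :: "'i op"
  assumes "T \<in> compact_ops" "e > 0"
  shows "\<exists>F. finite F \<and> norm (T - (\<Sum>i\<in>F. ketbra (delta i) (adj T (delta i)))) \<le> e"
proof -
  obtain K where K: "T \<in> bounded_ops" "compact K" "\<And>x. norm x \<le> 1 \<Longrightarrow> T x \<in> K"
    using assms(1) by (rule compact_opsE) blast
  define P :: "'i set \<Rightarrow> 'i op" where "P F = (\<Sum>i\<in>F. ketbra (delta i) (delta i))" for F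
  have Papp: "P F x = (\<Sum>i\<in>F. scaleC (coeff x i) (delta i))" for F and x :: "'i ell2"
    by (simp add: P_def blinfun.sum_left ketbra.rep_eq cinner_delta)
  have cP: "coeff (x - P F x) i = (if i \<in> F then 0 else coeff x i)" if "finite F" for F :: "'i set" and x :: "'i ell2" and i
    using that by (auto simp: Papp coeff_sum coeff_delta if_distrib cong: if_cong)
  have sm: "(\<lambda>i. (cmod (if i \<in> F then 0 else coeff x i))\<^sup>2) summable_on UNIV"
      if "finite F" for F :: "'i set" and x :: "'i ell2"
    using square_summable_coeff[of "x - P F x"] unfolding cP[OF that] .
  have mono: "norm (x - P G x) \<le> norm (x - P F x)" if "finite F" "finite G" "F \<subseteq> G"
    for x :: "'i ell2" and F G :: "'i set"
  proof -
    have "(norm (x - P G x))\<^sup>2 \<le> (norm (x - P F x))\<^sup>2"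
      unfolding norm_ell2_square
      by (rule infsum_mono) (use that in \<open>auto simp: sm cP simp del: coeff_simps(4)\<close>)
    then show ?thesis by (simp add: power2_le_iff_abs_le)
  qed
  have nP: "norm (x - P F x) \<le> norm x" if "finite F" for F :: "'i set" and x :: "'i ell2"
    using mono[of "{}" F x] that by (simp add: P_def)
  have "\<forall>x. \<exists>F. finite F \<and> norm (x - P F x) < e / 2"
  proof
    fix x :: "'i ell2"
    have "(sum (\<lambda>i. scaleC (coeff x i) (delta i)) \<longlongrightarrow> x) (finite_subsets_at_top UNIV)"
      using has_sum_delta[of x] by (simp add: has_sum_def)
    then have "\<forall>\<^sub>F F in finite_subsets_at_top UNIV. dist (P F x) x < e / 2"
      using assms(2) by (auto simp: Papp dest!: tendstoD[of _ _ _ "e/2"])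
    then show "\<exists>F. finite F \<and> norm (x - P F x) < e / 2"
      by (auto simp: eventually_finite_subsets_at_top dist_norm norm_minus_commute)
  qed
  then obtain \<Phi> where \<Phi>: "\<And>x. finite (\<Phi> x)" "\<And>x. norm (x - P (\<Phi> x) x) < e / 2" by metis
  obtain D where D: "finite D" "D \<subseteq> K" "K \<subseteq> (\<Union>x\<in>D. ball x (e/2))"
  proof -
    have "K \<subseteq> (\<Union>x\<in>K. ball x (e/2))" using assms(2) by force
    then show ?thesis using that by (rule compactE_image[OF K(2) open_ball])
  qed
  \<comment> \<open>One coordinate set serves the whole finite net: enlarging it only shrinks the
    truncation error, by \<open>mono\<close>.\<close>
  define F where "F = (\<Union>x\<in>D. \<Phi> x)"
  have F: "finite F" using D \<Phi> by (auto simp: F_def)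
  have "norm (y - P F y) \<le> e" if "y \<in> K" for y
  proof -
    obtain x where x: "x \<in> D" "dist x y < e / 2" using D(3) \<open>y \<in> K\<close> by (auto simp: subset_iff)
    have "y - P F y = (x - P F x) + ((y - x) - P F (y - x))" by (simp add: blinfun.diff_right)
    then have "norm (y - P F y) \<le> norm (x - P F x) + norm ((y - x) - P F (y - x))"
      by (metis norm_triangle_ineq)
    also have "norm (x - P F x) \<le> norm (x - P (\<Phi> x) x)"
      using x F \<Phi> by (intro mono) (auto simp: F_def)
    also have "norm ((y - x) - P F (y - x)) \<le> norm (y - x)" by (rule nP[OF F])
    finally show ?thesis using \<Phi>(2)[of x] x(2) by (simp add: dist_norm norm_minus_commute)
  qed note PK = this
  have "norm (T - (\<Sum>i\<in>F. ketbra (delta i) (adj T (delta i)))) \<le> e"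
  proof (rule norm_blinfun_bound)
    fix x
    have eq: "(T - (\<Sum>i\<in>F. ketbra (delta i) (adj T (delta i)))) x = T x - P F (T x)" for x
      using K(1) by (simp add: Papp blinfun.diff_left blinfun.sum_left ketbra.rep_eq cinner_adj_left cinner_delta)
    show "norm ((T - (\<Sum>i\<in>F. ketbra (delta i) (adj T (delta i)))) x) \<le> e * norm x"
    proof (cases "x = 0")
      case False
      have "norm (T (inverse (norm x) *\<^sub>R x) - P F (T (inverse (norm x) *\<^sub>R x))) \<le> e"
        using False by (intro PK K(3)) auto
      also have "T (inverse (norm x) *\<^sub>R x) - P F (T (inverse (norm x) *\<^sub>R x)) = inverse (norm x) *\<^sub>R (T x - P F (T x))"
        by (simp add: blinfun.scaleR_right algebra_simps)
      also have "norm (inverse (norm x) *\<^sub>R (T x - P F (T x))) = norm (T x - P F (T x)) / norm x"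
        by (simp add: divide_inverse mult.commute del: inverse_eq_divide)
      finally show ?thesis using False by (simp add: eq divide_le_eq)
    qed (simp add: eq blinfun.bilinear_simps)
  qed (use assms in auto)
  then show ?thesis using F by blast
qed

section \<open>The right regular representation\<close>

lemma coeff_right_regular [simp]: "coeff (right_regular t x) i = coeff x (i + t)"
  by (simp add: right_regular.rep_eq translate.rep_eq)

lemma right_regular_bounded_ops [simp]: "right_regular t \<in> bounded_ops"
  by (auto simp: bounded_ops_def intro!: ell2_eqI)

lemma right_regular_add: "right_regular (s + t) = right_regular s o\<^sub>L right_regular t"
  by (rule blinfun_eqI, rule ell2_eqI) (simp add: add.assoc)

lemma right_regular_zero [simp]: "right_regular 0 = id_blinfun"
  by (rule blinfun_eqI, rule ell2_eqI) simp

lemma norm_right_regular [simp]: "norm (right_regular m x) = norm x"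
  using infsum_reindex_bij_betw[OF bij_add_right[of m], of "\<lambda>\<nu>. (cmod (coeff x \<nu>))\<^sup>2"]
  by (simp add: norm_ell2_def)

lemma adj_right_regular [simp]: "adj (right_regular t) = right_regular (- t)"
proof (rule adjoint_unique)
  fix x y :: "'a ell2"
  have "cinner x (right_regular t y) = (\<Sum>\<^sub>\<infinity>i. cnj (coeff (right_regular (- t) x) (i + t)) * coeff y (i + t))"
    by (simp add: cinner_def)
  also have "\<dots> = cinner (right_regular (- t) x) y"
    unfolding cinner_def
    by (rule infsum_reindex_bij_betw[OF bij_add_right[of t],
        of "\<lambda>i. cnj (coeff (right_regular (- t) x) i) * coeff y i"])
  finally show "cinner (right_regular (- t) x) y = cinner x (right_regular t y)" ..
qed

lemma right_regular_compose [simp]: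
  "right_regular s o\<^sub>L right_regular t = right_regular (s + t)"
  by (simp add: right_regular_add)

lemma unitary_rep_right_regular: "unitary_rep right_regular"
  by (simp add: unitary_rep_def)

lemma right_regular_delta [simp]: "right_regular t (delta i) = delta (i - t)"
  by (rule ell2_eqI) (auto simp: coeff_delta)

lemma Ad_ketbra: "Ad right_regular t (ketbra x y) = ketbra (right_regular t x) (right_regular t y)"
  by (simp add: Ad_def compose_ketbra ketbra_compose)

lemma bounded_linear_Ad: "bounded_linear (Ad u t)"
proof -
  have "bounded_linear (\<lambda>T. (u t o\<^sub>L T) o\<^sub>L adj (u t))"
    by (rule bounded_linear_compose[OF blinfun_compose.bounded_linear_left blinfun_compose.bounded_linear_right])
  then show ?thesis by (simp add: Ad_def[abs_def])
qed

lemmas Ad_sum = linear_sum[OF bounded_linear.linear[OF bounded_linear_Ad]]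
  and Ad_diff = linear_diff[OF bounded_linear.linear[OF bounded_linear_Ad]]
  and Ad_add = linear_add[OF bounded_linear.linear[OF bounded_linear_Ad]]
  and Ad_zero_op = linear_0[OF bounded_linear.linear[OF bounded_linear_Ad]]

lemma Ad_bounded_ops [simp]: "T \<in> bounded_ops \<Longrightarrow> Ad right_regular t T \<in> bounded_ops"
  by (simp add: Ad_def)

lemma Ad_compact_ops: "T \<in> compact_ops \<Longrightarrow> Ad right_regular t T \<in> compact_ops"
  unfolding Ad_def by (intro compact_ops_compose_left compact_ops_compose_right) auto

lemma adj_id [simp]: "adj id_blinfun = id_blinfun"
  by (rule adjoint_unique) simp

lemma Ad_zero [simp]: "Ad right_regular 0 T = T"
  by (rule blinfun_eqI) (simp add: Ad_def)

lemma Ad_scale: "Ad right_regular t (scale_op c T) = scale_op c (Ad right_regular t T)"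
  by (rule blinfun_eqI) (simp add: Ad_def bounded_opsD[OF right_regular_bounded_ops])

lemma Ad_adj: "T \<in> bounded_ops \<Longrightarrow> adj (Ad right_regular t T) = Ad right_regular t (adj T)"
  by (rule blinfun_eqI) (simp add: Ad_def adj_compose)

lemma Ad_mult: "Ad right_regular t (S o\<^sub>L T) = Ad right_regular t S o\<^sub>L Ad right_regular t T"
proof (rule blinfun_eqI)
  fix x
  have "right_regular (- t) (right_regular t y) = y" for y :: "'a ell2"
    by (rule ell2_eqI) simp
  then show "Ad right_regular t (S o\<^sub>L T) x = (Ad right_regular t S o\<^sub>L Ad right_regular t T) x"
    by (simp add: Ad_def)
qed

lemma right_regular_apply_twice [simp]: "right_regular s (right_regular t x) = right_regular (s + t) x"
  by (rule ell2_eqI) (simp add: add.assoc)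

lemma Ad_Ad: "Ad right_regular s (Ad right_regular t T) = Ad right_regular (s + t) T"
proof (rule blinfun_eqI)
  fix x
  have "right_regular (- t) (right_regular (- s) x) = right_regular (- (s + t)) x"
    by (rule ell2_eqI) (simp add: minus_add add.assoc)
  then show "Ad right_regular s (Ad right_regular t T) x = Ad right_regular (s + t) T x"
    by (simp add: Ad_def)
qed

lemma norm_Ad_le: "norm (Ad right_regular t T) \<le> norm T"
proof (rule norm_blinfun_bound)
  fix x
  show "norm (Ad right_regular t T x) \<le> norm T * norm x"
    using norm_blinfun[of T "right_regular (- t) x"] by (simp add: Ad_def)
qed auto

lemma is_action_Ad: "is_action (Ad right_regular) compact_ops"
proof -
  have "bij_betw (Ad right_regular t) compact_ops compact_ops" for t :: 'a
    by (rule bij_betw_byWitness[where f' = "Ad right_regular (- t)"])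
       (auto simp: Ad_Ad intro: Ad_compact_ops)
  then show ?thesis
    by (simp add: is_action_def star_isomorphism_def op_alg_def Ad_scale Ad_adj compact_ops_bounded
        Ad_mult Ad_Ad Ad_add)
qed

section \<open>Strict summation\<close>

lemma has_sum_sum:
  fixes f :: "'a \<Rightarrow> 'b \<Rightarrow> 'c::real_normed_vector"
  assumes "finite G" "\<And>i. i \<in> G \<Longrightarrow> (f i has_sum s i) A"
  shows "((\<lambda>x. \<Sum>i\<in>G. f i x) has_sum (\<Sum>i\<in>G. s i)) A"
  using assms by (induction G rule: finite_induct) (auto intro: has_sum_add)

text \<open>Interchange of limits: it suffices to approximate by convergent families whose partial
  sums are close uniformly in the finite set, with close limits.\<close>

lemma has_sum_approx:
  fixes h :: "'a \<Rightarrow> 'b::real_normed_vector"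
  assumes "\<And>e. e > 0 \<Longrightarrow> \<exists>h' s'. (h' has_sum s') A \<and> norm (s - s') \<le> e \<and>
    (\<forall>F. finite F \<and> F \<subseteq> A \<longrightarrow> norm (sum h F - sum h' F) \<le> e)"
  shows "(h has_sum s) A"
  unfolding has_sum_def
proof (rule tendstoI)
  fix e :: real assume "e > 0"
  then have "e / 4 > 0" by simp
  from assms[OF this] obtain h' s' where *: "(h' has_sum s') A" "norm (s - s') \<le> e / 4"
    "\<And>F. finite F \<Longrightarrow> F \<subseteq> A \<Longrightarrow> norm (sum h F - sum h' F) \<le> e / 4" by blast
  have "\<forall>\<^sub>F F in finite_subsets_at_top A. dist (sum h' F) s' < e / 4"
    using *(1) \<open>e / 4 > 0\<close> unfolding has_sum_def by (rule tendstoD)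
  moreover have "\<forall>\<^sub>F F in finite_subsets_at_top A. norm (sum h F - sum h' F) \<le> e / 4"
    by (rule eventually_finite_subsets_at_top_weakI) (rule *(3))
  ultimately show "\<forall>\<^sub>F F in finite_subsets_at_top A. dist (sum h F) s < e"
  proof eventually_elim
    case (elim F)
    have eq: "sum h F - s = (sum h F - sum h' F) + (sum h' F - s') - (s - s')" by simp
    have "norm (sum h F - s) \<le> norm (sum h F - sum h' F) + norm (sum h' F - s') + norm (s - s')"
      unfolding eq
      using norm_triangle_ineq4[of "(sum h F - sum h' F) + (sum h' F - s')" "s - s'"]
        norm_triangle_ineq[of "sum h F - sum h' F" "sum h' F - s'"] by linarith
    then show ?case using elim *(2) \<open>e > 0\<close> by (simp add: dist_norm)
  qed
qed

text \<open>Uniformly bounded partial sums that converge on the basis converge strongly.\<close>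

lemma has_sum_pointwise:
  fixes f :: "'t \<Rightarrow> 'i op"
  assumes bd: "\<And>F. finite F \<Longrightarrow> norm (sum f F) \<le> C"
    and f: "\<And>t. f t \<in> bounded_ops" and X: "X \<in> bounded_ops"
    and d: "\<And>i. ((\<lambda>t. f t (delta i)) has_sum X (delta i)) UNIV"
  shows "((\<lambda>t. f t v) has_sum X v) UNIV"
proof (rule has_sum_approx)
  fix e :: real assume e: "e > 0"
  \<comment> \<open>A positive bound for both the partial sums and the limit, so that an error of
    \<open>e / K\<close> in the vector costs at most \<open>e\<close> in either place.\<close>
  define K where "K = C + norm X + 1"
  have "0 \<le> C" using bd[of "{}"] by simp
  then have K: "K > 0" "C \<le> K" "norm X \<le> K" by (simp_all add: K_def add_nonneg_pos)
  obtain G where G: "finite G" "dist (\<Sum>i\<in>G. scaleC (coeff v i) (delta i)) v \<le> e / K"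
    using has_sum_finite_approximation[OF has_sum_delta, of "e / K" v] e K by auto
  define v' where "v' = (\<Sum>i\<in>G. scaleC (coeff v i) (delta i))"
  have nv: "norm (v - v') \<le> e / K" using G by (simp add: v'_def dist_norm norm_minus_commute)
  have "((\<lambda>t. \<Sum>i\<in>G. scaleC (coeff v i) (f t (delta i))) has_sum
      (\<Sum>i\<in>G. scaleC (coeff v i) (X (delta i)))) UNIV"
  proof (rule has_sum_sum)
    fix i
    show "((\<lambda>t. scaleC (coeff v i) (f t (delta i))) has_sum scaleC (coeff v i) (X (delta i))) UNIV"
      by (rule has_sum_bounded_linear[OF bounded_linear_scaleC d])
  qed (use G in auto)
  then have 1: "((\<lambda>t. f t v') has_sum X v') UNIV"
    by (simp add: v'_def blinfun.sum_right bounded_opsD[OF f] bounded_opsD[OF X])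
  have 2: "norm (X v - X v') \<le> e"
  proof -
    have "norm (X v - X v') \<le> norm X * norm (v - v')"
      unfolding blinfun.diff_right[symmetric] by (rule norm_blinfun)
    also have "\<dots> \<le> K * (e / K)" by (intro mult_mono K nv) (use K in auto)
    finally show ?thesis using K by simp
  qed
  have 3: "norm ((\<Sum>t\<in>F. f t v) - (\<Sum>t\<in>F. f t v')) \<le> e" if "finite F" for F
  proof -
    have "(\<Sum>t\<in>F. f t v) - (\<Sum>t\<in>F. f t v') = sum f F (v - v')"
      by (simp add: blinfun.sum_left blinfun.diff_right sum_subtractf)
    then have "norm ((\<Sum>t\<in>F. f t v) - (\<Sum>t\<in>F. f t v')) \<le> norm (sum f F) * norm (v - v')"
      using norm_blinfun[of "sum f F" "v - v'"] by simp
    also have "\<dots> \<le> K * (e / K)"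
      using K bd[OF that] by (intro mult_mono nv) auto
    finally show ?thesis using K by simp
  qed
  show "\<exists>h' s'. (h' has_sum s') UNIV \<and> norm (X v - s') \<le> e \<and>
      (\<forall>F. finite F \<and> F \<subseteq> UNIV \<longrightarrow> norm ((\<Sum>t\<in>F. f t v) - sum h' F) \<le> e)"
    using 1 2 3 by blast
qed

text \<open>A compact \<open>a\<close> is a norm limit of sums of |delta_i><a* delta_i|. Multiplying
  these by \<open>f t\<close> from the left only needs convergence on basis vectors. From the right,
  the adjoint of \<open>f t\<close> meets the arbitrary vector a* delta_i, hence the detour through
  \<open>has_sum_pointwise\<close> for the adjoints.\<close>

lemma has_su_sum_delta:
  fixes f :: "'t \<Rightarrow> 'i op"
  assumes bd: "\<And>F. finite F \<Longrightarrow> norm (sum f F) \<le> C"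
    and f: "\<And>t. f t \<in> bounded_ops" and X: "X \<in> bounded_ops"
    and d: "\<And>i. ((\<lambda>t. f t (delta i)) has_sum X (delta i)) UNIV"
    and d': "\<And>i. ((\<lambda>t. adj (f t) (delta i)) has_sum adj X (delta i)) UNIV"
  shows "has_su_sum compact_ops f X"
  unfolding has_su_sum_def multipliers_compact
proof (intro conjI ballI X)
  fix a :: "'i op" assume a: "a \<in> compact_ops"
  have aB: "a \<in> bounded_ops" using a by (rule compact_ops_bounded)
  define K where "K = C + norm X + 1"
  have "0 \<le> C" using bd[of "{}"] by simp
  then have K: "K > 0" "C \<le> K" "norm X \<le> K" by (simp_all add: K_def add_nonneg_pos)
  have bd': "norm (\<Sum>t\<in>F. adj (f t)) \<le> C" if "finite F" for F
    using bd[OF that] f by (simp add: adj_sum[symmetric] bounded_ops_sum)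
  have ex: "\<exists>G. finite G \<and> norm (a - (\<Sum>i\<in>G. ketbra (delta i) (adj a (delta i)))) \<le> e / K"
    if "e > 0" for e using compact_approx[OF a, of "e / K"] that K by auto
  show "((\<lambda>t. f t o\<^sub>L a) has_sum (X o\<^sub>L a)) UNIV"
  proof (rule has_sum_approx)
    fix e :: real assume e: "e > 0"
    obtain G where G: "finite G" "norm (a - (\<Sum>i\<in>G. ketbra (delta i) (adj a (delta i)))) \<le> e / K"
      using ex[OF e] by blast
    define a' where "a' = (\<Sum>i\<in>G. ketbra (delta i) (adj a (delta i)))"
    have na: "norm (a - a') \<le> e / K" using G by (simp add: a'_def)
    have "((\<lambda>t. \<Sum>i\<in>G. ketbra (f t (delta i)) (adj a (delta i))) has_sum
        (\<Sum>i\<in>G. ketbra (X (delta i)) (adj a (delta i)))) UNIV"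
      by (rule has_sum_sum) (use G in \<open>auto intro!: has_sum_bounded_linear[OF bounded_linear_ketbra_left] d\<close>)
    then have 1: "((\<lambda>t. f t o\<^sub>L a') has_sum (X o\<^sub>L a')) UNIV"
      by (simp add: a'_def blinfun_compose.sum_right compose_ketbra f X)
    have 2: "norm ((S o\<^sub>L a) - (S o\<^sub>L a')) \<le> e" if "norm S \<le> K" for S
    proof -
      have "norm ((S o\<^sub>L a) - (S o\<^sub>L a')) \<le> norm S * norm (a - a')"
        unfolding blinfun_compose.diff_right[symmetric]
        by (rule norm_blinfun_compose)
      also have "\<dots> \<le> K * (e / K)" using that K by (intro mult_mono na) auto
      finally show ?thesis using K by simp
    qed
    have 3: "norm ((\<Sum>t\<in>F. f t o\<^sub>L a) - (\<Sum>t\<in>F. f t o\<^sub>L a')) \<le> e" if "finite F" for F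
      using 2[of "sum f F"] bd[OF that] K
      by (simp add: blinfun_compose.sum_left)
    show "\<exists>h' s'. (h' has_sum s') UNIV \<and> norm ((X o\<^sub>L a) - s') \<le> e \<and>
      (\<forall>F. finite F \<and> F \<subseteq> UNIV \<longrightarrow> norm ((\<Sum>t\<in>F. f t o\<^sub>L a) - sum h' F) \<le> e)"
      using 1 2[OF K(3)] 3 by blast
  qed
  show "((\<lambda>t. a o\<^sub>L f t) has_sum (a o\<^sub>L X)) UNIV"
  proof (rule has_sum_approx)
    fix e :: real assume e: "e > 0"
    obtain G where G: "finite G" "norm (a - (\<Sum>i\<in>G. ketbra (delta i) (adj a (delta i)))) \<le> e / K"
      using ex[OF e] by blast
    define a' where "a' = (\<Sum>i\<in>G. ketbra (delta i) (adj a (delta i)))"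
    have na: "norm (a - a') \<le> e / K" using G by (simp add: a'_def)
    have d'': "((\<lambda>t. adj (f t) v) has_sum adj X v) UNIV" for v
      by (rule has_sum_pointwise[OF bd']) (use f X d' in auto)
    have "((\<lambda>t. \<Sum>i\<in>G. ketbra (delta i) (adj (f t) (adj a (delta i)))) has_sum
        (\<Sum>i\<in>G. ketbra (delta i) (adj X (adj a (delta i))))) UNIV"
      by (rule has_sum_sum) (use G in \<open>auto intro!: has_sum_bounded_linear[OF bounded_linear_ketbra_right] d''\<close>)
    then have 1: "((\<lambda>t. a' o\<^sub>L f t) has_sum (a' o\<^sub>L X)) UNIV"
      by (simp add: a'_def blinfun_compose.sum_left ketbra_compose f X)
    have 2: "norm ((a o\<^sub>L S) - (a' o\<^sub>L S)) \<le> e" if "norm S \<le> K" for S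
    proof -
      have "norm ((a o\<^sub>L S) - (a' o\<^sub>L S)) \<le> norm (a - a') * norm S"
        unfolding blinfun_compose.diff_left[symmetric]
        by (rule norm_blinfun_compose)
      also have "\<dots> \<le> (e / K) * K" using that K e by (intro mult_mono na) auto
      finally show ?thesis using K by simp
    qed
    have 3: "norm ((\<Sum>t\<in>F. a o\<^sub>L f t) - (\<Sum>t\<in>F. a' o\<^sub>L f t)) \<le> e" if "finite F" for F
      using 2[of "sum f F"] bd[OF that] K
      by (simp add: blinfun_compose.sum_right)
    show "\<exists>h' s'. (h' has_sum s') UNIV \<and> norm ((a o\<^sub>L X) - s') \<le> e \<and>
      (\<forall>F. finite F \<and> F \<subseteq> UNIV \<longrightarrow> norm ((\<Sum>t\<in>F. a o\<^sub>L f t) - sum h' F) \<le> e)"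
      using 1 2[OF K(3)] 3 by blast
  qed
qed

text \<open>Strict convergence is tested on the compact operator \<open>ketbra x y\<close>; the
  scaling of \<open>y\<close> makes this operator fix \<open>x\<close>, so strict sums are in
  particular strong sums.\<close>

lemma has_su_sum_coeff:
  assumes "has_su_sum compact_ops f X" "X \<in> bounded_ops" "\<And>t. f t \<in> bounded_ops"
  shows "((\<lambda>t. f t x) has_sum X x) UNIV"
proof -
  define y where "y = x /\<^sub>R (norm x)\<^sup>2"
  have "((\<lambda>t. f t o\<^sub>L ketbra x y) has_sum (X o\<^sub>L ketbra x y)) UNIV"
    using assms(1) by (simp add: has_su_sum_def)
  from has_sum_bounded_linear[OF blinfun.bounded_linear_left this, of x]
  have *: "((\<lambda>t. scaleC (cinner y x) (f t x)) has_sum scaleC (cinner y x) (X x)) UNIV"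
    by (simp add: ketbra.rep_eq bounded_opsD[OF assms(2)] bounded_opsD[OF assms(3)])
  show ?thesis
  proof (cases "x = 0")
    case False
    have "cinner x x = complex_of_real ((norm x)\<^sup>2)"
      by (simp add: cinner_self norm_ell2_square)
    then have "cinner y x = 1"
      using False by (simp add: y_def scaleR_scaleC cinner_scaleC_left)
    then show ?thesis using * by simp
  qed (simp add: blinfun.zero_right)
qed

lemma su_sum_eqI:
  assumes "has_su_sum compact_ops f X" "\<And>t. f t \<in> bounded_ops"
  shows "su_sum compact_ops f = X"
  unfolding su_sum_def
proof (rule the_equality)
  fix Y assume Y: "has_su_sum compact_ops f Y"
  have b: "X \<in> bounded_ops" "Y \<in> bounded_ops"
    using assms(1) Y by (auto simp: has_su_sum_def multipliers_compact)
  show "Y = X"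
    using has_su_sum_coeff[OF Y b(2) assms(2)] has_su_sum_coeff[OF assms(1) b(1) assms(2)]
    by (intro blinfun_eqI) (rule has_sum_unique)
qed (rule assms)

section \<open>Strict sums of translates, with bounds that survive infinite linear
  combinations\<close>

lemma norm_ell2_mono:
  assumes "\<And>i. cmod (coeff x i) \<le> cmod (coeff y i)" shows "norm x \<le> norm y"
proof -
  have "(norm x)\<^sup>2 \<le> (norm y)\<^sup>2"
    unfolding norm_ell2_square
    by (rule infsum_mono) (auto intro!: square_summable_coeff power_mono assms)
  then show ?thesis by (simp add: power2_le_iff_abs_le)
qed

text \<open>\<open>X\<close> is the strict sum of the translates of \<open>T\<close>. The constant
  \<open>C\<close>, which dominates all finite partial sums and \<open>X\<close> itself, is recorded
  because it is the majorant in the passage to infinite series.\<close>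

definition su_int :: "'g::ab_group_add op \<Rightarrow> 'g op \<Rightarrow> real \<Rightarrow> bool" where
  "su_int T X C \<longleftrightarrow> T \<in> bounded_ops \<and> X \<in> bounded_ops \<and> norm X \<le> C \<and>
     (\<forall>F. finite F \<longrightarrow> norm (\<Sum>t\<in>F. Ad right_regular t T) \<le> C) \<and>
     has_su_sum compact_ops (\<lambda>t. Ad right_regular t T) X"

lemma su_int_mono: "su_int T X C \<Longrightarrow> C \<le> C' \<Longrightarrow> su_int T X C'"
  unfolding su_int_def by (meson order_trans)

lemma su_int_norm_le: assumes "su_int T X C" shows "norm T \<le> C"
proof -
  have "norm (\<Sum>t\<in>{0}. Ad right_regular t T) \<le> C"
    using assms unfolding su_int_def by blast
  then show ?thesis by simp
qed

lemma su_int_nonneg: "su_int T X C \<Longrightarrow> 0 \<le> C"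
  using su_int_norm_le norm_ge_zero order_trans by blast

lemma su_sum_su_int: "su_int T X C \<Longrightarrow> su_sum compact_ops (\<lambda>t. Ad right_regular t T) = X"
  by (rule su_sum_eqI) (auto simp: su_int_def)

lemma su_int_coeff:
  assumes "su_int T X C"
  shows "((\<lambda>t. coeff (Ad right_regular t T x) m) has_sum coeff (X x) m) UNIV"
  by (intro has_sum_bounded_linear[OF bounded_linear_coeff] has_su_sum_coeff)
     (use assms in \<open>auto simp: su_int_def\<close>)

text \<open>The translates are matrix units in pairwise different rows and columns, all on one
  diagonal. Hence a finite partial sum is a coordinate truncation of the translation by
  \<open>j - i\<close>, of norm at most 1 however many terms it has.\<close>

lemma su_int_delta:
  fixes i j :: "'g::ab_group_add"
  shows "su_int (ketbra (delta i) (delta j)) (right_regular (j - i)) 1"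
proof -
  have app: "ketbra (delta a) (delta b) x = scaleC (coeff x b) (delta a)" for a b :: 'g and x
    by (simp add: ketbra.rep_eq cinner_delta)
  have ps: "norm (\<Sum>t\<in>F. ketbra (delta (i - t)) (delta (j - t))) \<le> 1" if F: "finite F" for F
  proof (rule norm_blinfun_bound)
    fix x
    have "norm ((\<Sum>t\<in>F. ketbra (delta (i - t)) (delta (j - t))) x) \<le> norm (right_regular (j - i) x)"
    proof (rule norm_ell2_mono)
      fix m
      have "coeff ((\<Sum>t\<in>F. ketbra (delta (i - t)) (delta (j - t))) x) m
          = (\<Sum>t\<in>F. if t = i - m then coeff x (j - t) else 0)"
        unfolding blinfun.sum_left app coeff_sum
        by (intro sum.cong refl) (auto simp: coeff_delta algebra_simps)
      also have "\<dots> = (if i - m \<in> F then coeff x (m + (j - i)) else 0)"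
        using F by (simp add: diff_diff_eq2 add_diff_eq add.commute)
      finally show "cmod (coeff ((\<Sum>t\<in>F. ketbra (delta (i - t)) (delta (j - t))) x) m)
          \<le> cmod (coeff (right_regular (j - i) x) m)" by simp
    qed
    then show "norm ((\<Sum>t\<in>F. ketbra (delta (i - t)) (delta (j - t))) x) \<le> 1 * norm x" by simp
  qed simp
  \<comment> \<open>Stated for general indices because strictness also needs the adjoint family,
    which is the same with \<open>i\<close> and \<open>j\<close> exchanged. Column \<open>l\<close>
    is met by the single translate t = b - l.\<close>
  have pw: "((\<lambda>t. ketbra (delta (a - t)) (delta (b - t)) (delta l)) has_sum right_regular (b - a) (delta l)) UNIV"
    for a b l :: 'g
  proof (rule has_sum_finite_neutralI[of "{b - l}"])
    show "ketbra (delta (a - t)) (delta (b - t)) (delta l) = 0" if "t \<in> UNIV - {b - l}" for t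
      using that by (auto simp: app coeff_delta algebra_simps)
    show "right_regular (b - a) (delta l)
        = (\<Sum>t\<in>{b - l}. ketbra (delta (a - t)) (delta (b - t)) (delta l))"
      by (simp add: app coeff_delta algebra_simps)
  qed auto
  have "norm (right_regular (j - i)) \<le> 1"
    by (rule norm_blinfun_bound) auto
  moreover have "has_su_sum compact_ops (\<lambda>t. ketbra (delta (i - t)) (delta (j - t))) (right_regular (j - i))"
    using pw[of i j] pw[of j i] by (intro has_su_sum_delta[OF ps]) auto
  ultimately show ?thesis using ps by (simp add: su_int_def Ad_ketbra)
qed

lemma su_int_scale:
  assumes "su_int T X C" shows "su_int (scale_op c T) (scale_op c X) (cmod c * C)"
proof -
  have *: "(\<Sum>t\<in>F. Ad right_regular t (scale_op c T)) = scale_op c (\<Sum>t\<in>F. Ad right_regular t T)" for F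
    by (simp add: Ad_scale linear_sum[OF bounded_linear.linear[OF bounded_linear_scale_op]])
  have "has_su_sum compact_ops (\<lambda>t. Ad right_regular t (scale_op c T)) (scale_op c X)"
    using assms unfolding has_su_sum_def su_int_def multipliers_compact
    by (auto simp: Ad_scale scale_op_compose_left scale_op_compose_right compact_ops_bounded
        intro!: has_sum_bounded_linear[OF bounded_linear_scale_op])
  then show ?thesis
    using assms by (auto simp: su_int_def * intro!: mult_left_mono)
qed

text \<open>For fixed \<open>F\<close> the sum of conjugations is bounded and linear, so it passes
  through the series; the resulting bound does not depend on \<open>F\<close>.\<close>

lemma norm_sum_Ad_le:
  fixes T :: "'n \<Rightarrow> 'g::ab_group_add op"
  assumes T: "(T has_sum S) A" and X: "\<And>n. n \<in> A \<Longrightarrow> su_int (T n) (X n) (C n)"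
    and C: "C summable_on A" and F: "finite F"
  shows "norm (\<Sum>t\<in>F. Ad right_regular t S) \<le> infsum C A"
proof (rule norm_infsum_le)
  have "bounded_linear (\<lambda>T. \<Sum>t\<in>F. Ad right_regular t (T::'g op))"
    by (intro bounded_linear_sum bounded_linear_Ad)
  then show "((\<lambda>n. \<Sum>t\<in>F. Ad right_regular t (T n)) has_sum (\<Sum>t\<in>F. Ad right_regular t S)) A"
    using T by (rule has_sum_bounded_linear)
  show "(C has_sum infsum C A) A" using C by simp
qed (use X F in \<open>auto simp: su_int_def\<close>)

text \<open>Dominated convergence: the tails of the series are small uniformly in the partial sums.\<close>

lemma su_int_sum:
  fixes T :: "'n \<Rightarrow> 'g::ab_group_add op"
  assumes T: "(T has_sum S) A" and X: "\<And>n. n \<in> A \<Longrightarrow> su_int (T n) (X n) (C n)"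
    and C: "C summable_on A"
  shows "\<exists>Y. (X has_sum Y) A \<and> su_int S Y (infsum C A)"
proof -
  have TB: "T n \<in> bounded_ops" "X n \<in> bounded_ops" "norm (X n) \<le> C n" "0 \<le> C n" if "n \<in> A" for n
    using X[OF that] su_int_nonneg[OF X[OF that]] by (auto simp: su_int_def)
  have "X summable_on A"
    by (rule abs_summable_summable, rule summable_on_comparison_test[OF C]) (use TB in auto)
  then obtain Y where Y: "(X has_sum Y) A" by (auto simp: summable_on_def)
  have YB: "Y \<in> bounded_ops" using bounded_ops_has_sum[OF Y] TB by blast
  have SB: "S \<in> bounded_ops" using bounded_ops_has_sum[OF T] TB by blast
  have nY: "norm Y \<le> infsum C A"
    by (rule norm_infsum_le[OF Y has_sum_infsum[OF C]]) (use TB in auto)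
  have approx: "\<exists>G. finite G \<and> G \<subseteq> A \<and> norm (Y - sum X G) \<le> e \<and>
      (\<forall>F. finite F \<longrightarrow> norm ((\<Sum>t\<in>F. Ad right_regular t S) - (\<Sum>t\<in>F. Ad right_regular t (sum T G))) \<le> e)"
    if e: "e > 0" for e
  proof -
    obtain G where G: "finite G" "G \<subseteq> A" "dist (sum C G) (infsum C A) \<le> e"
      using infsum_finite_approximation[OF C e] by blast
    have CA: "C summable_on (A - G)" by (rule summable_on_subset[OF C]) auto
    have "infsum C (A - G) = infsum C A - sum C G"
      using G C by (simp add: infsum_Diff)
    then have tail: "infsum C (A - G) \<le> e" using G(3) by (auto simp: dist_real_def)
    have Y': "(X has_sum (Y - sum X G)) (A - G)"
      using G by (intro has_sum_Diff[OF Y has_sum_finite]) auto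
    have T': "(T has_sum (S - sum T G)) (A - G)"
      using G by (intro has_sum_Diff[OF T has_sum_finite]) auto
    have 1: "norm (Y - sum X G) \<le> infsum C (A - G)"
      by (rule norm_infsum_le[OF Y' has_sum_infsum[OF CA]]) (use TB in auto)
    have 2: "norm ((\<Sum>t\<in>F. Ad right_regular t S) - (\<Sum>t\<in>F. Ad right_regular t (sum T G))) \<le> e" if "finite F" for F
    proof -
      have "norm (\<Sum>t\<in>F. Ad right_regular t (S - sum T G)) \<le> infsum C (A - G)"
        by (rule norm_sum_Ad_le[OF T' _ CA that, of X]) (use X in auto)
      then show ?thesis
        using tail by (simp add: Ad_diff sum_subtractf)
    qed
    show ?thesis using G 1 2 tail by (intro exI[of _ G]) auto
  qed
  have su: "((\<lambda>t. Ad right_regular t S o\<^sub>L a) has_sum (Y o\<^sub>L a)) UNIV \<and>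
      ((\<lambda>t. a o\<^sub>L Ad right_regular t S) has_sum (a o\<^sub>L Y)) UNIV" if a: "a \<in> compact_ops" for a
  proof -
    have K: "norm a + 1 > 0" by (simp add: add_nonneg_pos)
    have hs: "((\<lambda>t. Ad right_regular t (T n) o\<^sub>L a) has_sum (X n o\<^sub>L a)) UNIV"
        "((\<lambda>t. a o\<^sub>L Ad right_regular t (T n)) has_sum (a o\<^sub>L X n)) UNIV" if "n \<in> A" for n
      using X[OF that] a by (auto simp: su_int_def has_su_sum_def)
    have mul: "norm (S o\<^sub>L a) \<le> e" "norm (a o\<^sub>L S) \<le> e" if "norm S \<le> e / (norm a + 1)" "e > 0" for S e
    proof -
      have "norm S * norm a \<le> e / (norm a + 1) * (norm a + 1)"
        using that K by (intro mult_mono) auto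
      then have *: "norm S * norm a \<le> e" using K by simp
      show "norm (S o\<^sub>L a) \<le> e" using norm_blinfun_compose[of S a] * by linarith
      show "norm (a o\<^sub>L S) \<le> e" using norm_blinfun_compose[of a S] * by (simp add: mult.commute)
    qed
    note lin = blinfun_compose.sum_right
      blinfun_compose.sum_left
      blinfun_compose.diff_right
      blinfun_compose.diff_left
      Ad_sum
    show ?thesis
    proof (intro conjI has_sum_approx)
      fix e :: real assume e: "e > 0"
      obtain G where G: "finite G" "G \<subseteq> A" "norm (Y - sum X G) \<le> e / (norm a + 1)"
        "\<And>F. finite F \<Longrightarrow> norm ((\<Sum>t\<in>F. Ad right_regular t S) - (\<Sum>t\<in>F. Ad right_regular t (sum T G)))
          \<le> e / (norm a + 1)"
        using approx[of "e / (norm a + 1)"] e K by auto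
      have "((\<lambda>t. \<Sum>n\<in>G. Ad right_regular t (T n) o\<^sub>L a) has_sum (\<Sum>n\<in>G. X n o\<^sub>L a)) UNIV"
        using G hs by (intro has_sum_sum) auto
      moreover have "norm ((Y o\<^sub>L a) - (\<Sum>n\<in>G. X n o\<^sub>L a)) \<le> e"
        using mul(1)[OF G(3) e] by (simp add: lin)
      moreover have "norm ((\<Sum>t\<in>F. Ad right_regular t S o\<^sub>L a) -
          (\<Sum>t\<in>F. \<Sum>n\<in>G. Ad right_regular t (T n) o\<^sub>L a)) \<le> e" if "finite F" for F
        using mul(1)[OF G(4)[OF that] e] by (simp add: lin)
      ultimately show "\<exists>h' s'. (h' has_sum s') UNIV \<and> norm ((Y o\<^sub>L a) - s') \<le> e \<and>
          (\<forall>F. finite F \<and> F \<subseteq> UNIV \<longrightarrow> norm ((\<Sum>t\<in>F. Ad right_regular t S o\<^sub>L a) - sum h' F) \<le> e)"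
        by blast
      have "((\<lambda>t. \<Sum>n\<in>G. a o\<^sub>L Ad right_regular t (T n)) has_sum (\<Sum>n\<in>G. a o\<^sub>L X n)) UNIV"
        using G hs by (intro has_sum_sum) auto
      moreover have "norm ((a o\<^sub>L Y) - (\<Sum>n\<in>G. a o\<^sub>L X n)) \<le> e"
        using mul(2)[OF G(3) e] by (simp add: lin)
      moreover have "norm ((\<Sum>t\<in>F. a o\<^sub>L Ad right_regular t S) -
          (\<Sum>t\<in>F. \<Sum>n\<in>G. a o\<^sub>L Ad right_regular t (T n))) \<le> e" if "finite F" for F
        using mul(2)[OF G(4)[OF that] e] by (simp add: lin)
      ultimately show "\<exists>h' s'. (h' has_sum s') UNIV \<and> norm ((a o\<^sub>L Y) - s') \<le> e \<and>
          (\<forall>F. finite F \<and> F \<subseteq> UNIV \<longrightarrow> norm ((\<Sum>t\<in>F. a o\<^sub>L Ad right_regular t S) - sum h' F) \<le> e)"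
        by blast
    qed
  qed
  have "norm (\<Sum>t\<in>F. Ad right_regular t S) \<le> infsum C A" if "finite F" for F
    by (rule norm_sum_Ad_le[OF T X C that])
  then have "su_int S Y (infsum C A)"
    using su YB SB nY by (auto simp: su_int_def has_su_sum_def multipliers_compact)
  then show ?thesis using Y by blast
qed

text \<open>The series lemma \<open>su_int_sum\<close> over the two-element index type
  \<open>bool\<close>.\<close>

lemma su_int_add:
  assumes "su_int T X C" "su_int T' X' C'" shows "su_int (T + T') (X + X') (C + C')"
proof -
  have "\<exists>Y. ((\<lambda>b. if b then X else X') has_sum Y) UNIV \<and>
      su_int (T + T') Y (\<Sum>\<^sub>\<infinity>b. if b then C else C')"
    by (rule su_int_sum[of "\<lambda>b. if b then T else T'"])
       (use assms in \<open>auto simp: has_sum_finite_iff UNIV_bool\<close>)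
  then show ?thesis by (auto simp: has_sum_finite_iff UNIV_bool add.commute)
qed

section \<open>Rank-one operators with absolutely summable coefficients\<close>

definition norm1 :: "'i ell2 \<Rightarrow> real" where "norm1 x = (\<Sum>\<^sub>\<infinity>i. cmod (coeff x i))"

abbreviation l1_vector :: "'i ell2 \<Rightarrow> bool" where
  "l1_vector x \<equiv> (\<lambda>i. cmod (coeff x i)) summable_on UNIV"

lemma norm1_nonneg: "norm1 x \<ge> 0"
  unfolding norm1_def by (rule infsum_nonneg) auto

lemma
  fixes x :: "'g::ab_group_add ell2"
  shows norm1_right_regular [simp]: "norm1 (right_regular t x) = norm1 x"
    and l1_right_regular [simp]: "l1_vector (right_regular t x) \<longleftrightarrow> l1_vector x"
  using infsum_reindex_bij_betw[OF bij_add_right[of t], of "\<lambda>i. cmod (coeff x i)"]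
    summable_on_reindex_bij_betw[OF bij_add_right[of t], of "\<lambda>i. cmod (coeff x i)"]
  by (simp_all add: norm1_def)

text \<open>Two expansions along the basis: \<open>x\<close> against a fixed basis vector, then
  \<open>y\<close>. Each is absolutely convergent with majorant the coefficients of the vector being
  expanded. Only existence of the sum is obtained; its matrix identifies it afterwards.\<close>

lemma su_int_ketbra:
  fixes x y :: "'g::ab_group_add ell2"
  assumes x: "l1_vector x" and y: "l1_vector y"
  shows "\<exists>X. su_int (ketbra x y) X (norm1 x * norm1 y)"
proof -
  have "\<exists>X. su_int (ketbra x (delta j)) X (norm1 x)" for j
  proof -
    have "((\<lambda>i. scale_op (coeff x i) (ketbra (delta i) (delta j))) has_sum ketbra x (delta j)) UNIV"
      using has_sum_bounded_linear[OF bounded_linear_ketbra_left has_sum_delta[of x]]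
      by (simp add: ketbra_simps)
    moreover have "su_int (scale_op (coeff x i) (ketbra (delta i) (delta j)))
        (scale_op (coeff x i) (right_regular (j - i))) (cmod (coeff x i))" for i
      using su_int_scale[OF su_int_delta[of i j], of "coeff x i"] by simp
    ultimately show ?thesis
      using su_int_sum[where T = "\<lambda>i. scale_op (coeff x i) (ketbra (delta i) (delta j))"
          and X = "\<lambda>i. scale_op (coeff x i) (right_regular (j - i))", OF _ _ x]
      unfolding norm1_def by blast
  qed
  then obtain X where X: "\<And>j. su_int (ketbra x (delta j)) (X j) (norm1 x)" by metis
  have "((\<lambda>j. scale_op (cnj (coeff y j)) (ketbra x (delta j))) has_sum ketbra x y) UNIV"
    using has_sum_bounded_linear[OF bounded_linear_ketbra_right has_sum_delta[of y]]
    by (simp add: ketbra_simps)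
  moreover have "su_int (scale_op (cnj (coeff y j)) (ketbra x (delta j)))
      (scale_op (cnj (coeff y j)) (X j)) (cmod (coeff y j) * norm1 x)" for j
    using su_int_scale[OF X[of j], of "cnj (coeff y j)"] by simp
  moreover have "(\<lambda>j. cmod (coeff y j) * norm1 x) summable_on UNIV"
    by (intro summable_on_cmult_left y)
  ultimately have "\<exists>X. su_int (ketbra x y) X (\<Sum>\<^sub>\<infinity>j. cmod (coeff y j) * norm1 x)"
    using su_int_sum[where T = "\<lambda>j. scale_op (cnj (coeff y j)) (ketbra x (delta j))"
        and X = "\<lambda>j. scale_op (cnj (coeff y j)) (X j)"
        and C = "\<lambda>j. cmod (coeff y j) * norm1 x" and A = UNIV] by blast
  then show ?thesis by (simp add: infsum_cmult_left' norm1_def mult.commute)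
qed

text \<open>Entry (m, l) of the translate by \<open>t\<close> is x(m + t) times the conjugate of y(l
  + t); summed over \<open>t\<close> this is an inner product of two translated vectors, ready for
  Parseval's identity.\<close>

lemma su_int_ketbra_coeff:
  assumes "su_int (ketbra x y) X C"
  shows "coeff (X (delta l)) m = cinner (right_regular l y) (right_regular m x)"
proof -
  have "((\<lambda>t. coeff (Ad right_regular t (ketbra x y) (delta l)) m) has_sum coeff (X (delta l)) m) UNIV"
    by (rule su_int_coeff[OF assms])
  moreover have "coeff (Ad right_regular t (ketbra x y) (delta l)) m
      = cnj (coeff (right_regular l y) t) * coeff (right_regular m x) t" for t
    by (simp add: Ad_ketbra ketbra.rep_eq cinner_delta_right add.commute)
  ultimately show ?thesis by (simp add: cinner_def infsumI)
qed

section \<open>Rieffel properness\<close>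

lemma subspace_closure:
  fixes S :: "'a::real_normed_vector set"
  assumes "subspace S" shows "subspace (closure S)"
proof (rule subspaceI)
  show "0 \<in> closure S" using closure_subset subspace_0[OF assms] by blast
  show "x + y \<in> closure S" if "x \<in> closure S" "y \<in> closure S" for x y
  proof -
    obtain f g where "\<And>n. f n \<in> S" "f \<longlonglongrightarrow> x" "\<And>n. g n \<in> S" "g \<longlonglongrightarrow> y"
      using \<open>x \<in> closure S\<close> \<open>y \<in> closure S\<close> unfolding closure_sequential by metis
    then show ?thesis
      unfolding closure_sequential
      by (intro exI[of _ "\<lambda>n. f n + g n"]) (auto intro: tendsto_add subspace_add[OF assms])
  qed
  show "c *\<^sub>R x \<in> closure S" if "x \<in> closure S" for c x
  proof -
    obtain f where "\<And>n. f n \<in> S" "f \<longlonglongrightarrow> x"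
      using \<open>x \<in> closure S\<close> unfolding closure_sequential by metis
    then show ?thesis
      unfolding closure_sequential
      by (intro exI[of _ "\<lambda>n. c *\<^sub>R f n"]) (auto intro: tendsto_scaleR subspace_scale[OF assms])
  qed
qed

lemma subspace_of_op_subspace: "op.subspace S \<Longrightarrow> subspace S"
proof (rule subspaceI)
  fix r :: real and T assume S: "op.subspace S" "T \<in> S"
  have "r *\<^sub>R T = scale_op (complex_of_real r) T"
    by (rule blinfun_eqI) (simp add: blinfun.scaleR_left scaleR_scaleC)
  then show "r *\<^sub>R T \<in> S" using op.subspace_scale[OF S] by simp
qed (auto simp: op.subspace_add op.subspace_0)

lemma ketbra_span_subset_compact: "ketbra_span R \<subseteq> compact_ops"
  unfolding ketbra_span_def by (rule op.span_minimal) (auto simp: compact_ops_subspace)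

lemma ketbra_in_span: "\<xi> \<in> R \<Longrightarrow> ketbra \<xi> \<eta> \<in> ketbra_span R"
  unfolding ketbra_span_def by (intro op.span_base) auto

text \<open>\<open>compact_approx\<close> yields finite sums of rank-one operators with arbitrary
  left vectors; these vectors are approximated from \<open>R\<close>, and approximating by elements
  of the closure is enough.\<close>

lemma dense_ketbra_span:
  fixes R :: "'i ell2 set"
  assumes "closure R = UNIV"
  shows "dense_subspace compact_ops (ketbra_span R)"
  unfolding dense_subspace_def
proof (intro conjI ketbra_span_subset_compact subsetI)
  show "op.subspace (ketbra_span R)" by (simp add: ketbra_span_def)
  then have sub: "subspace (closure (ketbra_span R))"
    by (intro subspace_closure subspace_of_op_subspace)
  fix T :: "'i op" assume T: "T \<in> compact_ops"
  have kb: "ketbra x y \<in> closure (ketbra_span R)" for x y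
  proof -
    have "(\<lambda>x. ketbra x y) ` closure R \<subseteq> closure (ketbra_span R)"
      by (rule image_closure_subset)
         (auto intro!: bounded_linear.continuous_on[OF bounded_linear_ketbra_left] continuous_on_id
            closure_subset[THEN subsetD] ketbra_in_span)
    then show ?thesis using assms by auto
  qed
  show "T \<in> closure (ketbra_span R)"
  proof (subst closure_closed[OF closed_closure, symmetric], unfold closure_approachable, intro allI impI)
    fix e :: real assume "e > 0"
    then obtain F where F: "finite F" "norm (T - (\<Sum>i\<in>F. ketbra (delta i) (adj T (delta i)))) \<le> e / 2"
      using compact_approx[OF T, of "e / 2"] by auto
    moreover have "(\<Sum>i\<in>F. ketbra (delta i) (adj T (delta i))) \<in> closure (ketbra_span R)"
      by (intro subspace_sum[OF sub] kb)
    ultimately show "\<exists>y\<in>closure (ketbra_span R). dist y T < e"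
      using \<open>e > 0\<close> by (auto simp: dist_norm norm_minus_commute intro!: bexI)
  qed
qed

text \<open>For rank-one operators the product collapses to the scalar <a, rho_t c> times |b><rho_t
  d|, whose norm is bounded independently of \<open>t\<close>. The two slots are then extended to
  the span one after the other.\<close>

lemma rieffel_proper_ketbra_span:
  fixes R :: "'g::ab_group_add ell2 set"
  assumes dense: "closure R = UNIV" and L1: "relatively_L1 right_regular R"
  shows "rieffel_proper (Ad right_regular) compact_ops (ketbra_span R)"
  unfolding rieffel_proper_def
proof (intro conjI ballI is_action_Ad dense_ketbra_span dense)
  let ?s = "\<lambda>\<xi> \<eta>. (\<lambda>t. norm (adj \<xi> o\<^sub>L Ad right_regular t \<eta>)) summable_on UNIV"
  note add = blinfun_compose.add_right
      blinfun_compose.add_left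
      Ad_add
  fix \<xi> \<eta> assume "\<xi> \<in> ketbra_span R" "\<eta> \<in> ketbra_span R"
  have 1: "?s (ketbra a b) (ketbra c d)" if "a \<in> R" "c \<in> R" for a b c d
  proof (rule summable_on_comparison_test)
    show "(\<lambda>t. cmod (cinner a (right_regular t c)) * (norm b * norm d)) summable_on UNIV"
      using L1 that by (intro summable_on_cmult_left) (auto simp: relatively_L1_def)
    fix t
    have "adj (ketbra a b) o\<^sub>L Ad right_regular t (ketbra c d)
        = scale_op (cinner a (right_regular t c)) (ketbra b (right_regular t d))"
      by (rule blinfun_eqI) (simp add: Ad_ketbra ketbra.rep_eq cinner_scaleC_right mult.commute)
    then show "norm (adj (ketbra a b) o\<^sub>L Ad right_regular t (ketbra c d))
        \<le> cmod (cinner a (right_regular t c)) * (norm b * norm d)"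
      using norm_ketbra_le[of b "right_regular t d"] by (simp add: mult_left_mono)
  qed auto
  have 2: "?s (ketbra a b) \<eta>" if "a \<in> R" for a b
    using \<open>\<eta> \<in> ketbra_span R\<close> unfolding ketbra_span_def
  proof (induction rule: op.span_induct_alt)
    case base
    then show ?case by (simp add: Ad_def blinfun_compose.zero_right
      blinfun_compose.zero_left)
  next
    case (step c x y)
    show ?case
    proof (rule summable_on_comparison_test)
      show "(\<lambda>t. cmod c * norm (adj (ketbra a b) o\<^sub>L Ad right_regular t x) +
          norm (adj (ketbra a b) o\<^sub>L Ad right_regular t y)) summable_on UNIV"
        using step 1[OF that] by (intro summable_on_add summable_on_cmult_right) auto
      fix t
      show "norm (adj (ketbra a b) o\<^sub>L Ad right_regular t (scale_op c x + y))
         \<le> cmod c * norm (adj (ketbra a b) o\<^sub>L Ad right_regular t x) +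
          norm (adj (ketbra a b) o\<^sub>L Ad right_regular t y)"
        unfolding add Ad_scale by (subst scale_op_compose_right, simp, rule norm_triangle_le, simp)
    qed auto
  qed
  \<comment> \<open>Complex linearity is carried through the induction because additivity of
    \<open>adj\<close> is available for such operators.\<close>
  have "\<xi> \<in> bounded_ops \<and> ?s \<xi> \<eta>"
    using \<open>\<xi> \<in> ketbra_span R\<close> unfolding ketbra_span_def
  proof (induction rule: op.span_induct_alt)
    case base
    then show ?case by (simp add: blinfun_compose.zero_left)
  next
    case (step c x y)
    from step(1) obtain a b where ab: "x = ketbra a b" "a \<in> R" by blast
    have x: "x \<in> bounded_ops" by (simp add: ab)
    have y: "y \<in> bounded_ops" "?s y \<eta>" using step by blast+
    have "?s \<xi>' \<eta>" if "\<xi>' = scale_op c x + y" for \<xi>'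
      unfolding that
    proof (rule summable_on_comparison_test)
      show "(\<lambda>t. cmod c * norm (adj x o\<^sub>L Ad right_regular t \<eta>) +
          norm (adj y o\<^sub>L Ad right_regular t \<eta>)) summable_on UNIV"
        using y 2[OF ab(2), of b] ab(1) by (intro summable_on_add summable_on_cmult_right) auto
      fix t
      show "norm (adj (scale_op c x + y) o\<^sub>L Ad right_regular t \<eta>)
         \<le> cmod c * norm (adj x o\<^sub>L Ad right_regular t \<eta>) + norm (adj y o\<^sub>L Ad right_regular t \<eta>)"
        using y(1) x
        by (simp add: adj_add adj_scale add scale_op_compose_left) (rule norm_triangle_le, simp)
    qed auto
    then show ?case using x y(1) by auto
  qed
  then show "?s \<xi> \<eta>" by blast
qed

section \<open>The generalised fixed-point algebra in terms of the vectors\<close>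

lemma has_sum_in_closed_subspace:
  assumes "op.subspace M" "closed M" "(f has_sum X) A" "\<And>i. i \<in> A \<Longrightarrow> f i \<in> M"
  shows "X \<in> M"
proof -
  have "(sum f \<longlongrightarrow> X) (finite_subsets_at_top A)" using assms(3) by (simp add: has_sum_def)
  then show ?thesis
    by (rule Lim_in_closed_set[OF assms(2) _ finite_subsets_at_top_neq_bot, rotated])
       (auto intro!: eventually_finite_subsets_at_top_weakI op.subspace_sum[OF assms(1)] assms(4))
qed

text \<open>The shape of the elements of the saturation: conjugating |a><b| f(-t) by rho_t gives
  |rho_t a><w_t| with w_t = rho_t f(-t)* b, and all that is retained about \<open>w\<close> is the
  summability of its norms.\<close>

definition translate_sums :: "'g::ab_group_add ell2 set \<Rightarrow> 'g op set" where
  "translate_sums R = {\<Sum>\<^sub>\<infinity>t. ketbra (right_regular t a) (w t) | a w.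
     a \<in> R \<and> (\<lambda>t. norm (w t)) summable_on UNIV}"

lemma translate_sum_has_sum:
  assumes "(\<lambda>t. norm (w t)) summable_on UNIV"
  shows "((\<lambda>t. ketbra (right_regular t a) (w t)) has_sum (\<Sum>\<^sub>\<infinity>t. ketbra (right_regular t a) (w t))) UNIV"
proof (rule has_sum_infsum, rule abs_summable_summable, rule summable_on_comparison_test)
  show "(\<lambda>t. norm a * norm (w t)) summable_on UNIV"
    using assms by (intro summable_on_cmult_right)
  fix t show "norm (ketbra (right_regular t a) (w t)) \<le> norm a * norm (w t)"
    using norm_ketbra_le[of "right_regular t a" "w t"] by simp
qed auto

lemma translate_sums_bounded: "V \<in> translate_sums R \<Longrightarrow> V \<in> bounded_ops"
  unfolding translate_sums_def using translate_sum_has_sum bounded_ops_has_sum by force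

lemma bij_uminus_group: "bij (uminus :: 'g::group_add \<Rightarrow> 'g)"
  by (rule bij_betw_byWitness[where f' = uminus]) auto

lemma saturation_subset:
  fixes R :: "'g::ab_group_add ell2 set"
  shows "saturation (Ad right_regular) compact_ops (ketbra_span R) \<subseteq> op.span (translate_sums R)"
  unfolding saturation_def
proof (rule op.span_minimal[OF _ op.subspace_span], safe)
  fix \<xi> :: "'g op" and f :: "'g \<Rightarrow> 'g op"
  assume \<xi>: "\<xi> \<in> ketbra_span R" and f: "f \<in> l1_functions compact_ops"
  have fB: "f t \<in> bounded_ops" for t
    using f by (auto simp: l1_functions_def intro!: compact_ops_bounded)
  have fs: "(\<lambda>t. norm (f (- t))) summable_on UNIV"
    using f summable_on_reindex_bij_betw[OF bij_uminus_group, of "\<lambda>t. norm (f t)"]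
    by (simp add: l1_functions_def)
  define I where "I \<eta> = (\<Sum>\<^sub>\<infinity>t. Ad right_regular t (\<eta> o\<^sub>L f (- t)))" for \<eta>
  have I: "((\<lambda>t. Ad right_regular t (\<eta> o\<^sub>L f (- t))) has_sum I \<eta>) UNIV" for \<eta>
    unfolding I_def
  proof (rule has_sum_infsum, rule abs_summable_summable, rule summable_on_comparison_test)
    show "(\<lambda>t. norm \<eta> * norm (f (- t))) summable_on UNIV"
      using fs by (intro summable_on_cmult_right)
    fix t show "norm (Ad right_regular t (\<eta> o\<^sub>L f (- t))) \<le> norm \<eta> * norm (f (- t))"
      using norm_Ad_le norm_blinfun_compose order_trans by blast
  qed auto
  have "I \<xi> \<in> op.span (translate_sums R)"
    using \<xi> unfolding ketbra_span_def
  proof (induction rule: op.span_induct_alt)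
    case base
    have "I 0 = 0"
      by (simp add: I_def blinfun_compose.zero_left
          Ad_zero_op)
    then show ?case by (simp add: op.span_zero)
  next
    case (step c x y)
    from step(1) obtain a b where ab: "x = ketbra a b" "a \<in> R" by blast
    have "((\<lambda>t. Ad right_regular t ((scale_op c x + y) o\<^sub>L f (- t))) has_sum scale_op c (I x) + I y) UNIV"
      using has_sum_add[OF has_sum_bounded_linear[OF bounded_linear_scale_op[of c] I[of x]] I[of y]]
      by (simp add: blinfun_compose.add_left scale_op_compose_left
          Ad_add Ad_scale)
    then have "I (scale_op c x + y) = scale_op c (I x) + I y"
      by (rule has_sum_unique[OF I])
    moreover have "I x \<in> translate_sums R"
    proof -
      define w where "w t = right_regular t (adj (f (- t)) b)" for t
      have "I x = (\<Sum>\<^sub>\<infinity>t. ketbra (right_regular t a) (w t))"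
        by (simp add: I_def ab(1) ketbra_compose[OF fB] Ad_ketbra w_def)
      moreover have "(\<lambda>t. norm (w t)) summable_on UNIV"
      proof (rule summable_on_comparison_test)
        show "(\<lambda>t. norm (f (- t)) * norm b) summable_on UNIV"
          using fs by (intro summable_on_cmult_left)
        fix t show "norm (w t) \<le> norm (f (- t)) * norm b"
          using norm_blinfun[of "adj (f (- t))" b] fB by (simp add: w_def)
      qed auto
      ultimately show ?thesis using ab(2) by (auto simp: translate_sums_def)
    qed
    ultimately show ?case
      using step by (simp add: op.span_add op.span_scale op.span_base)
  qed
  then show "(\<Sum>\<^sub>\<infinity>t. Ad right_regular t (\<xi> o\<^sub>L f (- t))) \<in> op.span (translate_sums R)"
    by (simp add: I_def)
qed

text \<open>V W* is the double series of |rho_t a><rho_s c| with coefficients the conjugates of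
  <v_s, w_t>. The bound \<open>K\<close> is the same for all s and t since \<open>norm1\<close> is
  translation invariant, so \<open>su_int_sum\<close> applies once over s and once over t. The
  closed subspace \<open>M\<close> receives each limit.\<close>

lemma su_int_translate_sums:
  fixes R :: "'g::ab_group_add ell2 set"
  assumes M: "op.subspace M" "closed M"
    and l1: "\<And>a. a \<in> R \<Longrightarrow> l1_vector a"
    and prod: "\<And>a c s t X C. a \<in> R \<Longrightarrow> c \<in> R \<Longrightarrow>
      su_int (ketbra (right_regular s a) (right_regular t c)) X C \<Longrightarrow> X \<in> M"
    and V: "V \<in> translate_sums R" and W: "W \<in> translate_sums R"
  shows "\<exists>X\<in>M. \<exists>C. su_int (V o\<^sub>L adj W) X C"
proof -
  obtain a w where a: "a \<in> R" "V = (\<Sum>\<^sub>\<infinity>t. ketbra (right_regular t a) (w t))"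
    and w: "(\<lambda>t. norm (w t)) summable_on UNIV" using V by (auto simp: translate_sums_def)
  obtain c v where c: "c \<in> R" "W = (\<Sum>\<^sub>\<infinity>t. ketbra (right_regular t c) (v t))"
    and v: "(\<lambda>t. norm (v t)) summable_on UNIV" using W by (auto simp: translate_sums_def)
  have WB: "W \<in> bounded_ops" using translate_sums_bounded[OF W] .
  define K where "K = norm1 a * norm1 c"
  have K: "K \<ge> 0" by (simp add: K_def norm1_nonneg)
  have "\<exists>X. su_int (ketbra (right_regular t a) (right_regular s c)) X K" for s t
    using su_int_ketbra[OF l1_right_regular[THEN iffD2, OF l1[OF a(1)]]
        l1_right_regular[THEN iffD2, OF l1[OF c(1)]], of t s] by (simp only: K_def norm1_right_regular)
  note ex = this
  define X where "X s t = (SOME X. su_int (ketbra (right_regular t a) (right_regular s c)) X K)" for s t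
  have X: "su_int (ketbra (right_regular t a) (right_regular s c)) (X s t) K" for s t
    unfolding X_def by (rule someI_ex[OF ex])
  have XM: "X s t \<in> M" for s t using prod[OF a(1) c(1) X] .
  \<comment> \<open>The inner series is treated for an arbitrary vector \<open>z\<close>, later z =
    w t. Its bound is linear in \<open>norm z\<close>, which keeps the outer series
    summable.\<close>
  have "\<exists>Y. Y \<in> M \<and> su_int (ketbra (right_regular t a) (W z)) Y ((\<Sum>\<^sub>\<infinity>s. norm (v s)) * (norm z * K))" for t z
  proof -
    have "((\<lambda>s. scaleC (cinner (v s) z) (right_regular s c)) has_sum W z) UNIV"
      using has_sum_bounded_linear[OF blinfun.bounded_linear_left translate_sum_has_sum[OF v, of c], of z]
      by (simp add: c(2) ketbra.rep_eq)
    from has_sum_bounded_linear[OF bounded_linear_ketbra_right this, of "right_regular t a"]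
    have 1: "((\<lambda>s. scale_op (cnj (cinner (v s) z)) (ketbra (right_regular t a) (right_regular s c)))
        has_sum ketbra (right_regular t a) (W z)) UNIV"
      by (simp add: ketbra_simps)
    have 2: "su_int (scale_op (cnj (cinner (v s) z)) (ketbra (right_regular t a) (right_regular s c)))
        (scale_op (cnj (cinner (v s) z)) (X s t)) (norm (v s) * (norm z * K))" for s
    proof (rule su_int_mono[OF su_int_scale[OF X]])
      have "cmod (cinner (v s) z) * K \<le> (norm (v s) * norm z) * K"
        by (intro mult_right_mono cmod_cinner_le K)
      then show "cmod (cnj (cinner (v s) z)) * K \<le> norm (v s) * (norm z * K)"
        by (simp add: mult.assoc)
    qed
    have 3: "(\<lambda>s. norm (v s) * (norm z * K)) summable_on UNIV"
      by (intro summable_on_cmult_left v)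
    obtain Y where Y: "((\<lambda>s. scale_op (cnj (cinner (v s) z)) (X s t)) has_sum Y) UNIV"
      "su_int (ketbra (right_regular t a) (W z)) Y (\<Sum>\<^sub>\<infinity>s. norm (v s) * (norm z * K))"
      using su_int_sum[OF 1 2 3] by blast
    have "Y \<in> M"
      by (rule has_sum_in_closed_subspace[OF M Y(1)]) (simp add: XM op.subspace_scale[OF M(1)])
    then show ?thesis using Y(2) by (auto simp: infsum_cmult_left')
  qed
  then obtain Y where Y: "\<And>t z. Y t z \<in> M"
    "\<And>t z. su_int (ketbra (right_regular t a) (W z)) (Y t z) ((\<Sum>\<^sub>\<infinity>s. norm (v s)) * (norm z * K))"
    by metis
  have 1: "((\<lambda>t. ketbra (right_regular t a) (W (w t))) has_sum (V o\<^sub>L adj W)) UNIV"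
    using has_sum_bounded_linear[OF blinfun_compose.bounded_linear_left translate_sum_has_sum[OF w, of a], of "adj W"]
    by (simp add: a(2) ketbra_compose WB)
  have 3: "(\<lambda>t. (\<Sum>\<^sub>\<infinity>s. norm (v s)) * (norm (w t) * K)) summable_on UNIV"
    by (intro summable_on_cmult_left summable_on_cmult_right w)
  obtain Z where "((\<lambda>t. Y t (w t)) has_sum Z) UNIV"
    "su_int (V o\<^sub>L adj W) Z (\<Sum>\<^sub>\<infinity>t. (\<Sum>\<^sub>\<infinity>s. norm (v s)) * (norm (w t) * K))"
    using su_int_sum[where T = "\<lambda>t. ketbra (right_regular t a) (W (w t))" and X = "\<lambda>t. Y t (w t)", OF 1 Y(2) 3]
    by blast
  moreover from this(1) have "Z \<in> M"
    by (rule has_sum_in_closed_subspace[OF M]) (rule Y)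
  ultimately show ?thesis by blast
qed

text \<open>\<open>M\<close> is abstract here and will be the algebra of multiplications by
  functions in C_0(S). Being strictly summable with value in \<open>M\<close> is stable under linear
  combinations, so it spreads over the spans, conjugate-linearly in the second factor and then
  linearly in the first.\<close>

lemma gen_fixed_point_algebra_subset:
  fixes R :: "'g::ab_group_add ell2 set"
  assumes M: "op.subspace M" "closed M"
    and l1: "\<And>a. a \<in> R \<Longrightarrow> l1_vector a"
    and prod: "\<And>a c s t X C. a \<in> R \<Longrightarrow> c \<in> R \<Longrightarrow>
      su_int (ketbra (right_regular s a) (right_regular t c)) X C \<Longrightarrow> X \<in> M"
  shows "gen_fixed_point_algebra (Ad right_regular) compact_ops (ketbra_span R) \<subseteq> M"
proof -
  let ?P = "\<lambda>T. \<exists>X\<in>M. \<exists>C. su_int T X C"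
  let ?S = "op.span (translate_sums R)"
  have P0: "?P 0"
  proof (intro bexI exI)
    show "su_int (0::'g op) 0 0"
      using su_int_scale[OF su_int_delta[of 0 0], of 0] by simp
  qed (simp add: op.subspace_0[OF M(1)])
  have Padd: "?P (scale_op k S + T)" if "?P S" "?P T" for k S T
  proof -
    from that obtain X C Y D where "X \<in> M" "su_int S X C" "Y \<in> M" "su_int T Y D" by blast
    then have "su_int (scale_op k S + T) (scale_op k X + Y) (cmod k * C + D)"
      and "scale_op k X + Y \<in> M"
      by (auto intro!: su_int_add su_int_scale op.subspace_add[OF M(1)] op.subspace_scale[OF M(1)])
    then show ?thesis by blast
  qed
  note lin = blinfun_compose.add_right
      blinfun_compose.add_left
      blinfun_compose.zero_right
      blinfun_compose.zero_left
  have 1: "\<eta> \<in> bounded_ops \<and> ?P (V o\<^sub>L adj \<eta>)" if V: "V \<in> translate_sums R" and "\<eta> \<in> ?S" for V \<eta>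
    using that(2)
  proof (induction rule: op.span_induct_alt)
    case base
    then show ?case using P0 by (simp add: lin)
  next
    case (step k x y)
    have xy: "x \<in> bounded_ops" "y \<in> bounded_ops"
      using translate_sums_bounded[OF step(1)] step(2) by auto
    have VB: "V \<in> bounded_ops" by (rule translate_sums_bounded[OF V])
    have "V o\<^sub>L adj (scale_op k x + y) = scale_op (cnj k) (V o\<^sub>L adj x) + (V o\<^sub>L adj y)"
      by (simp add: adj_add adj_scale xy lin scale_op_compose_right[OF VB])
    then show ?case
      using Padd[OF su_int_translate_sums[OF M l1 prod V step(1)] conjunct2[OF step(2)], where k = "cnj k"] xy
      by simp
  qed
  have 2: "?P (\<xi> o\<^sub>L adj \<eta>)" if "\<xi> \<in> ?S" and \<eta>: "\<eta> \<in> ?S" for \<xi> \<eta>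
    using that(1)
  proof (induction rule: op.span_induct_alt)
    case base
    then show ?case using P0 by (simp add: lin)
  next
    case (step k x y)
    show ?case
      using Padd[OF conjunct2[OF 1[OF step(1) \<eta>]] step(2), where k = k] by (simp add: lin scale_op_compose_left)
  qed
  have "su_sum compact_ops (\<lambda>t. Ad right_regular t (\<xi> o\<^sub>L adj \<eta>)) \<in> M"
    if "\<xi> \<in> saturation (Ad right_regular) compact_ops (ketbra_span R)"
      "\<eta> \<in> saturation (Ad right_regular) compact_ops (ketbra_span R)" for \<xi> \<eta>
    using 2[of \<xi> \<eta>] that saturation_subset[of R] su_sum_su_int by (metis subsetD)
  then have "op.span {su_sum compact_ops (\<lambda>t. Ad right_regular t (\<xi> o\<^sub>L adj \<eta>)) | \<xi> \<eta>.
      \<xi> \<in> saturation (Ad right_regular) compact_ops (ketbra_span R) \<and>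
      \<eta> \<in> saturation (Ad right_regular) compact_ops (ketbra_span R)} \<subseteq> M"
    by (intro op.span_minimal M) blast
  then show ?thesis
    unfolding gen_fixed_point_algebra_def by (intro closure_minimal M)
qed

text \<open>A function \<open>f\<close> concentrated at the neutral element collapses the sum to one
  product, and |xi><delta_0| |delta_0><eta| = |xi><eta| because \<open>delta 0\<close> is a unit
  vector.\<close>

lemma ketbra_in_saturation:
  fixes R :: "'g::ab_group_add ell2 set"
  assumes "\<xi> \<in> R"
  shows "ketbra \<xi> \<eta> \<in> saturation (Ad right_regular) compact_ops (ketbra_span R)"
proof -
  define f where "f t = (if t = 0 then ketbra (delta 0) \<eta> else 0)" for t :: 'g
  have "(\<lambda>t. norm (f t)) summable_on UNIV"
    by (rule finite_nonzero_values_imp_summable_on) (rule finite_subset[of _ "{0}"], auto simp: f_def)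
  then have f: "f \<in> l1_functions compact_ops" by (auto simp: l1_functions_def f_def)
  have "(\<Sum>\<^sub>\<infinity>t. Ad right_regular t (ketbra \<xi> (delta 0) o\<^sub>L f (- t)))
      = (\<Sum>\<^sub>\<infinity>t\<in>{0}. Ad right_regular t (ketbra \<xi> (delta 0) o\<^sub>L f (- t)))"
    by (rule infsum_cong_neutral)
       (auto simp: f_def blinfun_compose.zero_right
          Ad_zero_op)
  also have "\<dots> = ketbra \<xi> \<eta>"
    by (simp add: f_def compose_ketbra) (simp add: ketbra.rep_eq cinner_delta coeff_delta)
  finally show ?thesis
    unfolding saturation_def using f ketbra_in_span[OF assms, of "delta 0"]
    by (intro op.span_base) (auto intro!: exI[of _ "ketbra \<xi> (delta 0)"] exI[of _ f])
qed

text \<open>Every generator of \<open>Fix\<close> already occurs among those of the generalised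
  fixed-point algebra, as |a><c| factors through \<open>delta 0\<close>.\<close>

lemma su_sum_in_gen_fixed_point_algebra:
  fixes R :: "'g::ab_group_add ell2 set"
  assumes "a \<in> R" "c \<in> R"
  shows "su_sum compact_ops (\<lambda>t. ketbra (right_regular t a) (right_regular t c))
    \<in> gen_fixed_point_algebra (Ad right_regular) compact_ops (ketbra_span R)"
proof -
  have "ketbra a (delta 0) o\<^sub>L adj (ketbra c (delta 0)) = ketbra a c"
    by (simp add: compose_ketbra) (simp add: ketbra.rep_eq cinner_delta coeff_delta)
  then have "su_sum compact_ops (\<lambda>t. ketbra (right_regular t a) (right_regular t c))
      = su_sum compact_ops (\<lambda>t. Ad right_regular t (ketbra a (delta 0) o\<^sub>L adj (ketbra c (delta 0))))"
    by (simp add: Ad_ketbra)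
  then show ?thesis
    unfolding gen_fixed_point_algebra_def
    using ketbra_in_saturation[OF assms(1), of "delta 0"] ketbra_in_saturation[OF assms(2), of "delta 0"]
    by (intro closure_subset[THEN subsetD] op.span_base) blast
qed

section \<open>Fourier series of continuous functions on the torus\<close>

definition torus_char :: "int ^ 'k \<Rightarrow> real ^ 'k \<Rightarrow> complex" where
  "torus_char m t = cis (2 * pi * (\<Sum>i\<in>UNIV. of_int (m $ i) * t $ i))"

text \<open>Continuous functions on the torus, lifted along the covering so that means are integrals
  over a cube and derivatives are ordinary ones.\<close>

definition periodic_cont :: "(real ^ 'k \<Rightarrow> complex) set" where
  "periodic_cont = {F. continuous_on UNIV F \<and> (\<forall>t m. F (t + (\<chi> i. of_int (m $ i))) = F t)}"

definition mean :: "(real ^ 'k \<Rightarrow> complex) \<Rightarrow> complex" where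
  "mean F = integral (cbox 0 1) F"

text \<open>The character is not conjugated because \<open>is_fourier_transform\<close> expands in
  conjugated characters. With this sign, multiplication by the character \<open>n\<close>
  corresponds to \<open>right_regular n\<close>.\<close>

definition fourier_coeff :: "(real ^ 'k \<Rightarrow> complex) \<Rightarrow> int ^ 'k \<Rightarrow> complex" where
  "fourier_coeff F m = mean (\<lambda>t. torus_char m t * F t)"

lemma torus_char_add: "torus_char m (s + t) = torus_char m s * torus_char m t"
  by (simp add: torus_char_def cis_mult algebra_simps sum.distrib)

lemma torus_char_mult: "torus_char m t * torus_char n t = torus_char (m + n) t"
  by (simp add: torus_char_def cis_mult algebra_simps sum.distrib)

lemma torus_char_axis:
  "torus_char m (axis i h) = cis (2 * pi * of_int (m $ i) * h)"
proof -
  have "(\<Sum>j\<in>UNIV. of_int (m $ j) * axis i h $ j) = (\<Sum>j\<in>UNIV. if j = i then of_int (m $ i) * h else 0)"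
    by (rule sum.cong) (auto simp: axis_def)
  then show ?thesis by (simp add: torus_char_def mult_ac)
qed

lemma cnj_torus_char: "cnj (torus_char m t) = torus_char (- m) t"
  by (simp add: torus_char_def cis_cnj sum_negf)

lemma torus_char_zero [simp]: "torus_char 0 t = 1" "torus_char m 0 = 1"
  by (simp_all add: torus_char_def)

lemma cmod_torus_char [simp]: "cmod (torus_char m t) = 1"
  by (simp add: torus_char_def)

lemma cis_eq_1_iff: "cis (2 * pi * a) = 1 \<longleftrightarrow> a \<in> \<int>"
proof
  assume "cis (2 * pi * a) = 1"
  then have "cos (2 * pi * a) = 1" by (simp add: complex_eq_iff)
  then obtain n :: int where "2 * pi * a = of_int n * 2 * pi" by (auto simp: cos_one_2pi_int)
  then have "a = of_int n" by simp
  then show "a \<in> \<int>" by simp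
next
  assume "a \<in> \<int>"
  then show "cis (2 * pi * a) = 1" by (rule cis_multiple_2pi)
qed

lemma torus_char_int: "torus_char m (\<chi> i. of_int (n $ i)) = 1"
proof -
  have "(\<Sum>i\<in>UNIV. of_int (m $ i) * of_int (n $ i)) \<in> (\<int> :: real set)" by (intro Ints_sum Ints_mult) auto
  then show ?thesis by (simp add: torus_char_def cis_eq_1_iff)
qed

lemma periodic_contD: "F \<in> periodic_cont \<Longrightarrow> continuous_on A F"
  unfolding periodic_cont_def using continuous_on_subset by blast

lemma periodic_cont_int: "F \<in> periodic_cont \<Longrightarrow> F (t + (\<chi> i. of_int (m $ i))) = F t"
  by (simp add: periodic_cont_def)

lemma periodic_cont_intros [intro]:
  "(\<lambda>t. c) \<in> periodic_cont"
  "torus_char m \<in> periodic_cont" "(\<lambda>t. torus_char m t) \<in> periodic_cont"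
  "F \<in> periodic_cont \<Longrightarrow> G \<in> periodic_cont \<Longrightarrow> (\<lambda>t. F t + G t) \<in> periodic_cont"
  "F \<in> periodic_cont \<Longrightarrow> G \<in> periodic_cont \<Longrightarrow> (\<lambda>t. F t - G t) \<in> periodic_cont"
  "F \<in> periodic_cont \<Longrightarrow> G \<in> periodic_cont \<Longrightarrow> (\<lambda>t. F t * G t) \<in> periodic_cont"
  "F \<in> periodic_cont \<Longrightarrow> (\<lambda>t. cnj (F t)) \<in> periodic_cont"
proof -
  show *: "torus_char m \<in> periodic_cont"
    unfolding periodic_cont_def
    by (auto simp: torus_char_add torus_char_int) (auto simp: torus_char_def[abs_def] intro!: continuous_intros)
  then show "(\<lambda>t. torus_char m t) \<in> periodic_cont" .
qed (auto simp: periodic_cont_def intro!: continuous_intros)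

lemma periodic_cont_sum:
  "(\<And>i. i \<in> A \<Longrightarrow> F i \<in> periodic_cont) \<Longrightarrow> (\<lambda>t. \<Sum>i\<in>A. F i t) \<in> periodic_cont"
  by (induction A rule: infinite_finite_induct) auto

lemma periodic_cont_integrable: "F \<in> periodic_cont \<Longrightarrow> F integrable_on cbox 0 1"
  by (intro integrable_continuous periodic_contD)

lemma mean_add: "F \<in> periodic_cont \<Longrightarrow> G \<in> periodic_cont \<Longrightarrow> mean (\<lambda>t. F t + G t) = mean F + mean G"
  unfolding mean_def by (intro integral_add periodic_cont_integrable)

lemma mean_diff: "F \<in> periodic_cont \<Longrightarrow> G \<in> periodic_cont \<Longrightarrow> mean (\<lambda>t. F t - G t) = mean F - mean G"
  unfolding mean_def by (intro integral_diff periodic_cont_integrable)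

lemma mean_cmult: "mean (\<lambda>t. c * F t) = c * mean F"
  unfolding mean_def by simp

lemma mean_sum:
  assumes "\<And>i. i \<in> A \<Longrightarrow> F i \<in> periodic_cont"
  shows "mean (\<lambda>t. \<Sum>i\<in>A. F i t) = (\<Sum>i\<in>A. mean (F i))"
  using assms
proof (induction A rule: infinite_finite_induct)
  case (insert x A)
  then show ?case by (simp add: mean_add periodic_cont_sum)
qed (auto simp: mean_def)

lemma mean_cnj: "mean (\<lambda>t. cnj (F t)) = cnj (mean F)"
  by (simp add: mean_def integral_cnj)

lemma content_unit_cube: "measure lborel (cbox 0 (1 :: real ^ 'k)) = 1"
proof -
  have "0 \<in> cbox 0 (1 :: real ^ 'k)" by (simp add: mem_box_cart)
  then show ?thesis by (subst content_cbox_cart) auto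
qed

lemma mean_const [simp]: "mean (\<lambda>t :: real ^ 'k. c) = c"
  by (simp add: mean_def content_unit_cube)

lemma norm_mean_le:
  fixes F :: "real ^ 'k \<Rightarrow> complex"
  assumes F: "F \<in> periodic_cont" and B: "\<And>t. t \<in> cbox 0 1 \<Longrightarrow> cmod (F t) \<le> B"
  shows "cmod (mean F) \<le> B"
proof -
  have "cmod (F 0) \<le> B" by (rule B) (simp add: mem_box_cart)
  then have "0 \<le> B" using norm_ge_zero order_trans by blast
  then have "cmod (mean F) \<le> B * measure lborel (cbox 0 (1 :: real ^ 'k))"
    unfolding mean_def
    by (rule has_integral_bound[OF _ integrable_integral[OF periodic_cont_integrable[OF F]]]) (rule B)
  then show ?thesis by (simp add: content_unit_cube)
qed

text \<open>The shifted cube is cut at height 1 in direction \<open>i\<close>; by periodicity the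
  slice above, moved back by one period, fills the gap left at the bottom of the unit cube.\<close>

lemma mean_shift_axis:
  fixes F :: "real ^ 'k \<Rightarrow> complex"
  assumes F: "F \<in> periodic_cont" and h: "0 \<le> h" "h \<le> 1"
  shows "mean (\<lambda>t. F (t + axis i h)) = mean F"
proof -
  let ?c = "axis i h :: real ^ 'k" and ?e = "axis i 1 :: real ^ 'k"
  have Fint: "F integrable_on cbox a b" for a b
    by (intro integrable_continuous periodic_contD F)
  have e: "?e \<in> Basis" by (simp add: axis_in_Basis_iff)
  have mem: "x \<in> cbox a b \<longleftrightarrow> (a $ i \<le> x $ i \<and> x $ i \<le> b $ i) \<and>
      (\<forall>j. j \<noteq> i \<longrightarrow> a $ j \<le> x $ j \<and> x $ j \<le> b $ j)" for x a b :: "real ^ 'k"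
    unfolding mem_box_cart by metis
  have ie: "x \<bullet> ?e = x $ i" for x by (simp add: inner_axis)
  have ax: "axis i a $ j = (if j = i then a else 0)" for a :: real and j by (simp add: axis_def)
  have Q1: "cbox ?c (1 + ?c) \<inter> {x. x \<bullet> ?e \<le> 1} = cbox 0 1 \<inter> {x. x \<bullet> ?e \<ge> h}"
    using h by (auto simp: mem ie ax)
  have Q2: "cbox ?c (1 + ?c) \<inter> {x. x \<bullet> ?e \<ge> 1} = cbox ?e (1 + axis i (h - 1) + ?e)"
    using h by (auto simp: mem ie ax)
  have P1: "cbox 0 1 \<inter> {x. x \<bullet> ?e \<le> h} = cbox 0 (1 + axis i (h - 1))"
    using h by (auto simp: mem ie ax)
  have per: "F (x + ?e) = F x" for x
  proof -
    have "(\<chi> j. of_int ((axis i 1 :: int ^ 'k) $ j)) = ?e" by (auto simp: vec_eq_iff axis_def)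
    then show ?thesis using periodic_cont_int[OF F, of x "axis i 1"] by simp
  qed
  have "mean (\<lambda>t. F (t + ?c)) = integral (cbox ?c (1 + ?c)) F"
    using integral_shift_cbox[of ?c ?c "1 + ?c" F] by (simp add: mean_def)
  also have "\<dots> = integral (cbox 0 1 \<inter> {x. x \<bullet> ?e \<ge> h}) F + integral (cbox ?e (1 + axis i (h - 1) + ?e)) F"
    using integral_split[OF Fint e, of ?c "1 + ?c" 1] by (simp only: Q1 Q2)
  also have "integral (cbox ?e (1 + axis i (h - 1) + ?e)) F = integral (cbox 0 (1 + axis i (h - 1))) F"
    using integral_shift_cbox[of ?e ?e "1 + axis i (h - 1) + ?e" F] by (simp add: per)
  also have "integral (cbox 0 1 \<inter> {x. x \<bullet> ?e \<ge> h}) F + integral (cbox 0 (1 + axis i (h - 1))) F = mean F"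
    using integral_split[OF Fint e, of 0 1 h] by (simp add: P1 mean_def)
  finally show ?thesis .
qed

lemma mean_torus_char: "mean (torus_char m) = (if m = 0 then 1 else 0)"
proof (cases "m = 0")
  case True
  then have "torus_char m = (\<lambda>t. 1)" by auto
  then show ?thesis using True by simp
next
  case False
  then obtain i where i: "m $ i \<noteq> 0" by (auto simp: vec_eq_iff)
  \<comment> \<open>Half a period of the character in direction \<open>i\<close>: shifting by
    \<open>h\<close> flips its sign, so its mean equals its own negative and no integral has to be
    evaluated.\<close>
  define h where "h = 1 / (2 * \<bar>real_of_int (m $ i)\<bar>)"
  have "\<bar>real_of_int (m $ i)\<bar> \<ge> 1" using i by linarith
  then have h: "0 \<le> h" "h \<le> 1" by (auto simp: h_def divide_le_eq)
  have "2 * pi * of_int (m $ i) * h = (if m $ i > 0 then pi else - pi)"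
    using i by (auto simp: h_def field_simps)
  then have "torus_char m (axis i h) = - 1"
    by (auto simp: torus_char_axis cis_pi complex_eq_iff)
  then have "(\<lambda>t. torus_char m (t + axis i h)) = (\<lambda>t. (- 1) * torus_char m t)"
    by (auto simp: torus_char_add)
  then have "mean (\<lambda>t. (- 1) * torus_char m t) = mean (torus_char m)"
    using mean_shift_axis[OF _ h, of "torus_char m" i] by auto
  then have "(- 1) * mean (torus_char m) = mean (torus_char m)"
    by (simp only: mean_cmult)
  then show ?thesis using False by simp
qed

section \<open>Density of the trigonometric polynomials\<close>

inductive_set trig :: "(real ^ 'k \<Rightarrow> complex) set" where
  trig_char: "(\<lambda>t. c * torus_char m t) \<in> trig"
| trig_add: "p \<in> trig \<Longrightarrow> q \<in> trig \<Longrightarrow> (\<lambda>t. p t + q t) \<in> trig"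

lemma trig_periodic_cont: "p \<in> trig \<Longrightarrow> p \<in> periodic_cont"
  by (induction rule: trig.induct) auto

lemma trig_scale: "p \<in> trig \<Longrightarrow> (\<lambda>t. c * p t) \<in> trig"
proof (induction rule: trig.induct)
  case (trig_char d m)
  then show ?case using trig.trig_char[of "c * d" m] by (simp add: mult.assoc)
next
  case (trig_add p q)
  then show ?case using trig.trig_add by (simp add: distrib_left)
qed

lemma trig_mult: "p \<in> trig \<Longrightarrow> q \<in> trig \<Longrightarrow> (\<lambda>t. p t * q t) \<in> trig"
proof (induction rule: trig.induct)
  case (trig_char c m)
  then show ?case
  proof (induction rule: trig.induct)
    case (trig_char d n)
    have "(\<lambda>t. c * torus_char m t * (d * torus_char n t)) = (\<lambda>t. (c * d) * torus_char (m + n) t)"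
      by (auto simp: torus_char_mult[symmetric])
    then show ?case using trig.trig_char[of "c * d" "m + n"] by simp
  next
    case (trig_add p q)
    then show ?case using trig.trig_add by (simp add: distrib_left)
  qed
next
  case (trig_add p q)
  then show ?case using trig.trig_add by (simp add: distrib_right)
qed

lemma trig_const: "(\<lambda>t. c) \<in> trig"
  using trig_char[of c 0] by simp

section \<open>The torus as a quotient of real space, and Stone-Weierstrass on it\<close>

lemma torus_exp_eq_iff: "torus_exp s = torus_exp t \<longleftrightarrow> (\<exists>m. s = t + (\<chi> i. of_int (m $ i)))"
proof -
  have 1: "cis (2 * pi * a) = cis (2 * pi * b) \<longleftrightarrow> a - b \<in> \<int>" for a b
  proof -
    have "cis (2 * pi * a) = cis (2 * pi * (a - b)) * cis (2 * pi * b)"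
      by (simp add: cis_mult algebra_simps)
    then show ?thesis using cis_eq_1_iff[of "a - b"] by (metis cis_neq_zero mult_cancel_right2)
  qed
  have "torus_exp s = torus_exp t \<longleftrightarrow> (\<forall>i. s $ i - t $ i \<in> \<int>)"
    by (simp add: torus_exp_def vec_eq_iff 1)
  also have "\<dots> \<longleftrightarrow> (\<exists>m. s = t + (\<chi> i. of_int (m $ i)))"
  proof
    assume "\<forall>i. s $ i - t $ i \<in> \<int>"
    then have "\<forall>i. \<exists>n::int. s $ i - t $ i = of_int n" by (auto elim!: Ints_cases)
    then obtain n where "\<And>i. s $ i - t $ i = of_int (n i)" by metis
    then show "\<exists>m. s = t + (\<chi> i. of_int (m $ i))"
      by (intro exI[of _ "\<chi> i. n i"]) (auto simp: vec_eq_iff algebra_simps)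
  qed auto
  finally show ?thesis .
qed

lemma continuous_on_torus_exp: "continuous_on A torus_exp"
  unfolding torus_exp_def by (intro continuous_intros)

lemma torus_exp_in_torus [simp]: "torus_exp t \<in> torus"
  by (simp add: torus_exp_def torus_def)

lemma torus_exp_surj: "torus_exp ` cbox 0 1 = (torus :: (complex ^ 'k) set)"
proof -
  have "z \<in> torus_exp ` cbox 0 1" if "z \<in> torus" for z :: "complex ^ 'k"
  proof -
    have "\<exists>a. 0 \<le> a \<and> a \<le> 1 \<and> cis (2 * pi * a) = z $ i" for i
    proof -
      have "cmod (z $ i) = 1" using that by (simp add: torus_def)
      then obtain b where b: "0 \<le> b" "b < 2 * pi" "z $ i = cis b"
        by (metis complex_unimodular_polar cis.code complex_eq_iff cis.sel)
      then show ?thesis by (intro exI[of _ "b / (2 * pi)"]) auto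
    qed
    then obtain a where "\<And>i. 0 \<le> a i" "\<And>i. a i \<le> 1" "\<And>i. cis (2 * pi * a i) = z $ i" by metis
    then show ?thesis
      by (intro image_eqI[of _ _ "\<chi> i. a i"]) (auto simp: torus_exp_def mem_box_cart vec_eq_iff)
  qed
  then show ?thesis by auto
qed

lemma torus_exp_surj_UNIV: "z \<in> torus \<Longrightarrow> \<exists>t. z = torus_exp t"
  using torus_exp_surj by blast

lemma compact_torus: "compact (torus :: (complex ^ 'k) set)"
  unfolding torus_exp_surj[symmetric] by (intro compact_continuous_image continuous_on_torus_exp compact_cbox)

text \<open>The covering restricted to the compact cube is a closed map, so the torus carries the
  quotient topology: the preimage of a closed set is the image of a compact one.\<close>

lemma continuous_on_torusI:
  fixes f :: "complex ^ 'k \<Rightarrow> 'b::topological_space"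
  assumes "continuous_on UNIV (f \<circ> torus_exp)"
  shows "continuous_on torus f"
  unfolding continuous_on_closed_vimage[OF compact_imp_closed[OF compact_torus]]
proof (intro allI impI)
  fix B :: "'b set" assume B: "closed B"
  have "f -` B \<inter> torus = torus_exp ` (cbox 0 1 \<inter> (f \<circ> torus_exp) -` B)"
    unfolding torus_exp_surj[symmetric] by auto
  moreover have "closed ((f \<circ> torus_exp) -` B)"
    by (rule closed_vimage[OF B assms])
  ultimately show "closed (f -` B \<inter> torus)"
    by (simp add: compact_imp_closed compact_continuous_image continuous_on_torus_exp compact_Int_closed)
qed

text \<open>An arbitrary section of the covering with no continuity; composed with a periodic
  function it yields the function induced on the torus.\<close>

definition torus_log :: "complex ^ 'k \<Rightarrow> real ^ 'k" where
  "torus_log z = (SOME t. torus_exp t = z)"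

lemma periodic_cont_torus_log: "F \<in> periodic_cont \<Longrightarrow> F (torus_log (torus_exp t)) = F t"
proof -
  assume F: "F \<in> periodic_cont"
  have "torus_exp (torus_log (torus_exp t)) = torus_exp t"
    unfolding torus_log_def by (rule someI) (rule refl)
  then show ?thesis unfolding torus_exp_eq_iff using periodic_cont_int[OF F] by auto
qed

lemma periodic_cont_comp:
  fixes f :: "complex ^ 'k \<Rightarrow> complex"
  assumes f: "continuous_on torus f"
  shows "f \<circ> torus_exp \<in> periodic_cont"
proof -
  have "continuous_on UNIV (f \<circ> torus_exp)"
    by (rule continuous_on_compose) (auto intro: continuous_on_torus_exp continuous_on_subset[OF f])
  moreover have "torus_exp (t + (\<chi> i. of_int (m $ i))) = torus_exp t" for t :: "real ^ 'k" and m
    using torus_exp_eq_iff by blast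
  ultimately show ?thesis by (simp add: periodic_cont_def)
qed

text \<open>The real Stone-Weierstrass theorem is applied to real and imaginary part separately. The
  real algebra \<open>P\<close> consists of the functions whose lift is a trigonometric polynomial
  with complex coefficients.\<close>

theorem trig_dense:
  fixes F :: "real ^ 'k \<Rightarrow> complex"
  assumes F: "F \<in> periodic_cont" and e: "e > 0"
  shows "\<exists>p\<in>trig. \<forall>t. cmod (F t - p t) < e"
proof -
  define P where "P r \<longleftrightarrow> (\<exists>p\<in>trig. \<forall>t. complex_of_real (r (torus_exp t)) = p t)"
    for r :: "complex ^ 'k \<Rightarrow> real"
  have sw: "\<exists>r. P r \<and> (\<forall>z\<in>torus. \<bar>f z - r z\<bar> < e / 2)" if f: "continuous_on torus f" for f
  proof (rule Stone_Weierstrass_HOL[OF compact_torus _ _ _ _ _ f])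
    show "P (\<lambda>z. c)" for c
      unfolding P_def by (intro bexI[of _ "\<lambda>t. complex_of_real c"]) (auto intro: trig_const)
    show "continuous_on torus r" if "P r" for r
    proof (rule continuous_on_torusI)
      obtain p where p: "p \<in> trig" "\<And>t. complex_of_real (r (torus_exp t)) = p t"
        using \<open>P r\<close> by (auto simp: P_def)
      have "r \<circ> torus_exp = (\<lambda>t. Re (p t))" using p(2) by (auto simp: fun_eq_iff) (metis Re_complex_of_real)
      then show "continuous_on UNIV (r \<circ> torus_exp)"
        using periodic_contD[OF trig_periodic_cont[OF p(1)]] by (auto intro!: continuous_intros)
    qed
    show "P (\<lambda>x. r x + s x)" if "P r \<and> P s" for r s
    proof -
      obtain p q where "p \<in> trig" "\<And>t. complex_of_real (r (torus_exp t)) = p t"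
        "q \<in> trig" "\<And>t. complex_of_real (s (torus_exp t)) = q t" using \<open>P r \<and> P s\<close> by (auto simp: P_def)
      then show ?thesis unfolding P_def by (intro bexI[of _ "\<lambda>t. p t + q t"]) (auto intro: trig_add)
    qed
    show "P (\<lambda>x. r x * s x)" if "P r \<and> P s" for r s
    proof -
      obtain p q where "p \<in> trig" "\<And>t. complex_of_real (r (torus_exp t)) = p t"
        "q \<in> trig" "\<And>t. complex_of_real (s (torus_exp t)) = q t" using \<open>P r \<and> P s\<close> by (auto simp: P_def)
      then show ?thesis unfolding P_def by (intro bexI[of _ "\<lambda>t. p t * q t"]) (auto intro: trig_mult)
    qed
    \<comment> \<open>Cosine and sine of one coordinate, written with the characters of frequency 1
      and -1; together they separate the points of the torus.\<close>
    have "P (\<lambda>z. Re (z $ i))" for i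
      unfolding P_def
    proof (intro bexI allI)
      show "(\<lambda>t. (1/2) * torus_char (axis i 1) t + (1/2) * torus_char (axis i (-1)) t) \<in> trig"
        by (intro trig.intros)
      fix t :: "real ^ 'k"
      have s: "(\<Sum>j\<in>UNIV. real_of_int (axis i a $ j) * t $ j) = of_int a * t $ i" for a
        by (subst sum.mono_neutral_cong_right[of UNIV "{i}" _ "\<lambda>j. of_int a * t $ i"]) (auto simp: axis_def)
      show "complex_of_real (Re (torus_exp t $ i))
          = (1/2) * torus_char (axis i 1) t + (1/2) * torus_char (axis i (-1)) t"
        by (simp add: torus_char_def torus_exp_def s complex_eq_iff)
    qed
    moreover have "P (\<lambda>z. Im (z $ i))" for i
      unfolding P_def
    proof (intro bexI allI)
      show "(\<lambda>t. (- \<i>/2) * torus_char (axis i 1) t + (\<i>/2) * torus_char (axis i (-1)) t) \<in> trig"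
        by (intro trig.intros)
      fix t :: "real ^ 'k"
      have s: "(\<Sum>j\<in>UNIV. real_of_int (axis i a $ j) * t $ j) = of_int a * t $ i" for a
        by (subst sum.mono_neutral_cong_right[of UNIV "{i}" _ "\<lambda>j. of_int a * t $ i"]) (auto simp: axis_def)
      show "complex_of_real (Im (torus_exp t $ i))
          = (- \<i>/2) * torus_char (axis i 1) t + (\<i>/2) * torus_char (axis i (-1)) t"
        by (simp add: torus_char_def torus_exp_def s complex_eq_iff)
    qed
    ultimately show "\<exists>r. P r \<and> r x \<noteq> r y" if "x \<in> torus \<and> y \<in> torus \<and> x \<noteq> y" for x y
    proof -
      obtain i where "x $ i \<noteq> y $ i" using \<open>x \<in> torus \<and> y \<in> torus \<and> x \<noteq> y\<close> by (auto simp: vec_eq_iff)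
      then have "Re (x $ i) \<noteq> Re (y $ i) \<or> Im (x $ i) \<noteq> Im (y $ i)" by (auto simp: complex_eq_iff)
      then show ?thesis
        using \<open>\<And>i. P (\<lambda>z. Re (z $ i))\<close>[of i] \<open>\<And>i. P (\<lambda>z. Im (z $ i))\<close>[of i] by auto
    qed
  qed (use e in auto)
  have comp: "(\<lambda>z. F (torus_log z)) \<circ> torus_exp = F"
    by (auto simp: periodic_cont_torus_log[OF F])
  have cont: "continuous_on torus (\<lambda>z. F (torus_log z))"
    by (rule continuous_on_torusI) (simp only: comp periodic_contD[OF F])
  obtain r s where r: "P r" "\<And>z. z \<in> torus \<Longrightarrow> \<bar>Re (F (torus_log z)) - r z\<bar> < e / 2"
    and s: "P s" "\<And>z. z \<in> torus \<Longrightarrow> \<bar>Im (F (torus_log z)) - s z\<bar> < e / 2"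
    using sw[OF continuous_on_Re[OF cont]] sw[OF continuous_on_Im[OF cont]] by blast
  obtain p q where p: "p \<in> trig" "\<And>t. complex_of_real (r (torus_exp t)) = p t"
    and q: "q \<in> trig" "\<And>t. complex_of_real (s (torus_exp t)) = q t" using r(1) s(1) by (auto simp: P_def)
  show ?thesis
  proof (intro bexI allI)
    show "(\<lambda>t. p t + \<i> * q t) \<in> trig" by (intro trig_add trig_scale p q)
    fix t
    have "\<bar>Re (F t) - r (torus_exp t)\<bar> < e / 2" "\<bar>Im (F t) - s (torus_exp t)\<bar> < e / 2"
      using r(2)[of "torus_exp t"] s(2)[of "torus_exp t"] by (auto simp: periodic_cont_torus_log[OF F])
    moreover have "cmod (F t - (p t + \<i> * q t)) \<le> \<bar>Re (F t) - r (torus_exp t)\<bar> + \<bar>Im (F t) - s (torus_exp t)\<bar>"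
      by (rule order_trans[OF cmod_le]) (simp add: p(2)[symmetric] q(2)[symmetric])
    ultimately show "cmod (F t - (p t + \<i> * q t)) < e" by linarith
  qed
qed

section \<open>Parseval's identity\<close>

definition mean_square :: "(real ^ 'k \<Rightarrow> complex) \<Rightarrow> real" where
  "mean_square F = integral (cbox 0 1) (\<lambda>t. (cmod (F t))\<^sup>2)"

lemma mean_square_eq: assumes "F \<in> periodic_cont"
  shows "mean (\<lambda>t. F t * cnj (F t)) = complex_of_real (mean_square F)"
proof -
  have "(\<lambda>t. (cmod (F t))\<^sup>2) integrable_on cbox 0 1"
    by (intro integrable_continuous continuous_intros periodic_contD assms)
  from integral_linear[OF this bounded_linear_of_real[where 'a = complex]]
  show ?thesis by (simp add: mean_def mean_square_def o_def complex_norm_square[symmetric])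
qed

lemma mean_square_nonneg: assumes "F \<in> periodic_cont" shows "mean_square F \<ge> 0"
  unfolding mean_square_def
  by (intro integral_nonneg integrable_continuous continuous_intros periodic_contD assms) auto

lemma mean_square_le:
  assumes "F \<in> periodic_cont" "\<And>t. cmod (F t) \<le> B"
  shows "mean_square F \<le> B\<^sup>2"
proof -
  have "cmod (mean (\<lambda>t. F t * cnj (F t))) \<le> B\<^sup>2"
  proof (rule norm_mean_le)
    show "cmod (F t * cnj (F t)) \<le> B\<^sup>2" for t
      using power_mono[OF assms(2), of t 2] by (simp add: norm_mult power2_eq_square)
  qed (use assms in auto)
  then show ?thesis using mean_square_nonneg[OF assms(1)] by (simp add: mean_square_eq assms)
qed

lemma fourier_coeff_torus_char: "fourier_coeff (torus_char n) m = (if m = - n then 1 else 0)"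
  by (simp add: fourier_coeff_def torus_char_mult mean_torus_char eq_neg_iff_add_eq_0)

lemma fourier_coeff_add: "F \<in> periodic_cont \<Longrightarrow> G \<in> periodic_cont \<Longrightarrow>
    fourier_coeff (\<lambda>t. F t + G t) m = fourier_coeff F m + fourier_coeff G m"
  by (simp add: fourier_coeff_def distrib_left mean_add periodic_cont_intros)

lemma fourier_coeff_diff: "F \<in> periodic_cont \<Longrightarrow> G \<in> periodic_cont \<Longrightarrow>
    fourier_coeff (\<lambda>t. F t - G t) m = fourier_coeff F m - fourier_coeff G m"
  by (simp add: fourier_coeff_def right_diff_distrib mean_diff periodic_cont_intros)

lemma fourier_coeff_scale: "fourier_coeff (\<lambda>t. c * F t) m = c * fourier_coeff F m"
  by (simp add: fourier_coeff_def mean_cmult[symmetric] mult_ac)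

lemma fourier_coeff_char_mult: "fourier_coeff (\<lambda>t. torus_char n t * F t) m = fourier_coeff F (m + n)"
  by (simp add: fourier_coeff_def mult.assoc[symmetric] torus_char_mult)

lemma fourier_coeff_cnj: "fourier_coeff (\<lambda>t. cnj (F t)) m = cnj (fourier_coeff F (- m))"
  by (simp add: fourier_coeff_def mean_cnj[symmetric] cnj_torus_char)

lemma norm_fourier_coeff_le:
  assumes "F \<in> periodic_cont" "\<And>t. t \<in> cbox 0 1 \<Longrightarrow> cmod (F t) \<le> B"
  shows "cmod (fourier_coeff F m) \<le> B"
  unfolding fourier_coeff_def by (rule norm_mean_le) (use assms in \<open>auto simp: norm_mult\<close>)

text \<open>By orthonormality of the characters both cross terms and the square of the partial sum
  have the same mean \<open>S\<close>, so one \<open>S\<close> survives with a minus sign. This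
  gives Bessel's inequality and, once the norm is known, the exact size of the truncation
  error.\<close>

lemma mean_square_partial_sum:
  assumes F: "F \<in> periodic_cont" and A: "finite A"
  shows "mean_square (\<lambda>t. F t - (\<Sum>m\<in>A. fourier_coeff F m * cnj (torus_char m t)))
    = mean_square F - (\<Sum>m\<in>A. (cmod (fourier_coeff F m))\<^sup>2)"
proof -
  define c where "c = fourier_coeff F"
  define s where "s t = (\<Sum>m\<in>A. c m * cnj (torus_char m t))" for t
  define S where "S = (\<Sum>m\<in>A. c m * cnj (c m))"
  have s: "s \<in> periodic_cont" unfolding s_def[abs_def] by (intro periodic_cont_sum periodic_cont_intros)
  have 1: "mean (\<lambda>t. F t * cnj (s t)) = S"
  proof -
    have "mean (\<lambda>t. F t * cnj (s t)) = mean (\<lambda>t. \<Sum>m\<in>A. cnj (c m) * (torus_char m t * F t))"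
      by (simp add: s_def sum_distrib_left mult_ac)
    also have "\<dots> = (\<Sum>m\<in>A. mean (\<lambda>t. cnj (c m) * (torus_char m t * F t)))"
      using F by (intro mean_sum periodic_cont_intros)
    also have "\<dots> = (\<Sum>m\<in>A. cnj (c m) * c m)"
      by (simp only: mean_cmult) (simp add: c_def fourier_coeff_def)
    finally show ?thesis by (simp add: S_def mult.commute)
  qed
  have 2: "mean (\<lambda>t. s t * cnj (F t)) = S"
  proof -
    have "mean (\<lambda>t. s t * cnj (F t)) = mean (\<lambda>t. cnj (F t * cnj (s t)))" by (simp add: mult.commute)
    also have "\<dots> = cnj S" by (simp only: mean_cnj 1)
    finally show ?thesis by (simp add: S_def mult.commute)
  qed
  have 3: "mean (\<lambda>t. s t * cnj (s t)) = S"
  proof -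
    have "mean (\<lambda>t. s t * cnj (s t))
        = mean (\<lambda>t. \<Sum>m\<in>A. \<Sum>n\<in>A. (c m * cnj (c n)) * torus_char (n - m) t)"
      unfolding s_def cnj_sum sum_product
      by (simp add: cnj_torus_char torus_char_mult[of _ _ "- _", symmetric] mult_ac
          torus_char_mult[symmetric, of _ "- _", simplified])
    also have "\<dots> = (\<Sum>m\<in>A. \<Sum>n\<in>A. (c m * cnj (c n)) * mean (torus_char (n - m)))"
      by (subst mean_sum, intro periodic_cont_sum periodic_cont_intros, subst mean_sum,
          intro periodic_cont_intros, simp only: mean_cmult)
    also have "\<dots> = (\<Sum>m\<in>A. \<Sum>n\<in>A. if n = m then c m * cnj (c n) else 0)"
      by (intro sum.cong refl) (simp add: mean_torus_char)
    also have "\<dots> = S" using A by (simp add: S_def)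
    finally show ?thesis .
  qed
  have "complex_of_real (mean_square (\<lambda>t. F t - s t)) = mean (\<lambda>t. (F t - s t) * cnj (F t - s t))"
    by (rule mean_square_eq[symmetric]) (intro periodic_cont_intros F s)
  also have "\<dots> = mean (\<lambda>t. (F t * cnj (F t) - F t * cnj (s t)) - (s t * cnj (F t) - s t * cnj (s t)))"
    by (simp add: algebra_simps)
  also have "\<dots> = mean (\<lambda>t. F t * cnj (F t)) - S"
    using F s by (simp add: mean_diff periodic_cont_intros 1 2 3)
  also have "\<dots> = complex_of_real (mean_square F - (\<Sum>m\<in>A. (cmod (c m))\<^sup>2))"
    unfolding mean_square_eq[OF F] by (simp add: S_def complex_norm_square[symmetric])
  finally show ?thesis unfolding of_real_eq_iff by (simp add: s_def c_def)
qed

lemma bessel: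
  assumes F: "F \<in> periodic_cont" and A: "finite A"
  shows "(\<Sum>m\<in>A. (cmod (fourier_coeff F m))\<^sup>2) \<le> mean_square F"
proof -
  have "mean_square (\<lambda>t. F t - (\<Sum>m\<in>A. fourier_coeff F m * cnj (torus_char m t))) \<ge> 0"
    by (intro mean_square_nonneg periodic_cont_intros periodic_cont_sum F)
  then show ?thesis by (simp add: mean_square_partial_sum[OF F A])
qed

section \<open>Coefficient vectors and Parseval's identity\<close>

definition fourier_vec :: "(real ^ 'k \<Rightarrow> complex) \<Rightarrow> (int ^ 'k) ell2" where
  "fourier_vec F = Abs_ell2 (fourier_coeff F)"

lemma coeff_fourier_vec [simp]:
  assumes F: "F \<in> periodic_cont"
  shows "coeff (fourier_vec F) m = fourier_coeff F m"
proof -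
  have "(\<lambda>m. (cmod (fourier_coeff F m))\<^sup>2) summable_on UNIV"
    using bessel[OF F] by (intro nonneg_bdd_above_summable_on) (auto simp: bdd_above_def)
  then show ?thesis by (simp add: fourier_vec_def Abs_ell2_inverse)
qed

lemma norm_fourier_vec_square_le:
  assumes F: "F \<in> periodic_cont" shows "(norm (fourier_vec F))\<^sup>2 \<le> mean_square F"
  unfolding norm_ell2_square
  by (rule infsum_le_finite_sums) (use bessel[OF F] F square_summable_coeff[of "fourier_vec F"] in auto)

lemma norm_fourier_vec_le:
  assumes F: "F \<in> periodic_cont" and B: "\<And>t. cmod (F t) \<le> B"
  shows "norm (fourier_vec F) \<le> B"
proof -
  have "0 \<le> B" using B[of 0] norm_ge_zero order_trans by blast
  have "(norm (fourier_vec F))\<^sup>2 \<le> B\<^sup>2"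
    using norm_fourier_vec_square_le[OF F] mean_square_le[OF F B] by linarith
  then show ?thesis using \<open>0 \<le> B\<close> by (simp add: power2_le_iff_abs_le)
qed

lemma fourier_vec_add: "F \<in> periodic_cont \<Longrightarrow> G \<in> periodic_cont \<Longrightarrow>
    fourier_vec (\<lambda>t. F t + G t) = fourier_vec F + fourier_vec G"
  by (rule ell2_eqI) (simp add: fourier_coeff_add periodic_cont_intros)

lemma fourier_vec_diff: "F \<in> periodic_cont \<Longrightarrow> G \<in> periodic_cont \<Longrightarrow>
    fourier_vec (\<lambda>t. F t - G t) = fourier_vec F - fourier_vec G"
  by (rule ell2_eqI) (simp add: fourier_coeff_diff periodic_cont_intros)

lemma fourier_vec_scale: "F \<in> periodic_cont \<Longrightarrow> fourier_vec (\<lambda>t. c * F t) = scaleC c (fourier_vec F)"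
  by (rule ell2_eqI) (simp add: fourier_coeff_scale periodic_cont_intros)

lemma fourier_vec_torus_char: "fourier_vec (torus_char m) = delta (- m)"
  by (rule ell2_eqI) (auto simp: fourier_coeff_torus_char coeff_delta periodic_cont_intros)

lemma fourier_vec_char_mult: "F \<in> periodic_cont \<Longrightarrow>
    fourier_vec (\<lambda>t. torus_char n t * F t) = right_regular n (fourier_vec F)"
  by (rule ell2_eqI) (simp add: fourier_coeff_char_mult periodic_cont_intros)

text \<open>A trigonometric polynomial is visibly bounded, and one of them is within distance
  1.\<close>

lemma periodic_cont_bounded:
  assumes F: "F \<in> periodic_cont"
  shows "\<exists>B. 0 < B \<and> (\<forall>t. cmod (F t) \<le> B)"
proof -
  obtain p where p: "p \<in> trig" "\<And>t. cmod (F t - p t) < 1" using trig_dense[OF F, of 1] by auto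
  have "\<exists>B. \<forall>t. cmod (p t) \<le> B" using p(1)
  proof (induction rule: trig.induct)
    case (trig_char c m)
    then show ?case by (intro exI[of _ "cmod c"]) (simp add: norm_mult)
  next
    case (trig_add p q)
    then obtain B C where "\<And>t. cmod (p t) \<le> B" "\<And>t. cmod (q t) \<le> C" by blast
    then show ?case by (intro exI[of _ "B + C"]) (auto intro!: norm_triangle_le add_mono)
  qed
  then obtain B where B: "\<And>t. cmod (p t) \<le> B" by blast
  have "cmod (F t) \<le> B + 1" for t
    using norm_triangle_sub[of "F t" "p t"] B[of t] p(2)[of t] by linarith
  moreover have "0 \<le> B" using B[of 0] norm_ge_zero order_trans by blast
  ultimately show ?thesis by (intro exI[of _ "B + 1"]) auto
qed

text \<open>Linear in \<open>G\<close> and immediate on characters, hence true for trigonometric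
  polynomials. Both sides depend on \<open>G\<close> continuously in the supremum norm, with
  constant a bound \<open>B\<close> of \<open>F\<close>; each side then contributes an error of
  e/2.\<close>

theorem parseval:
  assumes F: "F \<in> periodic_cont" and G: "G \<in> periodic_cont"
  shows "cinner (fourier_vec F) (fourier_vec G) = mean (\<lambda>t. cnj (F t) * G t)"
proof -
  have trig: "cinner (fourier_vec F) (fourier_vec p) = mean (\<lambda>t. cnj (F t) * p t)" if "p \<in> trig" for p
    using that
  proof (induction rule: trig.induct)
    case (trig_char c m)
    have "cinner (fourier_vec F) (fourier_vec (\<lambda>t. c * torus_char m t))
        = c * cnj (fourier_coeff F (- m))"
      using F by (simp add: fourier_vec_scale periodic_cont_intros fourier_vec_torus_char
          cinner_scaleC_right cinner_delta_right)
    also have "\<dots> = c * mean (\<lambda>t. torus_char m t * cnj (F t))"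
      by (simp add: fourier_coeff_def mean_cnj[symmetric] cnj_torus_char)
    also have "\<dots> = mean (\<lambda>t. cnj (F t) * (c * torus_char m t))"
      by (subst mean_cmult[symmetric]) (simp add: mult_ac)
    finally show ?case .
  next
    case (trig_add p q)
    then show ?case
      using F trig_periodic_cont[OF trig_add(1)] trig_periodic_cont[OF trig_add(2)]
      by (simp add: fourier_vec_add cinner_add_right distrib_left mean_add periodic_cont_intros)
  qed
  obtain B where B: "0 < B" "\<And>t. cmod (F t) \<le> B" using periodic_cont_bounded[OF F] by blast
  have "cmod (cinner (fourier_vec F) (fourier_vec G) - mean (\<lambda>t. cnj (F t) * G t)) \<le> e" if e: "e > 0" for e
  proof -
    have e': "e / (2 * B) > 0" using e B by simp
    obtain p where p: "p \<in> trig" "\<And>t. cmod (G t - p t) < e / (2 * B)" using trig_dense[OF G e'] by blast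
    have pp: "p \<in> periodic_cont" by (rule trig_periodic_cont[OF p(1)])
    have 1: "cmod (cinner (fourier_vec F) (fourier_vec (\<lambda>t. G t - p t))) \<le> B * (e / (2 * B))"
      using B p e' by (intro order_trans[OF cmod_cinner_le] mult_mono norm_fourier_vec_le F
          periodic_cont_intros G pp) (auto simp: less_imp_le)
    have 2: "cmod (mean (\<lambda>t. cnj (F t) * (G t - p t))) \<le> B * (e / (2 * B))"
    proof (rule norm_mean_le)
      show "cmod (cnj (F t) * (G t - p t)) \<le> B * (e / (2 * B))" for t
        unfolding norm_mult complex_mod_cnj using B p(2)[of t] by (intro mult_mono) auto
    qed (intro periodic_cont_intros F G pp)
    have 3: "cinner (fourier_vec F) (fourier_vec (\<lambda>t. G t - p t))
        = cinner (fourier_vec F) (fourier_vec G) - mean (\<lambda>t. cnj (F t) * p t)"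
      by (simp add: fourier_vec_diff[OF G pp] cinner_diff_right trig[OF p(1)])
    have 4: "mean (\<lambda>t. cnj (F t) * (G t - p t)) = mean (\<lambda>t. cnj (F t) * G t) - mean (\<lambda>t. cnj (F t) * p t)"
      using F G pp by (simp add: right_diff_distrib mean_diff periodic_cont_intros)
    have "cinner (fourier_vec F) (fourier_vec G) - mean (\<lambda>t. cnj (F t) * G t)
        = cinner (fourier_vec F) (fourier_vec (\<lambda>t. G t - p t)) - mean (\<lambda>t. cnj (F t) * (G t - p t))"
      by (simp add: 3 4)
    also have "cmod \<dots> \<le> B * (e / (2 * B)) + B * (e / (2 * B))"
      using 1 2 norm_triangle_ineq4 by (smt (verit))
    also have "\<dots> = e" using B by simp
    finally show ?thesis .
  qed
  then have "cmod (cinner (fourier_vec F) (fourier_vec G) - mean (\<lambda>t. cnj (F t) * G t)) \<le> 0"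
    by (rule field_le_epsilon[of _ 0, simplified]) auto
  then show ?thesis by simp
qed

lemma norm_fourier_vec: assumes F: "F \<in> periodic_cont" shows "(norm (fourier_vec F))\<^sup>2 = mean_square F"
proof -
  have "cinner (fourier_vec F) (fourier_vec F) = complex_of_real (mean_square F)"
    using parseval[OF F F] mean_square_eq[OF F] by (simp add: mult.commute)
  then show ?thesis by (simp add: norm_eq_cinner)
qed

lemma delta_eq_fourier_vec: "delta l = fourier_vec (torus_char (- l))"
  by (simp add: fourier_vec_torus_char)

section \<open>Smooth functions\<close>

text \<open>Needed for the product rule, which leaves one factor undifferentiated and so uses it at
  the lower order.\<close>

lemma Ck_mono: "Ck (Suc n) f \<Longrightarrow> Ck n f"
proof (induction n arbitrary: f)
  case 0
  then show ?case by (auto simp: continuous_on_eq_continuous_at differentiable_imp_continuous_within)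
next
  case (Suc n)
  from Suc.prems have d: "\<forall>x. f differentiable (at x)"
    and c: "\<And>v. Ck (Suc n) (\<lambda>x. frechet_derivative f (at x) v)" by auto
  show ?case using d Suc.IH[OF c] by simp
qed

lemma Ck_SucI:
  assumes "\<And>x. (f has_derivative f' x) (at x)" "\<And>v. Ck n (\<lambda>x. f' x v)"
  shows "Ck (Suc n) f"
proof -
  have "frechet_derivative f (at x) = f' x" for x
    using frechet_derivative_at[OF assms(1)] by simp
  then show ?thesis using assms by (auto simp: differentiable_def)
qed

lemma Ck_SucE:
  assumes "Ck (Suc n) f"
  shows "(f has_derivative frechet_derivative f (at x)) (at x)" "Ck n (\<lambda>x. frechet_derivative f (at x) v)"
  using assms by (auto simp: frechet_derivative_works)

lemma Ck_const: "Ck n (\<lambda>x. c)"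
proof (induction n arbitrary: c)
  case (Suc n)
  show ?case by (rule Ck_SucI[of _ "\<lambda>x v. 0"]) (auto intro: Suc)
qed auto

lemma Ck_add: "Ck n f \<Longrightarrow> Ck n g \<Longrightarrow> Ck n (\<lambda>x. f x + g x)"
proof (induction n arbitrary: f g)
  case (Suc n)
  show ?case
    by (rule Ck_SucI[of _ "\<lambda>x v. frechet_derivative f (at x) v + frechet_derivative g (at x) v"])
       (intro has_derivative_add Ck_SucE[OF Suc.prems(1)] Ck_SucE[OF Suc.prems(2)] Suc.IH)+
qed (auto intro: continuous_intros)

lemma Ck_linear: "bounded_linear L \<Longrightarrow> Ck n f \<Longrightarrow> Ck n (\<lambda>x. L (f x))"
proof (induction n arbitrary: f)
  case 0
  then show ?case by (auto intro: bounded_linear.continuous_on)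
next
  case (Suc n)
  show ?case
    by (rule Ck_SucI[of _ "\<lambda>x v. L (frechet_derivative f (at x) v)"])
       (intro bounded_linear.has_derivative[OF Suc.prems(1)] Ck_SucE[OF Suc.prems(2)] Suc.IH Suc.prems)+
qed

lemma Ck_mult:
  fixes f g :: "'a::real_normed_vector \<Rightarrow> 'b::real_normed_algebra"
  shows "Ck n f \<Longrightarrow> Ck n g \<Longrightarrow> Ck n (\<lambda>x. f x * g x)"
proof (induction n arbitrary: f g)
  case (Suc n)
  show ?case
    by (rule Ck_SucI[of _ "\<lambda>x v. f x * frechet_derivative g (at x) v + frechet_derivative f (at x) v * g x"])
       (intro has_derivative_mult Ck_SucE[OF Suc.prems(1)] Ck_SucE[OF Suc.prems(2)] Suc.IH Ck_add
          Ck_mono[OF Suc.prems(1)] Ck_mono[OF Suc.prems(2)])+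
qed (auto intro: continuous_intros)

lemma smooth_const: "smooth (\<lambda>x. c)" by (simp add: smooth_def Ck_const)

lemma smooth_add: "smooth f \<Longrightarrow> smooth g \<Longrightarrow> smooth (\<lambda>x. f x + g x)"
  by (simp add: smooth_def Ck_add)

lemma smooth_linear: "bounded_linear L \<Longrightarrow> smooth f \<Longrightarrow> smooth (\<lambda>x. L (f x))"
  by (simp add: smooth_def Ck_linear)

lemma smooth_mult:
  fixes f g :: "'a::real_normed_vector \<Rightarrow> 'b::real_normed_algebra"
  shows "smooth f \<Longrightarrow> smooth g \<Longrightarrow> smooth (\<lambda>x. f x * g x)"
  by (simp add: smooth_def Ck_mult)

lemma smooth_cmult: "smooth f \<Longrightarrow> smooth (\<lambda>x. c * f x :: 'b::real_normed_algebra)"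
  by (intro smooth_mult smooth_const)

lemma smooth_continuous: "smooth f \<Longrightarrow> continuous_on UNIV f"
  unfolding smooth_def by (metis Ck.simps(1))

lemma smooth_has_derivative: "smooth f \<Longrightarrow> (f has_derivative frechet_derivative f (at x)) (at x)"
  unfolding smooth_def using Ck_SucE(1) by blast

lemma smooth_derivative: "smooth f \<Longrightarrow> smooth (\<lambda>x. frechet_derivative f (at x) v)"
  unfolding smooth_def using Ck_SucE(2) by blast



text \<open>The constant varies in the induction because the derivative along \<open>v\<close> is
  the same character times a new constant.\<close>

lemma Ck_torus_char: "Ck n (\<lambda>t. c * torus_char m t)"
proof (induction n arbitrary: c)
  case 0
  then show ?case using periodic_contD[OF periodic_cont_intros(2)] by (auto intro!: continuous_intros)
next
  case (Suc n)
  define L where "L t = (\<Sum>i\<in>UNIV. of_int (m $ i) * t $ i)" for t :: "real ^ 'a"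
  have L: "bounded_linear L" unfolding L_def
    by (intro bounded_linear_sum bounded_linear_const_mult bounded_linear_vec_nth)
  have "((\<lambda>t. 2 * pi * L t) has_derivative (\<lambda>v. 2 * pi * L v)) (at t)" for t
    by (intro has_derivative_mult_right bounded_linear.has_derivative[OF L] has_derivative_ident)
  from has_derivative_cis[OF this]
  have d: "(torus_char m has_derivative (\<lambda>v. (2 * pi * L v) *\<^sub>R (\<i> * torus_char m t))) (at t)" for t
    by (simp add: torus_char_def[abs_def] L_def)
  show ?case
  proof (rule Ck_SucI)
    show "((\<lambda>t. c * torus_char m t) has_derivative (\<lambda>v. c * ((2 * pi * L v) *\<^sub>R (\<i> * torus_char m t)))) (at t)" for t
      by (intro has_derivative_mult_right d)
    have "(\<lambda>t. c * ((2 * pi * L v) *\<^sub>R (\<i> * torus_char m t)))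
        = (\<lambda>t. (c * complex_of_real (2 * pi * L v) * \<i>) * torus_char m t)" for v
      by (auto simp: scaleR_conv_of_real)
    then show "Ck n (\<lambda>t. c * ((2 * pi * L v) *\<^sub>R (\<i> * torus_char m t)))" for v
      using Suc.IH by simp
  qed
qed

lemma trig_smooth: "p \<in> trig \<Longrightarrow> smooth p"
  by (induction rule: trig.induct) (auto simp: smooth_def Ck_torus_char Ck_add)

section \<open>Decay of the Fourier coefficients of smooth functions\<close>

lemma periodic_cont_derivative:
  fixes F :: "real ^ 'k \<Rightarrow> complex"
  assumes F: "F \<in> periodic_cont" and s: "smooth F"
  shows "(\<lambda>t. frechet_derivative F (at t) v) \<in> periodic_cont"
  unfolding periodic_cont_def
proof (intro CollectI conjI allI)
  show "continuous_on UNIV (\<lambda>t. frechet_derivative F (at t) v)"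
    by (intro smooth_continuous smooth_derivative s)
  fix t :: "real ^ 'k" and m :: "int ^ 'k"
  define c :: "real ^ 'k" where "c = (\<chi> i. of_int (m $ i))"
  have "((\<lambda>t. t + c) has_derivative (\<lambda>h. h)) (at t)" by (auto intro!: derivative_eq_intros)
  then have "((\<lambda>t. F (t + c)) has_derivative frechet_derivative F (at (t + c))) (at t)"
    using has_derivative_compose[of "\<lambda>t. t + c" "\<lambda>h. h" t UNIV F] smooth_has_derivative[OF s, of "t + c"]
    by simp
  moreover have "(\<lambda>t. F (t + c)) = F" using periodic_cont_int[OF F] by (auto simp: c_def)
  ultimately have "frechet_derivative F (at t) = frechet_derivative F (at (t + c))"
    using frechet_derivative_at by metis
  then show "frechet_derivative F (at (t + (\<chi> i. of_int (m $ i)))) v = frechet_derivative F (at t) v"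
    by (simp add: c_def)
qed

lemma fourier_coeff_shift:
  fixes F :: "real ^ 'k \<Rightarrow> complex"
  assumes F: "F \<in> periodic_cont" and h: "0 \<le> h" "h \<le> 1"
  shows "fourier_coeff (\<lambda>t. F (t + axis i h)) m = cis (- (2 * pi * of_int (m $ i) * h)) * fourier_coeff F m"
proof -
  let ?c = "cis (2 * pi * of_int (m $ i) * h)"
  have "fourier_coeff F m = mean (\<lambda>t. torus_char m (t + axis i h) * F (t + axis i h))"
    unfolding fourier_coeff_def
    using mean_shift_axis[of "\<lambda>t. torus_char m t * F t", OF _ h, of i] F by (simp add: periodic_cont_intros)
  also have "(\<lambda>t. torus_char m (t + axis i h) * F (t + axis i h))
      = (\<lambda>t. ?c * (torus_char m t * F (t + axis i h)))"
    by (auto simp: torus_char_add torus_char_axis)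
  also have "mean \<dots> = ?c * fourier_coeff (\<lambda>t. F (t + axis i h)) m"
    by (simp only: mean_cmult fourier_coeff_def)
  finally have "cis (- (2 * pi * of_int (m $ i) * h)) * fourier_coeff F m
      = (cis (- (2 * pi * of_int (m $ i) * h)) * ?c) * fourier_coeff (\<lambda>t. F (t + axis i h)) m"
    by (simp only: mult.assoc)
  also have "cis (- (2 * pi * of_int (m $ i) * h)) * ?c = 1" by (simp add: cis_mult)
  finally show ?thesis by simp
qed

text \<open>The difference quotients along a coordinate axis converge uniformly to the derivative,
  and they multiply the Fourier coefficients by a scalar.\<close>

lemma fourier_coeff_derivative:
  fixes F :: "real ^ 'k \<Rightarrow> complex"
  assumes F: "F \<in> periodic_cont" and s: "smooth F"
  shows "fourier_coeff (\<lambda>t. frechet_derivative F (at t) (axis i 1)) m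
    = - (2 * pi * \<i> * of_int (m $ i)) * fourier_coeff F m"
proof -
  define D where "D t = frechet_derivative F (at t) (axis i 1)" for t
  have D: "D \<in> periodic_cont" unfolding D_def[abs_def] by (rule periodic_cont_derivative[OF F s])
  define h where "h n = 1 / real (Suc n)" for n
  have h: "0 < h n" "h n \<le> 1" for n by (auto simp: h_def divide_le_eq)
  define Q where "Q n t = (1 / h n) * (F (t + axis i (h n)) - F t)" for n t
  have shift: "(\<lambda>t. G (t + c)) \<in> periodic_cont" if G: "G \<in> periodic_cont" for G and c :: "real ^ 'k"
    unfolding periodic_cont_def
  proof (intro CollectI conjI allI)
    show "continuous_on UNIV (\<lambda>t. G (t + c))"
      by (rule continuous_on_compose2[OF periodic_contD[OF G, of UNIV]]) (auto intro!: continuous_intros)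
    show "G (t + (\<chi> i. of_int (n $ i)) + c) = G (t + c)" for t n
      using periodic_cont_int[OF G, of "t + c" n] by (simp add: add_ac)
  qed
  have Q: "Q n \<in> periodic_cont" for n
    unfolding Q_def[abs_def] by (intro periodic_cont_intros shift F)
  have "(\<lambda>n. fourier_coeff (Q n) m) \<longlonglongrightarrow> fourier_coeff D m"
  proof (rule LIMSEQ_I)
    fix e :: real assume e: "e > 0"
    \<comment> \<open>The doubled cube contains both a point of the unit cube and its shift along an
      axis by at most 1.\<close>
    have "uniformly_continuous_on (cbox 0 2) D"
      by (intro compact_uniformly_continuous periodic_contD[OF D] compact_cbox)
    then obtain d where d: "d > 0" "\<And>x y. x \<in> cbox 0 2 \<Longrightarrow> y \<in> cbox 0 2 \<Longrightarrow> dist y x < d \<Longrightarrow> dist (D y) (D x) < e / 2"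
      unfolding uniformly_continuous_on_def using e by (metis half_gt_zero)
    obtain N where N: "h N < d" using reals_Archimedean[OF d(1)] by (auto simp: h_def inverse_eq_divide)
    have "cmod (fourier_coeff (Q n) m - fourier_coeff D m) < e" if n: "n \<ge> N" for n
    proof -
      have hn: "h n < d" using N n by (simp add: h_def) (smt (verit) frac_le of_nat_mono of_nat_0_le_iff)
      have bd: "cmod (Q n t - D t) \<le> e / 2" if t: "t \<in> cbox 0 1" for t
      proof -
        \<comment> \<open>The linear term is subtracted so that the derivative becomes a difference
          of two nearby values of \<open>D\<close>, small by uniform continuity; the mean value
          inequality then controls the difference quotient uniformly in \<open>t\<close>.\<close>
        define \<phi> where "\<phi> r = F (t + r *\<^sub>R axis i 1) - r *\<^sub>R D t" for r :: real
        have near: "cmod (D (t + r *\<^sub>R axis i 1) - D t) \<le> e / 2" if r: "r \<in> {0..h n}" for r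
        proof -
          have "t + r *\<^sub>R axis i 1 \<in> cbox 0 2" "t \<in> cbox 0 2"
            using t r h(2)[of n] by (auto simp: mem_box_cart axis_def) (smt (verit))+
          moreover have "dist (t + r *\<^sub>R axis i 1) t < d"
            using r hn by (simp add: dist_norm)
          ultimately show ?thesis using d(2) by (simp add: dist_norm less_imp_le)
        qed
        have der: "(\<phi> has_derivative (\<lambda>v. v *\<^sub>R (D (t + r *\<^sub>R axis i 1) - D t))) (at r within A)" for r A
        proof -
          have "((\<lambda>r. t + r *\<^sub>R axis i 1) has_derivative (\<lambda>v. v *\<^sub>R axis i 1)) (at r within A)"
            by (auto intro!: derivative_eq_intros)
          from has_derivative_compose[OF this smooth_has_derivative[OF s]]
          have "((\<lambda>r. F (t + r *\<^sub>R axis i 1)) has_derivative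
              (\<lambda>v. v *\<^sub>R D (t + r *\<^sub>R axis i 1))) (at r within A)"
            using linear_scale[OF has_derivative_linear[OF smooth_has_derivative[OF s]]]
            by (simp add: D_def)
          then show ?thesis unfolding \<phi>_def
            by (auto intro!: derivative_eq_intros simp: scaleR_diff_right)
        qed
        have "norm (\<phi> (h n) - \<phi> 0) \<le> e / 2 * norm (h n - 0)"
        proof (rule differentiable_bound[of "{0..h n}" \<phi>, OF _ der])
          fix r assume "r \<in> {0..h n}"
          then show "onorm (\<lambda>v. v *\<^sub>R (D (t + r *\<^sub>R axis i 1) - D t)) \<le> e / 2"
          proof (intro onorm_le)
            fix v
            show "norm (v *\<^sub>R (D (t + r *\<^sub>R axis i 1) - D t)) \<le> e / 2 * norm v"
              using mult_left_mono[OF near[OF \<open>r \<in> {0..h n}\<close>], of "\<bar>v\<bar>"] by (simp add: mult_ac)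
          qed
        qed (use h[of n] in auto)
        also have "\<phi> (h n) - \<phi> 0 = h n *\<^sub>R (Q n t - D t)"
        proof -
          have "h n *\<^sub>R axis i (1::real) = axis i (h n)" by (auto simp: axis_def vec_eq_iff)
          then show ?thesis
            using h(1)[of n] by (simp add: \<phi>_def Q_def scaleR_conv_of_real algebra_simps)
        qed
        finally have "h n * cmod (Q n t - D t) \<le> h n * (e / 2)"
          using h(1)[of n] by (simp add: mult.commute)
        then show ?thesis using h(1)[of n] by (simp add: mult_le_cancel_left)
      qed
      have "cmod (fourier_coeff (Q n) m - fourier_coeff D m) \<le> e / 2"
        unfolding fourier_coeff_diff[OF Q D, symmetric]
        by (rule norm_fourier_coeff_le) (use Q D bd in auto)
      then show ?thesis using e by simp
    qed
    then show "\<exists>N. \<forall>n\<ge>N. norm (fourier_coeff (Q n) m - fourier_coeff D m) < e" by blast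
  qed
  moreover have "(\<lambda>n. fourier_coeff (Q n) m) \<longlonglongrightarrow> - (2 * pi * \<i> * of_int (m $ i)) * fourier_coeff F m"
  proof -
    define a where "a = 2 * pi * real_of_int (m $ i)"
    \<comment> \<open>The scalar acting on the coefficient is the difference quotient of this
      exponential at 0, sampled at the steps \<open>h n\<close>.\<close>
    have "((\<lambda>z. exp (- (\<i> * complex_of_real a) * z)) has_field_derivative - (\<i> * complex_of_real a)) (at 0)"
      by (auto intro!: derivative_eq_intros)
    then have "((\<lambda>z. (exp (- (\<i> * complex_of_real a) * z) - 1) / z) \<longlongrightarrow> - (\<i> * complex_of_real a)) (at 0)"
      by (simp add: DERIV_def)
    moreover have "filterlim (\<lambda>n. complex_of_real (h n)) (at 0) sequentially"
    proof -
      have "h \<longlonglongrightarrow> 0" unfolding h_def[abs_def] by (rule LIMSEQ_Suc[OF lim_1_over_n])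
      then have "(\<lambda>n. complex_of_real (h n)) \<longlonglongrightarrow> 0" using tendsto_of_real by fastforce
      then show ?thesis unfolding filterlim_at using h(1) by (auto simp: less_imp_neq[symmetric])
    qed
    ultimately have "(\<lambda>n. (exp (- (\<i> * complex_of_real a) * complex_of_real (h n)) - 1) / complex_of_real (h n))
        \<longlonglongrightarrow> - (\<i> * complex_of_real a)"
      by (rule filterlim_compose)
    moreover have "exp (- (\<i> * complex_of_real a) * complex_of_real (h n)) = cis (- (a * h n))" for n
      by (simp add: cis_conv_exp mult.assoc)
    ultimately have "(\<lambda>n. (cis (- (a * h n)) - 1) / complex_of_real (h n) * fourier_coeff F m)
        \<longlonglongrightarrow> - (\<i> * complex_of_real a) * fourier_coeff F m"
      by (intro tendsto_mult tendsto_const) simp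
    moreover have "fourier_coeff (Q n) m = (cis (- (a * h n)) - 1) / complex_of_real (h n) * fourier_coeff F m" for n
    proof -
      have "fourier_coeff (Q n) m
          = complex_of_real (1 / h n) * (fourier_coeff (\<lambda>t. F (t + axis i (h n))) m - fourier_coeff F m)"
        unfolding Q_def[abs_def] by (simp only: fourier_coeff_scale fourier_coeff_diff[OF shift[OF F] F])
      also have "fourier_coeff (\<lambda>t. F (t + axis i (h n))) m = cis (- (a * h n)) * fourier_coeff F m"
        using fourier_coeff_shift[OF F less_imp_le[OF h(1)] h(2)] by (simp add: a_def)
      finally show ?thesis by (simp add: field_simps)
    qed
    moreover have "- (\<i> * complex_of_real a) = - (2 * pi * \<i> * of_int (m $ i))"
      by (simp add: a_def)
    ultimately show ?thesis by simp
  qed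
  ultimately show ?thesis unfolding D_def[abs_def] by (rule LIMSEQ_unique)
qed

text \<open>The operator 1 - D_i^2 / (4 pi^2) multiplies the coefficient at \<open>m\<close> by 1 +
  m_i^2; it is applied once for each coordinate in \<open>A\<close>. The constant \<open>c\<close>
  cancels the squared factor 2 pi from differentiating twice.\<close>

lemma fourier_coeff_smooth_factor:
  fixes F :: "real ^ 'k \<Rightarrow> complex"
  assumes F: "F \<in> periodic_cont" "smooth F" and A: "finite A"
  shows "\<exists>G\<in>periodic_cont. smooth G \<and>
    (\<forall>m. fourier_coeff G m = (\<Prod>i\<in>A. 1 + (of_int (m $ i))\<^sup>2) * fourier_coeff F m)"
  using A
proof (induction A rule: finite_induct)
  case empty
  then show ?case using F by auto
next
  case (insert i A)
  then obtain G where G: "G \<in> periodic_cont" "smooth G"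
    "\<And>m. fourier_coeff G m = (\<Prod>i\<in>A. 1 + (of_int (m $ i))\<^sup>2) * fourier_coeff F m" by blast
  define D where "D F t = frechet_derivative F (at t) (axis i 1)" for F :: "real ^ 'k \<Rightarrow> complex" and t
  have D: "D F \<in> periodic_cont" "smooth (D F)"
      "fourier_coeff (D F) m = - (2 * pi * \<i> * of_int (m $ i)) * fourier_coeff F m"
    if "F \<in> periodic_cont" "smooth F" for F m
    using that unfolding D_def[abs_def]
    by (auto intro: periodic_cont_derivative smooth_derivative simp: fourier_coeff_derivative)
  define c :: complex where "c = - 1 / (2 * complex_of_real pi)\<^sup>2"
  define H where "H t = G t + c * D (D G) t" for t
  have DD: "D (D G) \<in> periodic_cont" "smooth (D (D G))" using D G by auto
  have "H \<in> periodic_cont" "smooth H"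
    unfolding H_def[abs_def] by (intro periodic_cont_intros smooth_add smooth_cmult G DD)+
  moreover have "fourier_coeff H m = (\<Prod>i\<in>insert i A. 1 + (of_int (m $ i))\<^sup>2) * fourier_coeff F m" for m
  proof -
    have cD: "(\<lambda>t. c * D (D G) t) \<in> periodic_cont" by (intro periodic_cont_intros DD)
    have "fourier_coeff H m = fourier_coeff G m + c * (- (2 * pi * \<i> * of_int (m $ i)))\<^sup>2 * fourier_coeff G m"
      unfolding H_def[abs_def] fourier_coeff_add[OF G(1) cD] fourier_coeff_scale
      using D(3)[of "D G"] D(3)[of G] D G by (simp add: power2_eq_square mult_ac)
    also have "c * (- (2 * pi * \<i> * of_int (m $ i)))\<^sup>2 = (of_int (m $ i))\<^sup>2"
      by (simp add: c_def power_mult_distrib)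
    finally show ?thesis using insert G(3)[of m] by (simp add: algebra_simps)
  qed
  ultimately show ?case by blast
qed

section \<open>Summability of the Fourier coefficients of smooth functions\<close>

lemma summable_int_inverse_square: "(\<lambda>n::int. 1 / (1 + (real_of_int n)\<^sup>2)) summable_on UNIV"
proof -
  let ?f = "\<lambda>n::int. 1 / (1 + (real_of_int n)\<^sup>2)"
  have "summable (\<lambda>n::nat. 1 / (1 + (real n)\<^sup>2))"
  proof (rule summable_comparison_test'[of _ 1])
    show "summable (\<lambda>n. inverse (real n ^ 2))" by (rule inverse_power_summable) auto
    show "norm (1 / (1 + (real n)\<^sup>2)) \<le> inverse (real n ^ 2)" if "n \<ge> 1" for n
      using that by (simp add: inverse_eq_divide frac_le)
  qed
  then have s: "(\<lambda>n::nat. 1 / (1 + (real n)\<^sup>2)) summable_on UNIV"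
    by (rule summable_nonneg_imp_summable_on) auto
  have "?f summable_on range int"
    using s by (subst summable_on_reindex) (auto simp: o_def)
  moreover have "?f summable_on range (\<lambda>n. - int n)"
    using s by (subst summable_on_reindex) (auto simp: o_def inj_on_def)
  ultimately have "?f summable_on (range int \<union> range (\<lambda>n. - int n))"
    by (rule summable_on_union)
  moreover have "n \<in> range int \<union> range (\<lambda>n. - int n)" for n
    by (cases n rule: int_cases2) auto
  then have "range int \<union> range (\<lambda>n. - int n) = UNIV" by blast
  ultimately show ?thesis by simp
qed

text \<open>A finite set of lattice points lies in the product of its coordinate projections, where
  the sum factorises; each factor is at most the full one-dimensional sum.\<close>

lemma summable_prod_inverse_square:
  "(\<lambda>m :: int ^ 'k. \<Prod>i\<in>UNIV. 1 / (1 + (real_of_int (m $ i))\<^sup>2)) summable_on UNIV"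
proof (rule nonneg_bdd_above_summable_on)
  let ?f = "\<lambda>n::int. 1 / (1 + (real_of_int n)\<^sup>2)"
  have f0: "?f n \<ge> 0" for n by simp
  define S where "S = (\<Sum>\<^sub>\<infinity>n. ?f n)"
  have "(\<Sum>m\<in>A. \<Prod>i\<in>UNIV. ?f (m $ i)) \<le> (\<Prod>i\<in>(UNIV :: 'k set). S)" if A: "finite A" for A :: "(int ^ 'k) set"
  proof -
    define B where "B i = (\<lambda>m. m $ i) ` A" for i :: 'k
    have B: "finite (B i)" for i using A by (simp add: B_def)
    have "(\<Sum>m\<in>A. \<Prod>i\<in>UNIV. ?f (m $ i)) = (\<Sum>g\<in>vec_nth ` A. \<Prod>i\<in>UNIV. ?f (g i))"
      by (subst sum.reindex) (auto simp: inj_on_def vec_nth_inject)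
    also have "\<dots> \<le> (\<Sum>g\<in>PiE UNIV B. \<Prod>i\<in>UNIV. ?f (g i))"
      by (intro sum_mono2 finite_PiE B prod_nonneg f0 ballI) (auto simp: B_def)
    also have "\<dots> = (\<Prod>i\<in>UNIV. \<Sum>n\<in>B i. ?f n)"
      by (rule prod_sum_PiE[symmetric]) (auto simp: B)
    also have "\<dots> \<le> (\<Prod>i\<in>(UNIV :: 'k set). S)"
      unfolding S_def using B
      by (intro prod_mono conjI sum_nonneg f0 finite_sum_le_infsum summable_int_inverse_square) auto
    finally show ?thesis .
  qed
  then show "bdd_above (sum (\<lambda>m :: int ^ 'k. \<Prod>i\<in>UNIV. ?f (m $ i)) ` {F. F \<subseteq> UNIV \<and> finite F})"
    by (auto simp: bdd_above_def)
qed (auto intro: prod_nonneg)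

text \<open>The function \<open>G\<close> with coefficients enlarged by the product of all 1 + m_i^2
  is still bounded, hence so are its coefficients; dividing back leaves a summable majorant.\<close>

lemma l1_fourier_vec:
  fixes F :: "real ^ 'k \<Rightarrow> complex"
  assumes F: "F \<in> periodic_cont" "smooth F"
  shows "l1_vector (fourier_vec F)"
proof -
  obtain G where G: "G \<in> periodic_cont"
    "\<And>m. fourier_coeff G m = (\<Prod>i\<in>UNIV. 1 + (of_int (m $ i))\<^sup>2) * fourier_coeff F m"
    using fourier_coeff_smooth_factor[OF F, of UNIV] by auto
  obtain B where B: "\<And>t. cmod (G t) \<le> B" using periodic_cont_bounded[OF G(1)] by blast
  have "cmod (fourier_coeff F m) \<le> B * (\<Prod>i\<in>UNIV. 1 / (1 + (real_of_int (m $ i))\<^sup>2))" for m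
  proof -
    define P where "P = (\<Prod>i\<in>UNIV. 1 + (real_of_int (m $ i))\<^sup>2)"
    have P: "P > 0" unfolding P_def by (intro prod_pos) (auto simp: add_pos_nonneg)
    have "(\<Prod>i\<in>UNIV. 1 + (of_int (m $ i))\<^sup>2) = complex_of_real P" by (simp add: P_def)
    then have "P * cmod (fourier_coeff F m) = cmod (fourier_coeff G m)"
      using P by (simp add: G(2) norm_mult)
    also have "\<dots> \<le> B" by (rule norm_fourier_coeff_le[OF G(1)]) (rule B)
    finally have "cmod (fourier_coeff F m) \<le> B * (1 / P)" using P by (simp add: field_simps)
    then show ?thesis by (simp add: P_def prod_dividef)
  qed
  then show ?thesis
    using F by (intro summable_on_comparison_test[OF summable_on_cmult_right[OF summable_prod_inverse_square]]) auto
qed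

section \<open>Smooth cut-off functions\<close>

text \<open>The negative powers of \<open>x\<close> are built in to make the family closed under
  differentiation up to linear combinations; smoothness of all its members then follows by one
  induction with \<open>k\<close> arbitrary.\<close>

definition flat_exp :: "nat \<Rightarrow> real \<Rightarrow> real" where
  "flat_exp k x = (if x > 0 then exp (- 1 / x) / x ^ k else 0)"

text \<open>From the right, the substitution y = 1/x turns the quotient into y^k / exp y at
  infinity.\<close>

lemma flat_exp_quotient_tendsto: "(flat_exp k \<longlongrightarrow> 0) (at 0)"
proof -
  have "((\<lambda>y. y ^ k / exp y) \<longlongrightarrow> (0::real)) at_top" by (rule tendsto_power_div_exp_0)
  then have "((\<lambda>x. inverse x ^ k / exp (inverse x)) \<longlongrightarrow> (0::real)) (at_right 0)"
    by (rule filterlim_compose[OF _ filterlim_inverse_at_top_right])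
  then have "(flat_exp k \<longlongrightarrow> 0) (at_right 0)"
    by (rule Lim_transform_eventually)
       (auto simp: eventually_at_filter flat_exp_def exp_minus field_simps inverse_eq_divide power_one_over)
  moreover have "(flat_exp k \<longlongrightarrow> 0) (at_left 0)"
    by (rule Lim_transform_eventually[OF tendsto_const]) (auto simp: eventually_at_filter flat_exp_def)
  ultimately show ?thesis by (simp add: filterlim_split_at)
qed

lemma flat_exp_derivative:
  "(flat_exp k has_real_derivative flat_exp (k + 2) x - real k * flat_exp (k + 1) x) (at x)"
proof -
  consider "x > 0" | "x < 0" | "x = 0" by linarith
  then show ?thesis
  proof cases
    case 1
    have "((\<lambda>x. exp (- 1 / x) / x ^ k) has_real_derivative
        (exp (- 1 / x) * (1 / x\<^sup>2) * x ^ k - exp (- 1 / x) * (real k * x ^ (k - 1))) / (x ^ k * x ^ k)) (at x)"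
      using 1 by (auto intro!: derivative_eq_intros simp: power2_eq_square)
    also have "(exp (- 1 / x) * (1 / x\<^sup>2) * x ^ k - exp (- 1 / x) * (real k * x ^ (k - 1))) / (x ^ k * x ^ k)
        = flat_exp (k + 2) x - real k * flat_exp (k + 1) x"
      using 1 by (cases k) (simp_all add: flat_exp_def field_simps power2_eq_square)
    finally show ?thesis
      by (rule has_field_derivative_transform_within_open[of _ _ _ "{0<..}"])
         (use 1 in \<open>auto simp: flat_exp_def\<close>)
  next
    case 2
    have "((\<lambda>x. 0) has_real_derivative 0) (at x)" by simp
    then have "(flat_exp k has_real_derivative 0) (at x)"
      by (rule has_field_derivative_transform_within_open[of _ _ _ "{..<0}"])
         (use 2 in \<open>auto simp: flat_exp_def\<close>)
    then show ?thesis using 2 by (simp add: flat_exp_def)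
  next
    case 3
    \<comment> \<open>At 0 the difference quotient of \<open>flat_exp k\<close> is
      \<open>flat_exp (k + 1)\<close>.\<close>
    have "((\<lambda>h. (flat_exp k (0 + h) - flat_exp k 0) / h) \<longlongrightarrow> 0) (at 0)"
      by (rule Lim_transform_eventually[OF flat_exp_quotient_tendsto[of "k + 1"]])
         (auto simp: eventually_at_filter flat_exp_def)
    then show ?thesis using 3 by (simp add: DERIV_def flat_exp_def)
  qed
qed

lemma Ck_flat_exp_comp:
  fixes p :: "'a::real_normed_vector \<Rightarrow> real"
  assumes p: "smooth p"
  shows "Ck n (\<lambda>x. flat_exp k (p x))"
proof (induction n arbitrary: k)
  case 0
  have "continuous_on UNIV (flat_exp k)"
    by (rule DERIV_continuous_on[OF flat_exp_derivative[THEN has_field_derivative_at_within]])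
  from continuous_on_compose2[OF this smooth_continuous[OF p]] show ?case by simp
next
  case (Suc n)
  show ?case
  proof (rule Ck_SucI)
    fix x
    show "((\<lambda>x. flat_exp k (p x)) has_derivative (\<lambda>v. frechet_derivative p (at x) v *
        (flat_exp (k + 2) (p x) + (- real k) * flat_exp (k + 1) (p x)))) (at x)"
      using has_derivative_compose[OF smooth_has_derivative[OF p]
          flat_exp_derivative[of k "p x", unfolded has_field_derivative_def]]
      by (simp add: mult.commute)
  next
    fix v
    show "Ck n (\<lambda>x. frechet_derivative p (at x) v *
        (flat_exp (k + 2) (p x) + (- real k) * flat_exp (k + 1) (p x)))"
      using smooth_derivative[OF p] by (intro Ck_mult Ck_add Ck_const Suc) (simp add: smooth_def)
  qed
qed

text \<open>Compose \<open>exp (- 1 / x)\<close>, extended by zero, with a large multiple of a trigonometric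
  polynomial that is close to a Urysohn function.\<close>

lemma smooth_cutoff:
  fixes S K :: "(complex ^ 'k) set"
  assumes S: "openin (top_of_set torus) S" and K: "compact K" "K \<subseteq> S" and e: "0 < e"
  shows "\<exists>\<phi>. (\<lambda>z. complex_of_real (\<phi> z)) \<in> Cc_smooth S \<and> (\<forall>z. 0 \<le> \<phi> z \<and> \<phi> z \<le> 1) \<and> (\<forall>z\<in>K. \<phi> z \<ge> 1 - e)"
proof -
  have St: "S \<subseteq> torus" using S openin_imp_subset by blast
  have cl: "closed (torus - S)"
    using S compact_imp_closed[OF compact_torus] closedin_closed_trans
    by (metis closedin_diff closedin_self closedin_subtopology_refl topspace_euclidean_subtopology)
  \<comment> \<open>The values -1 and 2 leave room for an error of 1/2: the approximating
    \<open>q\<close> is still negative on the torus outside \<open>S\<close> and at least 1 on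
    \<open>K\<close>.\<close>
  obtain u :: "complex ^ 'k \<Rightarrow> real" where u: "continuous_on UNIV u" "\<And>z. u z \<in> closed_segment (-1) 2"
    "\<And>z. z \<in> torus - S \<Longrightarrow> u z = -1" "\<And>z. z \<in> K \<Longrightarrow> u z = 2"
    using Urysohn[OF cl compact_imp_closed[OF K(1)], of "-1::real" 2] K(2) by blast
  have "(\<lambda>z. complex_of_real (u z)) \<circ> torus_exp \<in> periodic_cont"
    by (rule periodic_cont_comp) (auto intro!: continuous_intros continuous_on_subset[OF u(1)])
  then obtain p where p: "p \<in> trig" "\<And>t. cmod (complex_of_real (u (torus_exp t)) - p t) < 1/2"
    using trig_dense[of "(\<lambda>z. complex_of_real (u z)) \<circ> torus_exp" "1/2"] by auto
  have pp: "p \<in> periodic_cont" by (rule trig_periodic_cont[OF p(1)])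
  define q where "q z = Re (p (torus_log z))" for z
  have qe: "q (torus_exp t) = Re (p t)" for t by (simp add: q_def periodic_cont_torus_log[OF pp])
  have qu: "\<bar>u z - q z\<bar> < 1/2" if "z \<in> torus" for z
  proof -
    obtain t where t: "z = torus_exp t" using torus_exp_surj_UNIV[OF \<open>z \<in> torus\<close>] by blast
    have "\<bar>Re (complex_of_real (u (torus_exp t)) - p t)\<bar> < 1/2"
      using abs_Re_le_cmod p(2) order_le_less_trans by blast
    then show ?thesis by (simp add: t qe)
  qed
  have "continuous_on UNIV (q \<circ> torus_exp)"
    using periodic_contD[OF pp] by (auto simp: o_def qe intro!: continuous_intros)
  then have qc: "continuous_on torus q" by (rule continuous_on_torusI)
  \<comment> \<open>Where \<open>q\<close> is at least 1, the value exp (- 1 / (L q)) is at least 1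
    - 1 / L, hence at least 1 - e.\<close>
  define L where "L = max 1 (1 / e)"
  have L: "L > 0" "1 / L \<le> e" using e by (auto simp: L_def max_def field_simps)
  define \<phi> where "\<phi> z = (if z \<in> torus then flat_exp 0 (L * q z) else 0)" for z
  have fl: "0 \<le> flat_exp 0 x" "flat_exp 0 x \<le> 1" for x by (auto simp: flat_exp_def)
  have "(\<lambda>z. complex_of_real (\<phi> z)) \<in> Cc_smooth S"
    unfolding Cc_smooth_def
  proof (intro CollectI conjI exI[of _ "{z \<in> torus. 0 \<le> q z}"] allI impI)
    have "smooth (\<lambda>t. L * Re (p t))"
      by (intro smooth_cmult smooth_linear[OF bounded_linear_Re] trig_smooth p)
    then have "smooth (\<lambda>t. flat_exp 0 (L * Re (p t)))" unfolding smooth_def using Ck_flat_exp_comp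
      by (metis smooth_def)
    then have "smooth (\<lambda>t. complex_of_real (flat_exp 0 (L * Re (p t))))"
      by (intro smooth_linear[OF bounded_linear_of_real])
    then show "smooth ((\<lambda>z. complex_of_real (\<phi> z)) \<circ> torus_exp)" by (simp add: o_def \<phi>_def qe)
    have "closed {z \<in> torus. 0 \<le> q z}"
      by (intro continuous_on_closed_Collect_le continuous_on_const qc compact_imp_closed compact_torus)
    from compact_Int_closed[OF compact_torus this] show "compact {z \<in> torus. 0 \<le> q z}"
      by (rule back_subst[of compact]) auto
    show "{z \<in> torus. 0 \<le> q z} \<subseteq> S"
    proof safe
      fix z assume z: "z \<in> torus" "0 \<le> q z"
      show "z \<in> S"
      proof (rule ccontr)
        assume "z \<notin> S"
        then have "u z = -1" using u(3) z by blast
        then show False using qu[OF z(1)] z(2) by linarith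
      qed
    qed
    fix z assume "z \<notin> {z \<in> torus. 0 \<le> q z}"
    then show "complex_of_real (\<phi> z) = 0"
      using L by (auto simp: \<phi>_def flat_exp_def zero_less_mult_iff)
  qed
  moreover have "\<phi> z \<ge> 1 - e" if "z \<in> K" for z
  proof -
    have zt: "z \<in> torus" using that K St by blast
    have "q z \<ge> 1" using qu[OF zt] u(4)[OF that] by linarith
    then have "L * q z \<ge> L" using L by simp
    then have "1 / (L * q z) \<le> e" and pos: "L * q z > 0"
      using L by (smt (verit) frac_le)+
    have "1 - e \<le> 1 + (- 1 / (L * q z))" using \<open>1 / (L * q z) \<le> e\<close> by simp
    also have "\<dots> \<le> exp (- 1 / (L * q z))" by (rule exp_ge_add_one_self)
    finally show ?thesis using zt pos by (simp add: \<phi>_def flat_exp_def)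
  qed
  moreover have "0 \<le> \<phi> z \<and> \<phi> z \<le> 1" for z using fl by (simp add: \<phi>_def)
  ultimately show ?thesis by (intro exI[of _ \<phi>]) auto
qed

section \<open>The Fourier transform on \<open>\<R>\<^sub>S\<close>\<close>

lemma measurable_torus_exp: "torus_exp \<in> measurable (restrict_space lborel (cbox 0 1)) borel"
  by (intro measurable_restrict_space1) (simp add: borel_measurable_continuous_onI continuous_on_torus_exp)

text \<open>The bridge from Lebesgue integrals for Haar measure to integrals over the unit cube, in
  which \<open>mean_square\<close> is phrased.\<close>

lemma
  fixes g :: "complex ^ 'k \<Rightarrow> real"
  assumes g: "g \<in> borel_measurable borel" and c: "continuous_on UNIV (g \<circ> torus_exp)"
  shows integrable_haar_torus: "integrable haar_torus g"
    and integral_haar_torus: "integral\<^sup>L haar_torus g = integral (cbox 0 1) (\<lambda>t. g (torus_exp t))"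
proof -
  have "continuous_on (cbox 0 1) (\<lambda>t. g (torus_exp t))"
    using c continuous_on_subset by (fastforce simp: o_def)
  then have i: "set_integrable lborel (cbox 0 1) (\<lambda>t. g (torus_exp t))"
    unfolding set_integrable_def by (intro borel_integrable_compact compact_cbox)
  then show "integrable haar_torus g"
    unfolding haar_torus_def integrable_distr_eq[OF measurable_torus_exp g]
    by (subst integrable_restrict_space) (auto simp: set_integrable_def)
  have "integral\<^sup>L haar_torus g = (LINT t:cbox 0 1|lborel. g (torus_exp t))"
    unfolding haar_torus_def integral_distr[OF measurable_torus_exp g]
    by (subst integral_restrict_space) (auto simp: set_lebesgue_integral_def)
  then show "integral\<^sup>L haar_torus g = integral (cbox 0 1) (\<lambda>t. g (torus_exp t))"
    by (simp add: set_borel_integral_eq_integral(2)[OF i])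
qed

lemma character_torus_exp: "character m (torus_exp t) = torus_char m t"
proof -
  have "(\<Prod>i\<in>A. cis (f i)) = cis (\<Sum>i\<in>A. f i)" if "finite A" for A :: "'a set" and f
    using that by (induction A rule: finite_induct) (auto simp: cis_mult)
  then show ?thesis
    by (simp add: character_def torus_exp_def torus_char_def cis_power_int sum_distrib_left mult_ac)
qed

lemma character_measurable: "character m \<in> borel_measurable borel"
proof -
  have c: "(\<lambda>z :: complex ^ 'a. z $ i) \<in> borel_measurable borel" for i
    by (intro borel_measurable_continuous_onI continuous_intros)
  have "(\<lambda>z :: complex ^ 'a. (z $ i) powi n) \<in> borel_measurable borel" for i n
    using c[of i] by (cases "n \<ge> 0") (simp_all add: power_int_def)
  then show ?thesis unfolding character_def[abs_def] by (intro borel_measurable_prod)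
qed

lemma fourier_coeff_sum:
  assumes "\<And>i. i \<in> A \<Longrightarrow> F i \<in> periodic_cont"
  shows "fourier_coeff (\<lambda>t. \<Sum>i\<in>A. F i t) m = (\<Sum>i\<in>A. fourier_coeff (F i) m)"
  using assms
proof (induction A rule: infinite_finite_induct)
  case (insert x A)
  then show ?case by (simp add: fourier_coeff_add periodic_cont_sum)
qed (auto simp: fourier_coeff_def)

lemma fourier_vec_zero [simp]: "fourier_vec (\<lambda>t. 0) = 0"
  by (rule ell2_eqI) (simp add: periodic_cont_intros fourier_coeff_def)

text \<open>The L^2 error of a partial sum is \<open>mean_square (R A)\<close>. For the coefficient
  vector it is the tail of the squared norm, by Parseval. Conversely, Bessel's inequality for
  \<open>R A\<close> at one index \<open>m\<close> in \<open>A\<close> bounds the squared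
  discrepancy at \<open>m\<close> by a quantity tending to 0.\<close>

lemma is_fourier_transform_iff:
  fixes f :: "complex ^ 'k \<Rightarrow> complex"
  assumes F: "f \<circ> torus_exp \<in> periodic_cont" and f: "f \<in> borel_measurable borel"
  shows "is_fourier_transform \<xi> f \<longleftrightarrow> \<xi> = fourier_vec (f \<circ> torus_exp)"
proof -
  let ?F = "f \<circ> torus_exp"
  define R where "R A t = ?F t - (\<Sum>m\<in>A. coeff \<xi> m * cnj (torus_char m t))" for A t
  have R: "R A \<in> periodic_cont" for A
    unfolding R_def[abs_def] by (intro periodic_cont_intros periodic_cont_sum F)
  have int: "(\<integral>z. (cmod (f z - (\<Sum>m\<in>A. coeff \<xi> m * cnj (character m z))))\<^sup>2 \<partial>haar_torus)
      = mean_square (R A)" for A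
  proof -
    have "(\<lambda>z. (cmod (f z - (\<Sum>m\<in>A. coeff \<xi> m * cnj (character m z))))\<^sup>2) \<in> borel_measurable borel"
    proof -
      have "(\<lambda>z. cnj (character m z)) \<in> borel_measurable borel" for m :: "int ^ 'k"
        by (rule measurable_compose[OF character_measurable])
           (intro borel_measurable_continuous_onI continuous_intros)
      then show ?thesis using f by measurable
    qed
    moreover have "continuous_on UNIV ((\<lambda>z. (cmod (f z - (\<Sum>m\<in>A. coeff \<xi> m * cnj (character m z))))\<^sup>2) \<circ> torus_exp)"
    proof -
      have "continuous_on UNIV (\<lambda>t. (cmod (R A t))\<^sup>2)" by (intro continuous_intros periodic_contD R)
      then show ?thesis by (simp add: o_def R_def character_torus_exp)
    qed
    ultimately show ?thesis
      by (simp add: integral_haar_torus mean_square_def R_def character_torus_exp)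
  qed
  have sq: "integrable haar_torus (\<lambda>z. (cmod (f z))\<^sup>2)"
    using f periodic_contD[OF F] by (intro integrable_haar_torus) (auto simp: o_def intro!: continuous_intros)
  have meas: "f \<in> borel_measurable haar_torus" using f by (simp add: haar_torus_def)
  have eq: "is_fourier_transform \<xi> f \<longleftrightarrow> ((\<lambda>A. mean_square (R A)) \<longlongrightarrow> 0) (finite_subsets_at_top UNIV)"
    unfolding is_fourier_transform_def int using sq meas by simp
  show ?thesis
  proof
    assume \<xi>: "\<xi> = fourier_vec ?F"
    have "((\<lambda>A. (norm \<xi>)\<^sup>2 - (\<Sum>m\<in>A. (cmod (coeff \<xi> m))\<^sup>2)) \<longlongrightarrow> (norm \<xi>)\<^sup>2 - (norm \<xi>)\<^sup>2) (finite_subsets_at_top UNIV)"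
      unfolding norm_ell2_square by (intro tendsto_intros infsum_tendsto square_summable_coeff)
    then have "((\<lambda>A. (norm \<xi>)\<^sup>2 - (\<Sum>m\<in>A. (cmod (coeff \<xi> m))\<^sup>2)) \<longlongrightarrow> 0) (finite_subsets_at_top UNIV)"
      by (simp only: diff_self)
    then have "((\<lambda>A. mean_square (R A)) \<longlongrightarrow> 0) (finite_subsets_at_top UNIV)"
    proof (rule Lim_transform_eventually[OF _ eventually_finite_subsets_at_top_weakI])
      fix A :: "(int ^ 'k) set" assume A: "finite A"
      show "(norm \<xi>)\<^sup>2 - (\<Sum>m\<in>A. (cmod (coeff \<xi> m))\<^sup>2) = mean_square (R A)"
        using mean_square_partial_sum[OF F A] norm_fourier_vec[OF F] F
        by (simp add: \<xi> R_def[abs_def])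
    qed
    then show "is_fourier_transform \<xi> f" using eq by blast
  next
    assume "is_fourier_transform \<xi> f"
    then have lim: "((\<lambda>A. mean_square (R A)) \<longlongrightarrow> 0) (finite_subsets_at_top UNIV)" using eq by blast
    show "\<xi> = fourier_vec ?F"
    proof (rule ell2_eqI)
      fix m
      have "(cmod (fourier_coeff ?F m - coeff \<xi> m))\<^sup>2 \<le> mean_square (R A)" if A: "finite A" "{m} \<subseteq> A" for A
      proof -
        have ch: "(\<lambda>t. coeff \<xi> n * torus_char (- n) t) \<in> periodic_cont" for n by (intro periodic_cont_intros)
        have sm: "(\<lambda>t. \<Sum>n\<in>A. coeff \<xi> n * torus_char (- n) t) \<in> periodic_cont" by (intro periodic_cont_sum ch)
        have "fourier_coeff (R A) m = fourier_coeff ?F m - (\<Sum>n\<in>A. coeff \<xi> n * (if m = n then 1 else 0))"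
          unfolding R_def[abs_def] cnj_torus_char fourier_coeff_diff[OF F sm] fourier_coeff_sum[OF ch]
            fourier_coeff_scale by (simp add: fourier_coeff_torus_char)
        also have "(\<Sum>n\<in>A. coeff \<xi> n * (if m = n then 1 else 0)) = coeff \<xi> m"
          using A by (simp add: if_distrib cong: if_cong)
        finally show ?thesis using bessel[OF R[of A], of "{m}"] by (simp add: o_def)
      qed
      then have "(cmod (fourier_coeff ?F m - coeff \<xi> m))\<^sup>2 \<le> 0"
        by (intro tendsto_lowerbound[OF lim _ finite_subsets_at_top_neq_bot])
           (auto simp: eventually_finite_subsets_at_top intro!: exI[of _ "{m}"])
      then show "coeff \<xi> m = coeff (fourier_vec ?F) m" using F by simp
    qed
  qed
qed

text \<open>The extension by zero need not be continuous on the ambient space; it is Borel because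
  it is continuous on the closed torus and vanishes elsewhere.\<close>

lemma Cc_smoothD:
  assumes f: "f \<in> Cc_smooth S" and S: "S \<subseteq> torus"
  shows "smooth (f \<circ> torus_exp)" "continuous_on torus f" "f \<circ> torus_exp \<in> periodic_cont"
    "f \<in> borel_measurable borel" "z \<notin> S \<Longrightarrow> f z = 0"
proof -
  show s: "smooth (f \<circ> torus_exp)" using f by (simp add: Cc_smooth_def)
  show c: "continuous_on torus f"
    by (rule continuous_on_torusI) (rule smooth_continuous[OF s])
  show "f \<circ> torus_exp \<in> periodic_cont" by (rule periodic_cont_comp[OF c])
  show z: "f z = 0" if "z \<notin> S" for z using f that by (auto simp: Cc_smooth_def)
  have "(\<lambda>z. if z \<in> torus then f z else 0) \<in> borel_measurable borel"
    by (rule borel_measurable_continuous_on_if)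
       (auto intro: c borel_closed compact_imp_closed compact_torus)
  also have "(\<lambda>z. if z \<in> torus then f z else 0) = f" by (rule ext) (use z S in auto)
  finally show "f \<in> borel_measurable borel" .
qed

lemma RS_iff:
  assumes "S \<subseteq> torus"
  shows "\<xi> \<in> RS S \<longleftrightarrow> (\<exists>f\<in>Cc_smooth S. \<xi> = fourier_vec (f \<circ> torus_exp))"
  unfolding RS_def using is_fourier_transform_iff Cc_smoothD[OF _ assms] by blast

lemma Cc_smooth_zero: "(\<lambda>z. 0) \<in> Cc_smooth S"
  by (auto simp: Cc_smooth_def o_def smooth_const intro!: exI[of _ "{}"])

lemma Cc_smooth_add: assumes "f \<in> Cc_smooth S" "g \<in> Cc_smooth S"
  shows "(\<lambda>z. f z + g z) \<in> Cc_smooth S"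
proof -
  obtain K L where KL: "compact K" "K \<subseteq> S" "\<And>z. z \<notin> K \<Longrightarrow> f z = 0" "compact L" "L \<subseteq> S" "\<And>z. z \<notin> L \<Longrightarrow> g z = 0"
    using assms by (auto simp: Cc_smooth_def)
  have "f z + g z = 0" if "z \<notin> K \<union> L" for z using KL(3)[of z] KL(6)[of z] that by simp
  moreover have "smooth ((\<lambda>z. f z + g z) \<circ> torus_exp)"
    using assms smooth_add[of "f \<circ> torus_exp" "g \<circ> torus_exp"] by (simp add: Cc_smooth_def o_def)
  ultimately show ?thesis unfolding Cc_smooth_def using KL(1,2,4,5)
    by (intro CollectI conjI exI[of _ "K \<union> L"] allI impI compact_Un Un_least) blast+
qed

lemma Cc_smooth_mult: assumes "f \<in> Cc_smooth S" "smooth (g \<circ> torus_exp)"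
  shows "(\<lambda>z. f z * g z) \<in> Cc_smooth S"
proof -
  obtain K where "compact K" "K \<subseteq> S" "\<And>z. z \<notin> K \<Longrightarrow> f z = 0"
    using assms by (auto simp: Cc_smooth_def)
  moreover have "smooth ((\<lambda>z. f z * g z) \<circ> torus_exp)"
    using assms smooth_mult[of "f \<circ> torus_exp" "g \<circ> torus_exp"] by (simp add: Cc_smooth_def o_def)
  ultimately show ?thesis unfolding Cc_smooth_def by (auto intro!: exI[of _ K])
qed

lemma RS_l1: "S \<subseteq> torus \<Longrightarrow> \<xi> \<in> RS S \<Longrightarrow> l1_vector \<xi>"
  using RS_iff l1_fourier_vec Cc_smoothD by metis

lemma RS_relatively_L1:
  fixes S :: "(complex ^ 'k) set"
  assumes S: "S \<subseteq> torus"
  shows "relatively_L1 right_regular (RS S)"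
  unfolding relatively_L1_def
proof (intro conjI ballI ell2.subspaceI)
  have "fourier_vec ((\<lambda>z. 0) \<circ> torus_exp) = (0 :: (int ^ 'k) ell2)"
    by (simp add: o_def)
  then show "0 \<in> RS S" unfolding RS_iff[OF S] using Cc_smooth_zero by metis
  show "x + y \<in> RS S" if "x \<in> RS S" "y \<in> RS S" for x y
  proof -
    obtain f g where fg: "f \<in> Cc_smooth S" "g \<in> Cc_smooth S"
      "x = fourier_vec (f \<circ> torus_exp)" "y = fourier_vec (g \<circ> torus_exp)"
      using \<open>x \<in> RS S\<close> \<open>y \<in> RS S\<close> by (auto simp: RS_iff[OF S])
    then have "x + y = fourier_vec ((\<lambda>z. f z + g z) \<circ> torus_exp)"
      using fourier_vec_add[OF Cc_smoothD(3)[OF fg(1) S] Cc_smoothD(3)[OF fg(2) S]] by (simp add: o_def)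
    then show ?thesis using Cc_smooth_add[OF fg(1,2)] by (auto simp: RS_iff[OF S])
  qed
  show "scaleC c x \<in> RS S" if "x \<in> RS S" for c x
  proof -
    obtain f where f: "f \<in> Cc_smooth S" "x = fourier_vec (f \<circ> torus_exp)"
      using \<open>x \<in> RS S\<close> by (auto simp: RS_iff[OF S])
    have "scaleC c x = fourier_vec ((\<lambda>z. f z * c) \<circ> torus_exp)"
      using fourier_vec_scale[OF Cc_smoothD(3)[OF f(1) S], of c] f(2) by (simp add: o_def mult.commute)
    moreover have "(\<lambda>z. f z * c) \<in> Cc_smooth S"
      by (rule Cc_smooth_mult[OF f(1)]) (simp add: o_def smooth_const)
    ultimately show ?thesis by (auto simp: RS_iff[OF S])
  qed
next
  fix \<xi> \<eta> assume "\<xi> \<in> RS S" "\<eta> \<in> RS S"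
  then obtain f g where f: "f \<in> Cc_smooth S" "\<xi> = fourier_vec (f \<circ> torus_exp)"
    and g: "g \<in> Cc_smooth S" "\<eta> = fourier_vec (g \<circ> torus_exp)"
    by (auto simp: RS_iff[OF S])
  define F G where "F = f \<circ> torus_exp" and "G = g \<circ> torus_exp"
  note F = Cc_smoothD(1,3)[OF f(1) S, folded F_def] and G = Cc_smoothD(1,3)[OF g(1) S, folded G_def]
  \<comment> \<open>By Parseval, <xi, rho_t eta> is the coefficient at \<open>t\<close> of
    \<open>H\<close>, which is again smooth and hence has summable coefficients.\<close>
  define H where "H t = cnj (F t) * G t" for t
  have H: "H \<in> periodic_cont" "smooth H"
    unfolding H_def[abs_def]
    by (intro periodic_cont_intros smooth_mult smooth_linear[OF bounded_linear_cnj] F G)+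
  have "cinner \<xi> (right_regular t \<eta>) = coeff (fourier_vec H) t" for t
  proof -
    have "cinner \<xi> (right_regular t \<eta>) = cinner (fourier_vec F) (fourier_vec (\<lambda>s. torus_char t s * G s))"
      using fourier_vec_char_mult[OF G(2), of t] by (simp add: f(2) g(2) F_def G_def)
    also have "\<dots> = mean (\<lambda>s. cnj (F s) * (torus_char t s * G s))"
      by (intro parseval F periodic_cont_intros G)
    also have "\<dots> = coeff (fourier_vec H) t"
      using H by (simp add: fourier_coeff_def H_def mult_ac)
    finally show ?thesis .
  qed
  then show "(\<lambda>t. cmod (cinner \<xi> (right_regular t \<eta>))) summable_on UNIV"
    using l1_fourier_vec[OF H] by simp
qed

section \<open>Density of \<open>\<R>\<^sub>S\<close>\<close>

lemma trig_vec_dense: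
  fixes x :: "(int ^ 'k) ell2"
  assumes "e > 0"
  shows "\<exists>p\<in>trig. norm (x - fourier_vec p) \<le> e"
proof -
  obtain A where A: "finite A" "dist (\<Sum>m\<in>A. scaleC (coeff x m) (delta m)) x \<le> e"
    using has_sum_finite_approximation[OF has_sum_delta[of x] assms] by blast
  have "\<exists>p\<in>trig. (\<Sum>m\<in>A. scaleC (coeff x m) (delta m)) = fourier_vec p"
    using A(1)
  proof (induction A rule: finite_induct)
    case empty
    show ?case by (intro bexI[of _ "\<lambda>t. 0"] trig_const) simp
  next
    case (insert m A)
    then obtain p where p: "p \<in> trig" "(\<Sum>m\<in>A. scaleC (coeff x m) (delta m)) = fourier_vec p" by blast
    have "(\<lambda>t. coeff x m * torus_char (- m) t + p t) \<in> trig" by (intro trig.intros p)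
    moreover have "fourier_vec (\<lambda>t. coeff x m * torus_char (- m) t + p t)
        = scaleC (coeff x m) (delta m) + fourier_vec p"
      using trig_periodic_cont[OF p(1)]
      by (simp add: fourier_vec_add fourier_vec_scale periodic_cont_intros fourier_vec_torus_char)
    ultimately show ?case using insert.hyps p(2) by (intro bexI[of _ "\<lambda>t. coeff x m * torus_char (- m) t + p t"]) simp_all
  qed
  then show ?thesis using A(2) by (auto simp: dist_norm norm_minus_commute)
qed

text \<open>Trigonometric polynomials are dense, and a polynomial \<open>p\<close> is the limit of
  its products with cut-offs tending to 1 on \<open>S\<close>. The full Haar measure of
  \<open>S\<close> turns this into convergence almost everywhere, so dominated convergence applies
  to the squared distance.\<close>

lemma RS_dense:
  fixes S :: "(complex ^ 'k) set"
  assumes S: "openin (top_of_set torus) S" and null: "torus - S \<in> null_sets haar_torus"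
  shows "closure (RS S) = UNIV"
proof -
  have St: "S \<subseteq> torus" using S openin_imp_subset by blast
  obtain U where U: "open U" "S = torus \<inter> U" using S by (auto simp: openin_open)
  have "\<exists>C :: nat \<Rightarrow> (complex ^ 'k) set. (\<forall>n. compact (C n)) \<and> (\<forall>n. C n \<subseteq> U) \<and>
      (\<forall>K. compact K \<longrightarrow> K \<subseteq> U \<longrightarrow> (\<exists>N. \<forall>n\<ge>N. K \<subseteq> C n))"
  proof (rule open_Union_compact_subsets[OF U(1)])
    fix C :: "nat \<Rightarrow> (complex ^ 'k) set"
    assume "\<And>n. compact (C n)" "\<And>n. C n \<subseteq> U"
      "\<And>K. compact K \<Longrightarrow> K \<subseteq> U \<Longrightarrow> \<exists>N. \<forall>n\<ge>N. K \<subseteq> C n"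
    then show ?thesis by (intro exI[of _ C]) simp
  qed
  then obtain C :: "nat \<Rightarrow> (complex ^ 'k) set" where C: "\<And>n. compact (C n)" "\<And>n. C n \<subseteq> U"
    "\<And>K. compact K \<Longrightarrow> K \<subseteq> U \<Longrightarrow> \<exists>N. \<forall>n\<ge>N. K \<subseteq> C n" by blast
  \<comment> \<open>The lower bound improves with \<open>n\<close> while the compact sets exhaust
    \<open>U\<close>, which forces \<open>\<phi> n z\<close> to tend to 1 at each point of
    \<open>S\<close>.\<close>
  have "\<exists>\<phi>. (\<lambda>z. complex_of_real (\<phi> z)) \<in> Cc_smooth S \<and> (\<forall>z. 0 \<le> \<phi> z \<and> \<phi> z \<le> 1) \<and>
      (\<forall>z\<in>torus \<inter> C n. \<phi> z \<ge> 1 - 1 / real (Suc n))" for n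
    by (rule smooth_cutoff[OF S]) (use C U compact_torus in \<open>auto intro: compact_Int\<close>)
  then obtain \<phi> where \<phi>: "\<And>n. (\<lambda>z. complex_of_real (\<phi> n z)) \<in> Cc_smooth S"
    "\<And>n z. 0 \<le> \<phi> n z" "\<And>n z. \<phi> n z \<le> 1" "\<And>n z. z \<in> torus \<inter> C n \<Longrightarrow> \<phi> n z \<ge> 1 - 1 / real (Suc n)"
    by metis
  have lim: "(\<lambda>n. \<phi> n z) \<longlonglongrightarrow> 1" if "z \<in> S" for z
  proof -
    have "\<exists>N. \<forall>n\<ge>N. {z} \<subseteq> C n" using that U by (intro C(3)) auto
    then obtain N where N: "\<And>n. n \<ge> N \<Longrightarrow> z \<in> C n" by auto
    have "(\<lambda>n. 1 - 1 / real (Suc n)) \<longlonglongrightarrow> 1 - 0"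
      by (intro tendsto_diff tendsto_const LIMSEQ_Suc[OF lim_1_over_n])
    then have l: "(\<lambda>n. 1 - 1 / real (Suc n)) \<longlonglongrightarrow> 1" by simp
    show ?thesis
    proof (rule tendsto_sandwich[OF _ _ l tendsto_const])
      have "1 - 1 / real (Suc n) \<le> \<phi> n z" if "n \<ge> N" for n
        using N[OF that] \<open>z \<in> S\<close> St by (intro \<phi>(4)) auto
      then show "\<forall>\<^sub>F n in sequentially. 1 - 1 / real (Suc n) \<le> \<phi> n z"
        unfolding eventually_sequentially by blast
      show "\<forall>\<^sub>F n in sequentially. \<phi> n z \<le> 1" using \<phi>(3) by simp
    qed
  qed
  have AE: "AE z in haar_torus. z \<in> S"
  proof -
    have "AE z in haar_torus. z \<in> torus"
      unfolding haar_torus_def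
      by (subst AE_distr_iff[OF measurable_torus_exp])
         (auto intro!: borel_closed compact_imp_closed compact_torus)
    moreover have "AE z in haar_torus. z \<notin> torus - S" using null by (rule AE_not_in)
    ultimately show ?thesis by eventually_elim auto
  qed
  have "fourier_vec p \<in> closure (RS S)" if p: "p \<in> trig" for p
  proof -
    have pp: "p \<in> periodic_cont" by (rule trig_periodic_cont[OF p])
    obtain B where B: "B > 0" "\<And>t. cmod (p t) \<le> B" using periodic_cont_bounded[OF pp] by blast
    define \<Phi> where "\<Phi> n = (\<lambda>z. complex_of_real (\<phi> n z)) \<circ> torus_exp" for n
    have \<Phi>: "\<Phi> n \<in> periodic_cont" for n
      unfolding \<Phi>_def by (rule Cc_smoothD(3)[OF \<phi>(1) St])
    define x where "x n = fourier_vec (\<lambda>t. \<Phi> n t * p t)" for n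
    have "x n \<in> RS S" for n
    proof -
      have "(\<lambda>z. p (torus_log z)) \<circ> torus_exp = p" by (auto simp: periodic_cont_torus_log[OF pp])
      then have "(\<lambda>z. complex_of_real (\<phi> n z) * p (torus_log z)) \<in> Cc_smooth S"
        using trig_smooth[OF p] by (intro Cc_smooth_mult \<phi>) simp
      moreover have "x n = fourier_vec ((\<lambda>z. complex_of_real (\<phi> n z) * p (torus_log z)) \<circ> torus_exp)"
        by (simp add: x_def \<Phi>_def o_def periodic_cont_torus_log[OF pp])
      ultimately show ?thesis by (auto simp: RS_iff[OF St])
    qed
    have "(\<lambda>n. (norm (fourier_vec p - x n))\<^sup>2) \<longlonglongrightarrow> 0"
    proof (rule tendsto_sandwich[OF _ _ tendsto_const])
      \<comment> \<open>\<open>Re (\<Phi> n t)\<close> is \<open>\<phi> n (torus_exp t)\<close>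
        written so that its continuity in \<open>t\<close> is at hand.\<close>
      have int: "integral\<^sup>L haar_torus (\<lambda>z. B\<^sup>2 * (1 - \<phi> n z)\<^sup>2) = integral (cbox 0 1) (\<lambda>t. B\<^sup>2 * (1 - Re (\<Phi> n t))\<^sup>2)" for n
      proof -
        have "(\<lambda>z. Re (complex_of_real (\<phi> n z))) \<in> borel_measurable borel"
          by (rule measurable_compose[OF Cc_smoothD(4)[OF \<phi>(1) St, of n]])
             (intro borel_measurable_continuous_onI continuous_intros)
        then have "(\<lambda>z. B\<^sup>2 * (1 - \<phi> n z)\<^sup>2) \<in> borel_measurable borel" by simp
        moreover have "continuous_on UNIV ((\<lambda>z. B\<^sup>2 * (1 - \<phi> n z)\<^sup>2) \<circ> torus_exp)"
        proof -
          have "continuous_on UNIV (\<lambda>t. B\<^sup>2 * (1 - Re (\<Phi> n t))\<^sup>2)"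
            by (intro continuous_intros periodic_contD[OF \<Phi>])
          then show ?thesis by (simp add: \<Phi>_def o_def)
        qed
        ultimately have "integral\<^sup>L haar_torus (\<lambda>z. B\<^sup>2 * (1 - \<phi> n z)\<^sup>2)
            = integral (cbox 0 1) (\<lambda>t. B\<^sup>2 * (1 - \<phi> n (torus_exp t))\<^sup>2)"
          by (rule integral_haar_torus)
        then show ?thesis by (simp only: \<Phi>_def o_apply Re_complex_of_real)
      qed
      have meas: "(\<lambda>z. B\<^sup>2 * (1 - \<phi> n z)\<^sup>2) \<in> borel_measurable haar_torus" for n
      proof -
        have "(\<lambda>z. Re (complex_of_real (\<phi> n z))) \<in> borel_measurable borel"
          by (rule measurable_compose[OF Cc_smoothD(4)[OF \<phi>(1) St, of n]])
             (intro borel_measurable_continuous_onI continuous_intros)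
        then show ?thesis by (simp add: haar_torus_def)
      qed
      have "(\<lambda>n. integral\<^sup>L haar_torus (\<lambda>z. B\<^sup>2 * (1 - \<phi> n z)\<^sup>2)) \<longlonglongrightarrow>
          integral\<^sup>L (haar_torus :: (complex ^ 'k) measure) (\<lambda>z. 0 :: real)"
      proof (rule integral_dominated_convergence[where w = "\<lambda>_. B\<^sup>2"])
        show "integrable haar_torus (\<lambda>_ :: complex ^ 'k. B\<^sup>2)"
          by (rule integrable_haar_torus) (auto simp: o_def)
        show "AE z in haar_torus. (\<lambda>n. B\<^sup>2 * (1 - \<phi> n z)\<^sup>2) \<longlonglongrightarrow> 0"
          using AE
        proof eventually_elim
          case (elim z)
          have "(\<lambda>n. B\<^sup>2 * (1 - \<phi> n z)\<^sup>2) \<longlonglongrightarrow> B\<^sup>2 * (1 - 1)\<^sup>2"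
            by (intro tendsto_intros lim elim)
          then show ?case by simp
        qed
        show "AE z in haar_torus. norm (B\<^sup>2 * (1 - \<phi> n z)\<^sup>2) \<le> B\<^sup>2" for n
        proof (rule AE_I2)
          fix z
          have "(1 - \<phi> n z)\<^sup>2 \<le> 1" using \<phi>(2)[of n z] \<phi>(3)[of n z] by (intro power_le_one) auto
          then have "B\<^sup>2 * (1 - \<phi> n z)\<^sup>2 \<le> B\<^sup>2 * 1" by (intro mult_left_mono) auto
          then show "norm (B\<^sup>2 * (1 - \<phi> n z)\<^sup>2) \<le> B\<^sup>2" by simp
        qed
      qed (use meas in auto)
      then show "(\<lambda>n. integral (cbox 0 1) (\<lambda>t. B\<^sup>2 * (1 - Re (\<Phi> n t))\<^sup>2)) \<longlonglongrightarrow> 0"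
        unfolding int by simp
      show "\<forall>\<^sub>F n in sequentially. 0 \<le> (norm (fourier_vec p - x n))\<^sup>2" by simp
      show "\<forall>\<^sub>F n in sequentially. (norm (fourier_vec p - x n))\<^sup>2 \<le> integral (cbox 0 1) (\<lambda>t. B\<^sup>2 * (1 - Re (\<Phi> n t))\<^sup>2)"
      proof (intro always_eventually allI)
        fix n
        have \<Phi>p: "(\<lambda>t. \<Phi> n t * p t) \<in> periodic_cont" by (intro periodic_cont_intros \<Phi> pp)
        have d: "(\<lambda>t. p t - \<Phi> n t * p t) \<in> periodic_cont" by (intro periodic_cont_intros \<Phi>p pp)
        have "(norm (fourier_vec p - x n))\<^sup>2 = mean_square (\<lambda>t. p t - \<Phi> n t * p t)"
          unfolding x_def fourier_vec_diff[OF pp \<Phi>p, symmetric] by (rule norm_fourier_vec[OF d])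
        also have "\<dots> \<le> integral (cbox 0 1) (\<lambda>t. B\<^sup>2 * (1 - Re (\<Phi> n t))\<^sup>2)"
          unfolding mean_square_def
        proof (rule integral_le)
          show "(\<lambda>t. (cmod (p t - \<Phi> n t * p t))\<^sup>2) integrable_on cbox 0 1"
            by (intro integrable_continuous continuous_intros periodic_contD pp \<Phi>)
          show "(\<lambda>t. B\<^sup>2 * (1 - Re (\<Phi> n t))\<^sup>2) integrable_on cbox 0 1"
            by (intro integrable_continuous continuous_intros periodic_contD[OF \<Phi>])
          fix t
          have "p t - \<Phi> n t * p t = p t * complex_of_real (1 - \<phi> n (torus_exp t))"
            by (simp add: \<Phi>_def algebra_simps)
          then have "(cmod (p t - \<Phi> n t * p t))\<^sup>2 = (cmod (p t))\<^sup>2 * (1 - \<phi> n (torus_exp t))\<^sup>2"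
            by (simp only: norm_mult norm_of_real power_mult_distrib power2_abs)
          also have "\<dots> \<le> B\<^sup>2 * (1 - \<phi> n (torus_exp t))\<^sup>2"
            using B by (intro mult_right_mono power_mono) auto
          finally show "(cmod (p t - \<Phi> n t * p t))\<^sup>2 \<le> B\<^sup>2 * (1 - Re (\<Phi> n t))\<^sup>2" by (simp add: \<Phi>_def)
        qed
        finally show "(norm (fourier_vec p - x n))\<^sup>2 \<le> integral (cbox 0 1) (\<lambda>t. B\<^sup>2 * (1 - Re (\<Phi> n t))\<^sup>2)" .
      qed
    qed
    from tendsto_real_sqrt[OF this] have "(\<lambda>n. norm (fourier_vec p - x n)) \<longlonglongrightarrow> 0" by simp
    then have "x \<longlonglongrightarrow> fourier_vec p"
      by (subst tendsto_dist_iff) (simp add: dist_norm norm_minus_commute)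
    then show ?thesis using \<open>\<And>n. x n \<in> RS S\<close> by (auto simp: closure_sequential)
  qed note trig_cl = this
  have "y \<in> closure (closure (RS S))" for y
    unfolding closure_approachable[of _ "closure (RS S)"]
  proof (intro allI impI)
    fix e :: real assume "e > 0"
    then obtain p where "p \<in> trig" "norm (y - fourier_vec p) \<le> e / 2"
      using trig_vec_dense[of "e / 2" y] by auto
    then show "\<exists>x\<in>closure (RS S). dist x y < e"
      using trig_cl \<open>e > 0\<close> by (intro bexI[of _ "fourier_vec p"]) (auto simp: dist_norm norm_minus_commute)
  qed
  then show ?thesis by auto
qed

section \<open>Multiplication operators\<close>

text \<open>\<open>T\<close> corresponds to multiplication by \<open>F\<close> on the Fourier side.\<close>

definition is_mul :: "(real ^ 'k \<Rightarrow> complex) \<Rightarrow> (int ^ 'k) op \<Rightarrow> bool" where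
  "is_mul F T \<longleftrightarrow> T \<in> bounded_ops \<and> (\<forall>l m. coeff (T (delta l)) m = fourier_coeff F (m - l))"

lemma is_mul_bounded: "is_mul F T \<Longrightarrow> T \<in> bounded_ops"
  by (simp add: is_mul_def)

lemma is_mul_unique: "is_mul F S \<Longrightarrow> is_mul F T \<Longrightarrow> S = T"
  by (rule op_eqI_delta) (auto simp: is_mul_def intro!: ell2_eqI)

text \<open>The matrix prescribes \<open>T\<close> on characters, hence on trigonometric
  polynomials; both sides are continuous in \<open>G\<close> for the supremum norm, with constants
  \<open>norm T\<close> and \<open>B\<close>.\<close>

lemma is_mul_apply:
  assumes F: "F \<in> periodic_cont" and T: "is_mul F T" and G: "G \<in> periodic_cont"
  shows "T (fourier_vec G) = fourier_vec (\<lambda>t. F t * G t)"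
proof -
  have trig: "T (fourier_vec p) = fourier_vec (\<lambda>t. F t * p t)" if "p \<in> trig" for p
    using that
  proof (induction rule: trig.induct)
    case (trig_char c n)
    have "T (delta (- n)) = fourier_vec (\<lambda>t. torus_char n t * F t)"
      using T F by (intro ell2_eqI) (simp add: is_mul_def fourier_coeff_char_mult periodic_cont_intros)
    then have "T (fourier_vec (\<lambda>t. c * torus_char n t)) = fourier_vec (\<lambda>t. c * (torus_char n t * F t))"
      using F by (simp add: fourier_vec_scale periodic_cont_intros fourier_vec_torus_char
          bounded_opsD[OF is_mul_bounded[OF T]])
    also have "(\<lambda>t. c * (torus_char n t * F t)) = (\<lambda>t. F t * (c * torus_char n t))" by (auto simp: mult_ac)
    finally show ?case .
  next
    case (trig_add p q)
    then show ?case
      using F trig_periodic_cont[OF trig_add(1)] trig_periodic_cont[OF trig_add(2)]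
      by (simp add: fourier_vec_add blinfun.add_right distrib_left periodic_cont_intros)
  qed
  obtain B where B: "0 < B" "\<And>t. cmod (F t) \<le> B" using periodic_cont_bounded[OF F] by blast
  define K where "K = norm T + B"
  have K: "K > 0" using B by (simp add: K_def add_nonneg_pos)
  have "norm (T (fourier_vec G) - fourier_vec (\<lambda>t. F t * G t)) \<le> e" if e: "e > 0" for e
  proof -
    have e': "e / K > 0" using e K by simp
    obtain p where p: "p \<in> trig" "\<And>t. cmod (G t - p t) < e / K" using trig_dense[OF G e'] by blast
    have pp: "p \<in> periodic_cont" by (rule trig_periodic_cont[OF p(1)])
    have D: "(\<lambda>t. G t - p t) \<in> periodic_cont" "(\<lambda>t. F t * (G t - p t)) \<in> periodic_cont"
      by (intro periodic_cont_intros F G pp)+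
    have 1: "norm (T (fourier_vec (\<lambda>t. G t - p t))) \<le> norm T * (e / K)"
      by (intro order_trans[OF norm_blinfun] mult_left_mono norm_fourier_vec_le D less_imp_le[OF p(2)] norm_ge_zero)
    have 2: "norm (fourier_vec (\<lambda>t. F t * (G t - p t))) \<le> B * (e / K)"
    proof (rule norm_fourier_vec_le[OF D(2)])
      show "cmod (F t * (G t - p t)) \<le> B * (e / K)" for t
        unfolding norm_mult using B p(2)[of t] by (intro mult_mono) auto
    qed
    have "T (fourier_vec (\<lambda>t. G t - p t)) = T (fourier_vec G) - fourier_vec (\<lambda>t. F t * p t)"
      by (simp add: fourier_vec_diff[OF G pp] blinfun.diff_right trig[OF p(1)])
    moreover have "fourier_vec (\<lambda>t. F t * (G t - p t)) = fourier_vec (\<lambda>t. F t * G t) - fourier_vec (\<lambda>t. F t * p t)"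
      using F G pp by (simp add: right_diff_distrib fourier_vec_diff periodic_cont_intros)
    ultimately have "norm (T (fourier_vec G) - fourier_vec (\<lambda>t. F t * G t))
        = norm (T (fourier_vec (\<lambda>t. G t - p t)) - fourier_vec (\<lambda>t. F t * (G t - p t)))" by simp
    also have "\<dots> \<le> norm T * (e / K) + B * (e / K)"
      using 1 2 norm_triangle_ineq4[of "T (fourier_vec (\<lambda>t. G t - p t))" "fourier_vec (\<lambda>t. F t * (G t - p t))"]
      by linarith
    also have "\<dots> = K * (e / K)" by (simp add: K_def algebra_simps add_divide_distrib)
    also have "\<dots> = e" using K by simp
    finally show ?thesis .
  qed
  then have "norm (T (fourier_vec G) - fourier_vec (\<lambda>t. F t * G t)) \<le> 0"
    by (rule field_le_epsilon[of _ 0, simplified]) auto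
  then show ?thesis by simp
qed

text \<open>On trigonometric polynomials the pointwise bound passes under the integral by Parseval,
  and their coefficient vectors are dense.\<close>

lemma norm_is_mul_le:
  assumes F: "F \<in> periodic_cont" and T: "is_mul F T" and B: "\<And>t. cmod (F t) \<le> B"
  shows "norm T \<le> B"
proof (rule norm_blinfun_bound)
  show B0: "0 \<le> B" using B[of 0] norm_ge_zero order_trans by blast
  fix v
  have trig: "norm (T (fourier_vec p)) \<le> B * norm (fourier_vec p)" if p: "p \<in> trig" for p
  proof -
    have pp: "p \<in> periodic_cont" by (rule trig_periodic_cont[OF p])
    have Fp: "(\<lambda>t. F t * p t) \<in> periodic_cont" by (intro periodic_cont_intros F pp)
    have "(norm (T (fourier_vec p)))\<^sup>2 = mean_square (\<lambda>t. F t * p t)"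
      by (simp add: is_mul_apply[OF F T pp] norm_fourier_vec[OF Fp])
    also have "\<dots> \<le> integral (cbox 0 1) (\<lambda>t. B\<^sup>2 * (cmod (p t))\<^sup>2)"
      unfolding mean_square_def
    proof (rule integral_le)
      show "(cmod (F t * p t))\<^sup>2 \<le> B\<^sup>2 * (cmod (p t))\<^sup>2" for t
        unfolding norm_mult power_mult_distrib using B by (intro mult_right_mono power_mono) auto
    qed (intro integrable_continuous continuous_intros periodic_contD F pp)+
    also have "\<dots> = (B * norm (fourier_vec p))\<^sup>2"
      by (simp add: power_mult_distrib norm_fourier_vec[OF pp] mean_square_def)
    finally show ?thesis using B0 by (simp add: power2_le_iff_abs_le)
  qed
  have "norm (T v) \<le> B * norm v + e" if e: "e > 0" for e
  proof -
    \<comment> \<open>Replacing \<open>v\<close> by a trigonometric polynomial costs (norm T + B) (e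
      / K) = (K - 1) (e / K), which is below \<open>e\<close>.\<close>
    define K where "K = norm T + B + 1"
    have K: "K > 0" using B0 by (simp add: K_def add_nonneg_pos)
    obtain p where p: "p \<in> trig" "norm (v - fourier_vec p) \<le> e / K"
      using trig_vec_dense[of "e / K" v] e K by auto
    have np: "norm (fourier_vec p) \<le> norm v + e / K"
      using norm_triangle_sub[of "fourier_vec p" v] p(2) by (simp add: norm_minus_commute)
    have "T v = T (fourier_vec p) + T (v - fourier_vec p)" by (simp add: blinfun.diff_right)
    then have "norm (T v) \<le> norm (T (fourier_vec p)) + norm (T (v - fourier_vec p))"
      by (simp only: norm_triangle_ineq)
    also have "\<dots> \<le> B * norm (fourier_vec p) + norm T * (e / K)"
      using p by (intro add_mono trig order_trans[OF norm_blinfun] mult_left_mono) auto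
    also have "\<dots> \<le> B * (norm v + e / K) + norm T * (e / K)"
      by (intro add_right_mono mult_left_mono np B0)
    also have "\<dots> = B * norm v + (K - 1) * (e / K)" by (simp add: K_def algebra_simps add_divide_distrib)
    also have "(K - 1) * (e / K) \<le> K * (e / K)" using e K by (intro mult_right_mono) auto
    finally show ?thesis using K by simp
  qed
  then show "norm (T v) \<le> B * norm v" by (rule field_le_epsilon)
qed

text \<open>The test function \<open>max 0 (\<bar>F\<bar>\<^sup>2 - \<parallel>T\<parallel>\<^sup>2)\<close> detects where \<open>\<bar>F\<bar>\<close> exceeds \<open>\<parallel>T\<parallel>\<close>.\<close>

lemma cmod_le_norm_is_mul:
  fixes F :: "real ^ 'k \<Rightarrow> complex"
  assumes F: "F \<in> periodic_cont" and T: "is_mul F T"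
  shows "cmod (F t) \<le> norm T"
proof -
  define h where "h t = (cmod (F t))\<^sup>2 - (norm T)\<^sup>2" for t
  define g where "g t = max 0 (h t)" for t
  define G where "G t = complex_of_real (g t)" for t
  have hc: "continuous_on A h" for A unfolding h_def by (intro continuous_intros periodic_contD F)
  have gc: "continuous_on A g" for A unfolding g_def by (intro continuous_intros hc)
  have G: "G \<in> periodic_cont"
    unfolding periodic_cont_def using gc periodic_cont_int[OF F]
    by (auto simp: G_def g_def h_def intro!: continuous_intros)
  have FG: "(\<lambda>t. F t * G t) \<in> periodic_cont" by (intro periodic_cont_intros F G)
  have "(norm (T (fourier_vec G)))\<^sup>2 \<le> (norm T * norm (fourier_vec G))\<^sup>2"
    by (intro power_mono norm_blinfun) auto
  then have "mean_square (\<lambda>t. F t * G t) \<le> (norm T)\<^sup>2 * mean_square G"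
    by (simp add: is_mul_apply[OF F T G] norm_fourier_vec[OF FG] norm_fourier_vec[OF G] power_mult_distrib)
  then have "integral (cbox 0 1) (\<lambda>t. (cmod (F t * G t))\<^sup>2) - integral (cbox 0 1) (\<lambda>t. (norm T)\<^sup>2 * (cmod (G t))\<^sup>2) \<le> 0"
    by (simp add: mean_square_def)
  then have "integral (cbox 0 1) (\<lambda>t. (cmod (F t * G t))\<^sup>2 - (norm T)\<^sup>2 * (cmod (G t))\<^sup>2) \<le> 0"
    by (subst integral_diff) (auto intro!: integrable_continuous continuous_intros periodic_contD F G)
  \<comment> \<open>With |G| = g the integrand is h g^2, which equals g^3 since g is the positive
    part of h. A continuous nonnegative function whose integral is at most 0 vanishes.\<close>
  also have "(\<lambda>t. (cmod (F t * G t))\<^sup>2 - (norm T)\<^sup>2 * (cmod (G t))\<^sup>2) = (\<lambda>t. g t ^ 3)"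
  proof
    fix t
    have "cmod (G t) = g t" by (simp add: G_def g_def)
    moreover have "h t * (g t)\<^sup>2 = g t ^ 3" by (simp add: g_def max_def power2_eq_square power3_eq_cube)
    ultimately show "(cmod (F t * G t))\<^sup>2 - (norm T)\<^sup>2 * (cmod (G t))\<^sup>2 = g t ^ 3"
      by (simp add: norm_mult power_mult_distrib h_def left_diff_distrib)
  qed
  finally have "integral (cbox 0 1) (\<lambda>t. g t ^ 3) \<le> 0" .
  moreover have "integral (cbox 0 1) (\<lambda>t. g t ^ 3) \<ge> 0"
    by (intro integral_nonneg integrable_continuous continuous_intros gc) (auto simp: g_def)
  ultimately have "integral (cbox 0 1) (\<lambda>t. g t ^ 3) = 0" by simp
  moreover have "box 0 (1 :: real ^ 'k) \<noteq> {}"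
  proof -
    have "(\<chi> i. 1 / 2) \<in> box 0 (1 :: real ^ 'k)" by (simp add: mem_box_cart)
    then show ?thesis by blast
  qed
  ultimately have z: "g s = 0" if "s \<in> cbox 0 1" for s
  proof -
    have "(integral (cbox 0 1) (\<lambda>t. g t ^ 3) = 0) = (\<forall>t\<in>cbox 0 1. g t ^ 3 = 0)"
      by (intro integral_cbox_eq_0_iff continuous_intros gc \<open>box 0 1 \<noteq> {}\<close>) (auto simp: g_def)
    then show ?thesis using \<open>integral (cbox 0 1) (\<lambda>t. g t ^ 3) = 0\<close> \<open>s \<in> cbox 0 1\<close> by simp
  qed
  have "torus_exp t \<in> torus_exp ` cbox 0 1" by (simp add: torus_exp_surj)
  then obtain s where s: "s \<in> cbox 0 1" "torus_exp t = torus_exp s" by blast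
  then obtain m where m: "t = s + (\<chi> i. of_int (m $ i))" by (auto simp: torus_exp_eq_iff)
  have "cmod (F t) = cmod (F s)" unfolding m by (simp add: periodic_cont_int[OF F])
  moreover have "h s \<le> 0" using z[OF s(1)] by (simp add: g_def)
  ultimately have "cmod (F t) = cmod (F s)" "h s \<le> 0" by auto
  then show ?thesis by (simp add: h_def power2_le_iff_abs_le)
qed

section \<open>Algebraic operations and limits of multiplication operators\<close>

lemma is_mul_add:
  assumes "F \<in> periodic_cont" "G \<in> periodic_cont" "is_mul F S" "is_mul G T"
  shows "is_mul (\<lambda>t. F t + G t) (S + T)"
  using assms by (simp add: is_mul_def fourier_coeff_add blinfun.add_left)

lemma is_mul_diff:
  assumes "F \<in> periodic_cont" "G \<in> periodic_cont" "is_mul F S" "is_mul G T"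
  shows "is_mul (\<lambda>t. F t - G t) (S - T)"
  using assms by (simp add: is_mul_def fourier_coeff_diff blinfun.diff_left)

lemma is_mul_scale:
  assumes "is_mul F S" shows "is_mul (\<lambda>t. c * F t) (scale_op c S)"
  using assms by (simp add: is_mul_def fourier_coeff_scale)

lemma is_mul_mult:
  fixes F G :: "real ^ 'k \<Rightarrow> complex"
  assumes F: "F \<in> periodic_cont" "is_mul F S" and G: "G \<in> periodic_cont" "is_mul G T"
  shows "is_mul (\<lambda>t. F t * G t) (S o\<^sub>L T)"
  unfolding is_mul_def
proof (intro conjI allI)
  fix l m :: "int ^ 'k"
  have c: "torus_char (- l) \<in> periodic_cont" by (rule periodic_cont_intros)
  have Gc: "(\<lambda>t. G t * torus_char (- l) t) \<in> periodic_cont" by (intro periodic_cont_intros G)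
  have "(S o\<^sub>L T) (delta l) = fourier_vec (\<lambda>t. F t * (G t * torus_char (- l) t))"
    by (simp add: delta_eq_fourier_vec is_mul_apply[OF G c] is_mul_apply[OF F Gc])
  also have "\<dots> = fourier_vec (\<lambda>t. torus_char (- l) t * (F t * G t))" by (simp add: mult_ac)
  finally show "coeff ((S o\<^sub>L T) (delta l)) m = fourier_coeff (\<lambda>t. F t * G t) (m - l)"
    using F G by (simp add: periodic_cont_intros fourier_coeff_char_mult)
qed (use assms in \<open>simp add: is_mul_def\<close>)

lemma is_mul_adj:
  assumes "is_mul F T" shows "is_mul (\<lambda>t. cnj (F t)) (adj T)"
  unfolding is_mul_def
proof (intro conjI allI)
  have T: "T \<in> bounded_ops" by (rule is_mul_bounded[OF assms])
  then show "adj T \<in> bounded_ops" by simp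
  fix l m
  have "coeff (adj T (delta l)) m = cinner (delta m) (adj T (delta l))" by (simp add: cinner_delta)
  also have "\<dots> = cnj (coeff (T (delta m)) l)" by (simp add: cinner_adj_right T cinner_delta_right)
  finally show "coeff (adj T (delta l)) m = fourier_coeff (\<lambda>t. cnj (F t)) (m - l)"
    using assms by (simp add: is_mul_def fourier_coeff_cnj)
qed

text \<open>The zero operator \<open>T - T\<close> is multiplication by the difference, which its
  norm dominates pointwise.\<close>

lemma is_mul_eq:
  assumes "F \<in> periodic_cont" "G \<in> periodic_cont" "is_mul F T" "is_mul G T"
  shows "F = G"
proof
  fix t
  have "cmod (F t - G t) \<le> norm (T - T)"
    by (rule cmod_le_norm_is_mul[OF _ is_mul_diff[OF assms]]) (intro periodic_cont_intros assms)
  then show "F t = G t" by simp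
qed

lemma is_mul_limit:
  assumes Fn: "\<And>n. F n \<in> periodic_cont" "\<And>n. is_mul (F n) (T n)" and G: "G \<in> periodic_cont"
    and FG: "\<And>e. e > 0 \<Longrightarrow> \<forall>\<^sub>F n in sequentially. \<forall>t. cmod (F n t - G t) \<le> e" and T: "T \<longlonglongrightarrow> S"
  shows "is_mul G S"
  unfolding is_mul_def
proof (intro conjI allI)
  show "S \<in> bounded_ops"
    by (rule closed_sequentially[OF closed_bounded_ops _ T]) (rule is_mul_bounded[OF Fn(2)])
  fix l m
  have "(\<lambda>n. coeff (T n (delta l)) m) \<longlonglongrightarrow> coeff (S (delta l)) m"
    by (intro bounded_linear.tendsto[OF bounded_linear_coeff] bounded_linear.tendsto[OF blinfun.bounded_linear_left] T)
  then have "(\<lambda>n. fourier_coeff (F n) (m - l)) \<longlonglongrightarrow> coeff (S (delta l)) m"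
    using Fn(2) by (simp add: is_mul_def)
  moreover have "(\<lambda>n. fourier_coeff (F n) (m - l)) \<longlonglongrightarrow> fourier_coeff G (m - l)"
  proof (rule tendstoI)
    fix e :: real assume "e > 0"
    then have "\<forall>\<^sub>F n in sequentially. \<forall>t. cmod (F n t - G t) \<le> e / 2" by (intro FG) simp
    then show "\<forall>\<^sub>F n in sequentially. dist (fourier_coeff (F n) (m - l)) (fourier_coeff G (m - l)) < e"
    proof eventually_elim
      case (elim n)
      have "cmod (fourier_coeff (\<lambda>t. F n t - G t) (m - l)) \<le> e / 2"
        by (rule norm_fourier_coeff_le) (use elim Fn G in auto)
      then show ?case using \<open>e > 0\<close> by (simp add: dist_norm fourier_coeff_diff Fn G)
    qed
  qed
  ultimately show "coeff (S (delta l)) m = fourier_coeff G (m - l)" by (rule LIMSEQ_unique)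
qed

lemma is_mul_trig: "p \<in> trig \<Longrightarrow> \<exists>T. is_mul p T"
proof (induction rule: trig.induct)
  case (trig_char c n)
  have "is_mul (torus_char n) (right_regular n)"
    by (auto simp: is_mul_def coeff_delta fourier_coeff_torus_char algebra_simps)
  then show ?case using is_mul_scale by blast
next
  case (trig_add p q)
  then show ?case using is_mul_add trig_periodic_cont by metis
qed

text \<open>Characters act by translations, so trigonometric polynomials act by finite combinations
  of them; the upper norm estimate turns uniform approximation into a Cauchy sequence of
  operators.\<close>

lemma is_mul_exists:
  assumes F: "F \<in> periodic_cont" shows "\<exists>T. is_mul F T"
proof -
  have "\<exists>p T. p \<in> trig \<and> is_mul p T \<and> (\<forall>t. cmod (F t - p t) < 1 / real (Suc n))" for n
  proof -
    obtain p where "p \<in> trig" "\<And>t. cmod (F t - p t) < 1 / real (Suc n)"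
      using trig_dense[OF F, of "1 / real (Suc n)"] by auto
    then show ?thesis using is_mul_trig by blast
  qed
  then obtain p T where p: "\<And>n. p n \<in> trig" "\<And>n. is_mul (p n) (T n)"
    "\<And>n t. cmod (F t - p n t) < 1 / real (Suc n)" by metis
  have pp: "p n \<in> periodic_cont" for n by (rule trig_periodic_cont[OF p(1)])
  have small: "\<exists>N. \<forall>n\<ge>N. \<forall>t. cmod (F t - p n t) \<le> e" if "e > 0" for e
  proof -
    obtain N where N: "inverse (real (Suc N)) < e" using reals_Archimedean[OF \<open>e > 0\<close>] by blast
    have "cmod (F t - p n t) \<le> e" if "n \<ge> N" for n t
    proof -
      have "1 / real (Suc n) \<le> inverse (real (Suc N))" using that by (simp add: inverse_eq_divide frac_le)
      then show ?thesis using p(3)[of t n] N by linarith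
    qed
    then show ?thesis by blast
  qed
  have "Cauchy T"
  proof (rule metric_CauchyI)
    fix e :: real assume e: "e > 0"
    obtain N where N: "\<And>n t. n \<ge> N \<Longrightarrow> cmod (F t - p n t) \<le> e / 4" using small[of "e / 4"] e by auto
    have "dist (T m) (T n) < e" if "m \<ge> N" "n \<ge> N" for m n
    proof -
      have "norm (T m - T n) \<le> e / 2"
      proof (rule norm_is_mul_le[OF _ is_mul_diff[OF pp pp p(2) p(2)]])
        fix t
        have "p m t - p n t = (F t - p n t) - (F t - p m t)" by simp
        then show "cmod (p m t - p n t) \<le> e / 2"
          using N[OF that(1), of t] N[OF that(2), of t] norm_triangle_ineq4[of "F t - p n t" "F t - p m t"] by simp
      qed (intro periodic_cont_intros pp)
      then show ?thesis using e by (simp add: dist_norm)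
    qed
    then show "\<exists>M. \<forall>m\<ge>M. \<forall>n\<ge>M. dist (T m) (T n) < e" by blast
  qed
  then obtain S where "T \<longlonglongrightarrow> S" using Cauchy_convergent convergent_def by blast
  then have "is_mul F S"
    by (rule is_mul_limit[OF pp p(2) F, rotated])
       (use small in \<open>auto simp: eventually_sequentially norm_minus_commute\<close>)
  then show ?thesis by blast
qed

text \<open>Parseval rewrites the matrix entry as a mean in which the two characters merge into that
  of \<open>m - l\<close>, leaving the coefficient of the product function.\<close>

lemma su_int_is_mul:
  assumes F: "F \<in> periodic_cont" and G: "G \<in> periodic_cont"
    and X: "su_int (ketbra (fourier_vec F) (fourier_vec G)) X C"
  shows "is_mul (\<lambda>t. F t * cnj (G t)) X"
  unfolding is_mul_def
proof (intro conjI allI)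
  show "X \<in> bounded_ops" using X by (simp add: su_int_def)
  fix l m
  have Fc: "(\<lambda>t. torus_char m t * F t) \<in> periodic_cont" and Gc: "(\<lambda>t. torus_char l t * G t) \<in> periodic_cont"
    by (intro periodic_cont_intros F G)+
  have "coeff (X (delta l)) m = cinner (right_regular l (fourier_vec G)) (right_regular m (fourier_vec F))"
    by (rule su_int_ketbra_coeff[OF X])
  also have "\<dots> = mean (\<lambda>t. cnj (torus_char l t * G t) * (torus_char m t * F t))"
    using parseval[OF Gc Fc] by (simp add: fourier_vec_char_mult F G)
  also have "(\<lambda>t. cnj (torus_char l t * G t) * (torus_char m t * F t))
      = (\<lambda>t. torus_char (m - l) t * (F t * cnj (G t)))"
  proof
    fix t
    have "torus_char (m - l) t = torus_char m t * cnj (torus_char l t)"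
      by (simp add: cnj_torus_char torus_char_mult)
    then show "cnj (torus_char l t * G t) * (torus_char m t * F t) = torus_char (m - l) t * (F t * cnj (G t))"
      by simp
  qed
  finally show "coeff (X (delta l)) m = fourier_coeff (\<lambda>t. F t * cnj (G t)) (m - l)"
    by (simp add: fourier_coeff_def)
qed

section \<open>The fixed-point algebra is \<open>C\<^sub>0(S)\<close>\<close>

text \<open>A point outside \<open>S\<close> has a neighbourhood avoiding the compact set where |f|
  is at least e, so extension by zero is continuous on the torus. Conversely, superlevel sets are
  closed in the compact torus and contained in \<open>S\<close>.\<close>

lemma C0_iff:
  fixes S :: "(complex ^ 'k) set"
  assumes S: "openin (top_of_set torus) S"
  shows "f \<in> C0 S \<longleftrightarrow> continuous_on torus f \<and> (\<forall>z. z \<notin> S \<longrightarrow> f z = 0)"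
proof
  assume f: "f \<in> C0 S"
  then have c: "continuous_on S f" and K: "\<And>e. e > 0 \<Longrightarrow> compact {z \<in> S. e \<le> cmod (f z)}"
    and z0: "\<And>z. z \<notin> S \<Longrightarrow> f z = 0" by (auto simp: C0_def)
  obtain U where U: "open U" "S = torus \<inter> U" using S by (auto simp: openin_open)
  have "continuous_on torus f"
    unfolding continuous_on_iff
  proof (intro ballI allI impI)
    fix z :: "complex ^ 'k" and e :: real assume z: "z \<in> torus" and e: "e > 0"
    show "\<exists>d>0. \<forall>x\<in>torus. dist x z < d \<longrightarrow> dist (f x) (f z) < e"
    proof (cases "z \<in> S")
      case True
      obtain d where d: "d > 0" "\<And>x. x \<in> S \<Longrightarrow> dist x z < d \<Longrightarrow> dist (f x) (f z) < e"
        using c True e unfolding continuous_on_iff by blast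
      obtain r where r: "r > 0" "\<And>x. dist x z < r \<Longrightarrow> x \<in> U"
        using U(1) True U(2) unfolding open_dist by blast
      show ?thesis using d r U(2) by (intro exI[of _ "min d r"]) auto
    next
      case False
      have "open (- {z \<in> S. e \<le> cmod (f z)})" using K[OF e] by (intro open_Compl compact_imp_closed)
      then obtain r where r: "r > 0" "\<And>x. dist x z < r \<Longrightarrow> x \<in> - {z \<in> S. e \<le> cmod (f z)}"
        using False unfolding open_dist by blast
      have "dist (f x) (f z) < e" if "dist x z < r" for x
        using r(2)[OF that] z0[OF False] z0[of x] e by (cases "x \<in> S") auto
      then show ?thesis using r(1) by blast
    qed
  qed
  then show "continuous_on torus f \<and> (\<forall>z. z \<notin> S \<longrightarrow> f z = 0)" using z0 by blast
next
  assume f: "continuous_on torus f \<and> (\<forall>z. z \<notin> S \<longrightarrow> f z = 0)"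
  have St: "S \<subseteq> torus" using S openin_imp_subset by blast
  have "compact {z \<in> S. e \<le> cmod (f z)}" if e: "e > 0" for e
  proof -
    have "closed {z \<in> torus. e \<le> cmod (f z)}"
      using f by (intro continuous_on_closed_Collect_le continuous_on_const continuous_on_norm
          compact_imp_closed compact_torus) auto
    from compact_Int_closed[OF compact_torus this] have "compact {z \<in> torus. e \<le> cmod (f z)}"
      by (rule back_subst[of compact]) auto
    moreover have "{z \<in> torus. e \<le> cmod (f z)} = {z \<in> S. e \<le> cmod (f z)}" using f e St by force
    ultimately show ?thesis by simp
  qed
  then show "f \<in> C0 S" using f St continuous_on_subset by (auto simp: C0_def)
qed

definition C0_ops :: "(complex ^ 'k) set \<Rightarrow> (int ^ 'k) op set" where
  "C0_ops S = {T. \<exists>f\<in>C0 S. is_mul (f \<circ> torus_exp) T}"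

context
  fixes S :: "(complex ^ 'k) set"
  assumes S: "openin (top_of_set torus) S"
begin

lemma S_torus: "S \<subseteq> torus"
  using S openin_imp_subset by blast

lemma C0_periodic: "f \<in> C0 S \<Longrightarrow> f \<circ> torus_exp \<in> periodic_cont"
  using C0_iff[OF S] periodic_cont_comp by blast

lemma Cc_smooth_C0: "f \<in> Cc_smooth S \<Longrightarrow> f \<in> C0 S"
  using C0_iff[OF S] Cc_smoothD[OF _ S_torus] by blast

lemma C0_closure:
  "(\<lambda>z. 0) \<in> C0 S"
  "f \<in> C0 S \<Longrightarrow> g \<in> C0 S \<Longrightarrow> (\<lambda>z. f z + g z) \<in> C0 S"
  "f \<in> C0 S \<Longrightarrow> g \<in> C0 S \<Longrightarrow> (\<lambda>z. f z * g z) \<in> C0 S"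
  "f \<in> C0 S \<Longrightarrow> (\<lambda>z. c * f z) \<in> C0 S"
  "f \<in> C0 S \<Longrightarrow> (\<lambda>z. cnj (f z)) \<in> C0 S"
  unfolding C0_iff[OF S] by (auto intro!: continuous_intros)

lemma C0_ops_bounded: "T \<in> C0_ops S \<Longrightarrow> T \<in> bounded_ops"
  by (auto simp: C0_ops_def is_mul_bounded)

lemma C0_ops_subspace: "op.subspace (C0_ops S)"
proof (rule op.subspaceI)
  have "is_mul (\<lambda>t. 0) 0" by (simp add: is_mul_def fourier_coeff_def)
  then show "0 \<in> C0_ops S" unfolding C0_ops_def using C0_closure(1) by (force simp: o_def)
  show "T + T' \<in> C0_ops S" if "T \<in> C0_ops S" "T' \<in> C0_ops S" for T T'
  proof -
    obtain f g where fg: "f \<in> C0 S" "is_mul (f \<circ> torus_exp) T" "g \<in> C0 S" "is_mul (g \<circ> torus_exp) T'"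
      using \<open>T \<in> C0_ops S\<close> \<open>T' \<in> C0_ops S\<close> by (auto simp: C0_ops_def)
    then have "is_mul ((\<lambda>z. f z + g z) \<circ> torus_exp) (T + T')"
      using is_mul_add[OF C0_periodic C0_periodic fg(2,4)] by (simp add: o_def)
    then show ?thesis using C0_closure(2)[OF fg(1,3)] by (auto simp: C0_ops_def)
  qed
  show "scale_op c T \<in> C0_ops S" if "T \<in> C0_ops S" for c T
  proof -
    obtain f where f: "f \<in> C0 S" "is_mul (f \<circ> torus_exp) T"
      using \<open>T \<in> C0_ops S\<close> by (auto simp: C0_ops_def)
    then have "is_mul ((\<lambda>z. c * f z) \<circ> torus_exp) (scale_op c T)"
      using is_mul_scale[OF f(2)] by (simp add: o_def)
    then show ?thesis using C0_closure(4)[OF f(1)] by (auto simp: C0_ops_def)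
  qed
qed

text \<open>The operator norm dominates the distance of the functions pointwise, so a convergent
  sequence of operators has uniformly Cauchy functions; continuity on the torus and vanishing off
  \<open>S\<close> survive the uniform limit.\<close>

lemma C0_ops_closed: "closed (C0_ops S)"
  unfolding closed_sequential_limits
proof (intro allI impI, elim conjE)
  fix T l assume T: "\<forall>n. T n \<in> C0_ops S" "T \<longlonglongrightarrow> l"
  then have "\<forall>n. \<exists>f. f \<in> C0 S \<and> is_mul (f \<circ> torus_exp) (T n)" by (auto simp: C0_ops_def)
  from choice[OF this] obtain f where f: "\<And>n. f n \<in> C0 S" "\<And>n. is_mul (f n \<circ> torus_exp) (T n)" by blast
  have fp: "f n \<circ> torus_exp \<in> periodic_cont" for n by (rule C0_periodic[OF f(1)])
  have diff: "cmod (f m z - f n z) \<le> norm (T m - T n)" for m n z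
  proof (cases "z \<in> torus")
    case True
    then obtain t where t: "z = torus_exp t" using torus_exp_surj_UNIV by blast
    have "(\<lambda>t. (f m \<circ> torus_exp) t - (f n \<circ> torus_exp) t) \<in> periodic_cont" by (intro periodic_cont_intros fp)
    from cmod_le_norm_is_mul[OF this is_mul_diff[OF fp fp f(2) f(2)], of t] show ?thesis by (simp add: t)
  next
    case False
    then have "f m z = 0" "f n z = 0" using f(1) S_torus unfolding C0_iff[OF S] by blast+
    then show ?thesis by simp
  qed
  have "Cauchy T" using T(2) by (rule LIMSEQ_imp_Cauchy)
  have "uniformly_Cauchy_on UNIV f"
  proof (rule uniformly_Cauchy_onI)
    fix e :: real assume "e > 0"
    then obtain M where M: "\<And>m n. m \<ge> M \<Longrightarrow> n \<ge> M \<Longrightarrow> dist (T m) (T n) < e"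
      using \<open>Cauchy T\<close> by (meson metric_CauchyD)
    have "dist (f m x) (f n x) < e" if "m \<ge> M" "n \<ge> M" for m n x
      using order_le_less_trans[OF diff M[OF that, unfolded dist_norm]] by (simp add: dist_norm)
    then show "\<exists>M. \<forall>x\<in>UNIV. \<forall>m\<ge>M. \<forall>n\<ge>M. dist (f m x) (f n x) < e" by blast
  qed
  then obtain g where g: "uniform_limit UNIV f g sequentially"
    using Cauchy_uniformly_convergent unfolding uniformly_convergent_on_def by blast
  have gC: "g \<in> C0 S"
    unfolding C0_iff[OF S]
  proof (intro conjI allI impI)
    have "uniform_limit torus f g sequentially" using g by (rule uniform_limit_on_subset) auto
    then show "continuous_on torus g"
      by (rule uniform_limit_theorem[rotated]) (use f(1) in \<open>auto simp: C0_iff[OF S]\<close>)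
    fix z assume z: "z \<notin> S"
    have "(\<lambda>n. f n z) \<longlonglongrightarrow> g z" using tendsto_uniform_limitI[OF g] by simp
    moreover have "f n z = 0" for n using f(1) z by (auto simp: C0_iff[OF S])
    ultimately show "g z = 0" by (simp add: LIMSEQ_const_iff)
  qed
  have "is_mul (g \<circ> torus_exp) l"
  proof (rule is_mul_limit[OF fp f(2) C0_periodic[OF gC] _ T(2)])
    fix e :: real assume "e > 0"
    from uniform_limitD[OF g this]
    show "\<forall>\<^sub>F n in sequentially. \<forall>t. cmod ((f n \<circ> torus_exp) t - (g \<circ> torus_exp) t) \<le> e"
      by eventually_elim (auto simp: dist_norm less_imp_le)
  qed
  then show "l \<in> C0_ops S" using gC by (auto simp: C0_ops_def)
qed

lemma C0_ops_cstar_subalgebra: "cstar_subalgebra (C0_ops S)"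
  unfolding cstar_subalgebra_def
proof (intro conjI ballI subsetI C0_ops_bounded C0_ops_subspace C0_ops_closed)
  show "T o\<^sub>L T' \<in> C0_ops S" if "T \<in> C0_ops S" "T' \<in> C0_ops S" for T T'
  proof -
    obtain f g where fg: "f \<in> C0 S" "is_mul (f \<circ> torus_exp) T" "g \<in> C0 S" "is_mul (g \<circ> torus_exp) T'"
      using \<open>T \<in> C0_ops S\<close> \<open>T' \<in> C0_ops S\<close> by (auto simp: C0_ops_def)
    then have "is_mul ((\<lambda>z. f z * g z) \<circ> torus_exp) (T o\<^sub>L T')"
      using is_mul_mult[OF C0_periodic fg(2) C0_periodic fg(4)] by (simp add: o_def)
    then show ?thesis using C0_closure(3)[OF fg(1,3)] by (auto simp: C0_ops_def)
  qed
  show "adj T \<in> C0_ops S" if "T \<in> C0_ops S" for T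
  proof -
    obtain f where f: "f \<in> C0 S" "is_mul (f \<circ> torus_exp) T"
      using \<open>T \<in> C0_ops S\<close> by (auto simp: C0_ops_def)
    then have "is_mul ((\<lambda>z. cnj (f z)) \<circ> torus_exp) (adj T)"
      using is_mul_adj[OF f(2)] by (simp add: o_def)
    then show ?thesis using C0_closure(5)[OF f(1)] by (auto simp: C0_ops_def)
  qed
qed

text \<open>Approximate \<open>f\<close> by \<open>(\<phi> p) \<phi>\<close> with a trigonometric polynomial \<open>p\<close> and a cut-off \<open>\<phi>\<close>.\<close>

lemma C0_approx:
  assumes f: "f \<in> C0 S" and e: "e > 0"
  shows "\<exists>g\<in>Cc_smooth S. \<exists>h\<in>Cc_smooth S. \<forall>t. cmod (f (torus_exp t) - g (torus_exp t) * cnj (h (torus_exp t))) \<le> e"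
proof -
  have fp: "f \<circ> torus_exp \<in> periodic_cont" by (rule C0_periodic[OF f])
  obtain B where B: "B > 0" "\<And>t. cmod ((f \<circ> torus_exp) t) \<le> B" using periodic_cont_bounded[OF fp] by blast
  define K where "K = {z \<in> S. e / 2 \<le> cmod (f z)}"
  have "\<forall>e>0. compact {z \<in> S. e \<le> cmod (f z)}" using f by (simp add: C0_def)
  then have K: "compact K" "K \<subseteq> S" using half_gt_zero[OF e] unfolding K_def by blast+
  \<comment> \<open>On \<open>K\<close> the defect 1 - phi^2 = (1 - phi)(1 + phi) is at most 2 e /
    (4 B), which against |f| at most B costs e/2; off \<open>K\<close> the function itself is at
    most e/2.\<close>
  obtain \<phi> where \<phi>: "(\<lambda>z. complex_of_real (\<phi> z)) \<in> Cc_smooth S" "\<And>z. 0 \<le> \<phi> z" "\<And>z. \<phi> z \<le> 1"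
    "\<And>z. z \<in> K \<Longrightarrow> \<phi> z \<ge> 1 - e / (4 * B)"
    using smooth_cutoff[OF S K, of "e / (4 * B)"] e B by auto
  obtain p where p: "p \<in> trig" "\<And>t. cmod ((f \<circ> torus_exp) t - p t) < e / 2"
    using trig_dense[OF fp, of "e / 2"] e by auto
  have pp: "p \<in> periodic_cont" by (rule trig_periodic_cont[OF p(1)])
  have pl: "p (torus_log (torus_exp t)) = p t" for t by (rule periodic_cont_torus_log[OF pp])
  have "(\<lambda>z. p (torus_log z)) \<circ> torus_exp = p" by (auto simp: pl)
  then have g: "(\<lambda>z. complex_of_real (\<phi> z) * p (torus_log z)) \<in> Cc_smooth S"
    using trig_smooth[OF p(1)] by (intro Cc_smooth_mult \<phi>) simp
  have "cmod (f z - complex_of_real (\<phi> z) * p t * cnj (complex_of_real (\<phi> z))) \<le> e"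
    if z: "z = torus_exp t" for z t
  proof -
    define a where "a = (\<phi> z)\<^sup>2"
    have a: "0 \<le> a" "a \<le> 1" using \<phi>(2,3)[of z] by (auto simp: a_def power_le_one)
    have "f z - complex_of_real (\<phi> z) * p t * cnj (complex_of_real (\<phi> z))
        = complex_of_real a * (f z - p t) + complex_of_real (1 - a) * f z"
      by (simp add: a_def power2_eq_square algebra_simps)
    also have "cmod \<dots> \<le> a * cmod (f z - p t) + (1 - a) * cmod (f z)"
    proof -
      have "cmod (complex_of_real a * (f z - p t)) = a * cmod (f z - p t)"
        using a by (simp add: norm_mult)
      moreover have "cmod (complex_of_real (1 - a) * f z) = (1 - a) * cmod (f z)"
        unfolding norm_mult norm_of_real using a by simp
      ultimately show ?thesis
        using norm_triangle_ineq[of "complex_of_real a * (f z - p t)" "complex_of_real (1 - a) * f z"] by linarith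
    qed
    also have "a * cmod (f z - p t) \<le> 1 * (e / 2)"
      using a p(2)[of t] by (intro mult_mono) (auto simp: z)
    also have "(1 - a) * cmod (f z) \<le> e / 2"
    proof (cases "z \<in> K")
      case True
      have "1 - a = (1 - \<phi> z) * (1 + \<phi> z)" by (simp add: a_def power2_eq_square algebra_simps)
      also have "\<dots> \<le> (e / (4 * B)) * 2"
        using \<phi>(2,3)[of z] \<phi>(4)[OF True] e B by (intro mult_mono) auto
      finally have "1 - a \<le> e / (2 * B)" by simp
      then have "(1 - a) * cmod (f z) \<le> e / (2 * B) * B"
        using B e by (intro mult_mono) (auto simp: z)
      then show ?thesis using B by simp
    next
      case False
      have "cmod (f z) \<le> e / 2"
      proof (cases "z \<in> S")
        case True
        then show ?thesis using False by (auto simp: K_def)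
      next
        case False
        then have "f z = 0" using f by (auto simp: C0_def)
        then show ?thesis using e by simp
      qed
      then have "(1 - a) * cmod (f z) \<le> 1 * (e / 2)" using a by (intro mult_mono) auto
      then show ?thesis by simp
    qed
    finally show ?thesis by simp
  qed
  then show ?thesis
    by (intro bexI[OF _ g] bexI[OF _ \<phi>(1)]) (simp add: pl)
qed

section \<open>Both fixed-point algebras coincide with \<open>C0_ops S\<close>\<close>

definition su_generators :: "(int ^ 'k) op set" where
  "su_generators = {su_sum compact_ops (\<lambda>t. ketbra (right_regular t \<xi>) (right_regular t \<eta>)) | \<xi> \<eta>.
     \<xi> \<in> RS S \<and> \<eta> \<in> RS S}"

lemma su_sum_RS:
  assumes "g \<in> Cc_smooth S" "h \<in> Cc_smooth S"
  shows "is_mul ((\<lambda>z. g z * cnj (h z)) \<circ> torus_exp) (su_sum compact_ops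
    (\<lambda>t. ketbra (right_regular t (fourier_vec (g \<circ> torus_exp))) (right_regular t (fourier_vec (h \<circ> torus_exp)))))"
proof -
  note g = Cc_smoothD(1,3)[OF assms(1) S_torus] and h = Cc_smoothD(1,3)[OF assms(2) S_torus]
  obtain X C where X: "su_int (ketbra (fourier_vec (g \<circ> torus_exp)) (fourier_vec (h \<circ> torus_exp))) X C"
    using su_int_ketbra[OF l1_fourier_vec[OF g(2,1)] l1_fourier_vec[OF h(2,1)]] by blast
  show ?thesis
    using su_int_is_mul[OF g(2) h(2) X] su_sum_su_int[OF X] by (simp add: Ad_ketbra o_def)
qed

lemma su_generators_subset: "su_generators \<subseteq> C0_ops S"
proof
  fix X assume "X \<in> su_generators"
  then obtain g h where gh: "g \<in> Cc_smooth S" "h \<in> Cc_smooth S"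
    "X = su_sum compact_ops (\<lambda>t. ketbra (right_regular t (fourier_vec (g \<circ> torus_exp)))
      (right_regular t (fourier_vec (h \<circ> torus_exp))))"
    by (auto simp: su_generators_def RS_iff[OF S_torus])
  then show "X \<in> C0_ops S"
    using su_sum_RS[OF gh(1,2)] C0_closure(3,5) Cc_smooth_C0 by (auto simp: C0_ops_def)
qed

text \<open>A single generator approximates \<open>T\<close>, since \<open>C0_approx\<close> uses
  one product and the norm of a difference is bounded by the supremum of its function. The same
  inclusion serves \<open>Fix\<close> and the generalised fixed-point algebra.\<close>

lemma C0_ops_subset_closure: "C0_ops S \<subseteq> closure su_generators"
proof
  fix T assume "T \<in> C0_ops S"
  then obtain f where f: "f \<in> C0 S" "is_mul (f \<circ> torus_exp) T" by (auto simp: C0_ops_def)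
  show "T \<in> closure su_generators"
    unfolding closure_approachable
  proof (intro allI impI)
    fix e :: real assume e: "e > 0"
    obtain g h where gh: "g \<in> Cc_smooth S" "h \<in> Cc_smooth S"
      "\<And>t. cmod (f (torus_exp t) - g (torus_exp t) * cnj (h (torus_exp t))) \<le> e / 2"
      using C0_approx[OF f(1), of "e / 2"] e by auto
    define X where "X = su_sum compact_ops (\<lambda>t. ketbra (right_regular t (fourier_vec (g \<circ> torus_exp)))
      (right_regular t (fourier_vec (h \<circ> torus_exp))))"
    have X: "is_mul ((\<lambda>z. g z * cnj (h z)) \<circ> torus_exp) X" unfolding X_def by (rule su_sum_RS[OF gh(1,2)])
    have "(\<lambda>z. g z * cnj (h z)) \<in> C0 S" by (intro C0_closure Cc_smooth_C0 gh)
    then have ghp: "(\<lambda>z. g z * cnj (h z)) \<circ> torus_exp \<in> periodic_cont" by (rule C0_periodic)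
    have "norm (T - X) \<le> e / 2"
    proof (rule norm_is_mul_le[OF _ is_mul_diff[OF C0_periodic[OF f(1)] ghp f(2) X]])
      show "(\<lambda>t. (f \<circ> torus_exp) t - ((\<lambda>z. g z * cnj (h z)) \<circ> torus_exp) t) \<in> periodic_cont"
        by (rule periodic_cont_intros(5)[OF C0_periodic[OF f(1)] ghp])
    qed (use gh(3) in simp)
    moreover have "X \<in> su_generators"
      using gh(1,2) unfolding su_generators_def X_def RS_iff[OF S_torus] by blast
    ultimately show "\<exists>y\<in>su_generators. dist y T < e"
      using e by (auto simp: dist_norm norm_minus_commute intro!: bexI[of _ X])
  qed
qed

lemma Fix_eq: "Fix right_regular (RS S) = C0_ops S"
proof -
  have eq: "Fix right_regular (RS S) = cstar_subalgebra hull su_generators"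
    by (simp add: Fix_def su_generators_def)
  show ?thesis
  proof
    show "Fix right_regular (RS S) \<subseteq> C0_ops S"
      unfolding eq by (rule hull_minimal[of _ _ cstar_subalgebra, OF su_generators_subset C0_ops_cstar_subalgebra])
    show "C0_ops S \<subseteq> Fix right_regular (RS S)"
      unfolding eq hull_def
    proof (rule Inter_greatest)
      fix B assume "B \<in> {t. cstar_subalgebra t \<and> su_generators \<subseteq> t}"
      then have "closure su_generators \<subseteq> B" by (intro closure_minimal) (auto simp: cstar_subalgebra_def)
      then show "C0_ops S \<subseteq> B" using C0_ops_subset_closure by blast
    qed
  qed
qed

lemma gen_fixed_point_algebra_eq:
  "gen_fixed_point_algebra (Ad right_regular) compact_ops (ketbra_span (RS S)) = C0_ops S"
proof
  show "gen_fixed_point_algebra (Ad right_regular) compact_ops (ketbra_span (RS S)) \<subseteq> C0_ops S"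
  proof (rule gen_fixed_point_algebra_subset[OF C0_ops_subspace C0_ops_closed])
    show "l1_vector a" if "a \<in> RS S" for a using RS_l1[OF S_torus that] .
    fix a c s t X C
    assume "a \<in> RS S" "c \<in> RS S"
      and X: "su_int (ketbra (right_regular s a) (right_regular t c)) X C"
    then obtain g h where gh: "g \<in> Cc_smooth S" "a = fourier_vec (g \<circ> torus_exp)"
      "h \<in> Cc_smooth S" "c = fourier_vec (h \<circ> torus_exp)" by (auto simp: RS_iff[OF S_torus])
    note g = Cc_smoothD(3)[OF gh(1) S_torus] and h = Cc_smoothD(3)[OF gh(3) S_torus]
    have Gp: "(\<lambda>r. torus_char s r * (g \<circ> torus_exp) r) \<in> periodic_cont"
      and Hp: "(\<lambda>r. torus_char t r * (h \<circ> torus_exp) r) \<in> periodic_cont"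
      by (intro periodic_cont_intros g h)+
    \<comment> \<open>Translating the vectors by \<open>s\<close> and \<open>t\<close> multiplies
      their transforms by characters, which does not disturb vanishing outside
      \<open>S\<close>.\<close>
    define f where "f z = (character s z * g z) * cnj (character t z * h z)" for z
    have fe: "f \<circ> torus_exp = (\<lambda>r. torus_char s r * (g \<circ> torus_exp) r * cnj (torus_char t r * (h \<circ> torus_exp) r))"
      by (auto simp: f_def character_torus_exp)
    have fp: "f \<circ> torus_exp \<in> periodic_cont"
      unfolding fe by (rule periodic_cont_intros(6)[OF Gp periodic_cont_intros(7)[OF Hp]])
    have "f \<in> C0 S"
      unfolding C0_iff[OF S]
      using continuous_on_torusI[OF periodic_contD[OF fp]] Cc_smoothD(5)[OF gh(1) S_torus]
      by (auto simp: f_def)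
    moreover have "is_mul (f \<circ> torus_exp) X"
      unfolding fe
      by (rule su_int_is_mul[OF Gp Hp]) (use X in \<open>simp only: gh(2,4) fourier_vec_char_mult[OF g] fourier_vec_char_mult[OF h]\<close>)
    ultimately show "X \<in> C0_ops S" by (auto simp: C0_ops_def)
  qed
  have "su_generators \<subseteq> gen_fixed_point_algebra (Ad right_regular) compact_ops (ketbra_span (RS S))"
    using su_sum_in_gen_fixed_point_algebra by (auto simp: su_generators_def)
  then have "closure su_generators \<subseteq> gen_fixed_point_algebra (Ad right_regular) compact_ops (ketbra_span (RS S))"
    by (rule closure_minimal) (simp add: gen_fixed_point_algebra_def)
  then show "C0_ops S \<subseteq> gen_fixed_point_algebra (Ad right_regular) compact_ops (ketbra_span (RS S))"
    using C0_ops_subset_closure by blast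
qed

text \<open>The isomorphism sends an operator to its function. Uniqueness of that function off the
  torus rests on the convention that elements of \<open>C0 S\<close> are 0 outside \<open>S\<close>;
  surjectivity is \<open>is_mul_exists\<close>.\<close>

lemma star_isomorphic_C0_ops: "star_isomorphic (op_alg (C0_ops S)) (C0_alg S)"
proof -
  define symb where "symb T = (SOME f. f \<in> C0 S \<and> is_mul (f \<circ> torus_exp) T)" for T
  have symb: "symb T \<in> C0 S" "is_mul (symb T \<circ> torus_exp) T" if "T \<in> C0_ops S" for T
    using someI_ex[of "\<lambda>f. f \<in> C0 S \<and> is_mul (f \<circ> torus_exp) T"] that
    unfolding C0_ops_def symb_def by auto
  have uniq: "symb T = f" if f: "f \<in> C0 S" "is_mul (f \<circ> torus_exp) T" for T f
  proof -
    have T: "T \<in> C0_ops S" using f by (auto simp: C0_ops_def)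
    have eq: "symb T \<circ> torus_exp = f \<circ> torus_exp"
      by (rule is_mul_eq[OF C0_periodic[OF symb(1)[OF T]] C0_periodic[OF f(1)] symb(2)[OF T] f(2)])
    show ?thesis
    proof
      fix z show "symb T z = f z"
      proof (cases "z \<in> torus")
        case True
        then obtain t where "z = torus_exp t" using torus_exp_surj_UNIV by blast
        then show ?thesis using fun_cong[OF eq, of t] by simp
      next
        case False
        then have "z \<notin> S" using S_torus by blast
        then show ?thesis using symb(1)[OF T] f(1) by (simp add: C0_def)
      qed
    qed
  qed
  have bij: "bij_betw symb (C0_ops S) (C0 S)"
    unfolding bij_betw_def
  proof
    show "inj_on symb (C0_ops S)"
      using symb(2) is_mul_unique by (metis inj_onI)
    show "symb ` C0_ops S = C0 S"
    proof safe
      fix f assume f: "f \<in> C0 S"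
      obtain T where "is_mul (f \<circ> torus_exp) T" using is_mul_exists[OF C0_periodic[OF f]] by blast
      then show "f \<in> symb ` C0_ops S" using uniq[OF f] f by (auto simp: C0_ops_def intro!: image_eqI)
    qed (rule symb)
  qed
  have "star_isomorphism symb (op_alg (C0_ops S)) (C0_alg S)"
    unfolding star_isomorphism_def op_alg_def C0_alg_def star_algebra.simps
  proof (intro conjI ballI allI bij)
    fix X Y assume X: "X \<in> C0_ops S" and Y: "Y \<in> C0_ops S"
    note px = C0_periodic[OF symb(1)[OF X]] and py = C0_periodic[OF symb(1)[OF Y]]
    show "symb (X + Y) = (\<lambda>z. symb X z + symb Y z)"
      using is_mul_add[OF px py symb(2)[OF X] symb(2)[OF Y]]
      by (intro uniq C0_closure symb X Y) (simp add: o_def)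
    show "symb (X o\<^sub>L Y) = (\<lambda>z. symb X z * symb Y z)"
      using is_mul_mult[OF px symb(2)[OF X] py symb(2)[OF Y]]
      by (intro uniq C0_closure symb X Y) (simp add: o_def)
  next
    fix X c assume X: "X \<in> C0_ops S"
    show "symb (scale_op c X) = (\<lambda>z. c * symb X z)"
      using is_mul_scale[OF symb(2)[OF X]] by (intro uniq C0_closure symb X) (simp add: o_def)
    show "symb (adj X) = (\<lambda>z. cnj (symb X z))"
      using is_mul_adj[OF symb(2)[OF X]] by (intro uniq C0_closure symb X) (simp add: o_def)
  qed
  then show ?thesis unfolding star_isomorphic_def by blast
qed

end

section \<open>Counting components of \<open>S\<close> in the algebra \<open>C\<^sub>0(S)\<close>\<close>

text \<open>A star algebra here is a bare record, so closure of the carrier under the operations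
  must be supplied: the inverse map recognises a result only inside the carrier of
  \<open>A\<close>.\<close>

lemma star_isomorphic_sym:
  assumes iso: "star_isomorphic A B"
    and cl: "\<And>x y. x \<in> alg_carrier A \<Longrightarrow> y \<in> alg_carrier A \<Longrightarrow> alg_add A x y \<in> alg_carrier A"
      "\<And>x y. x \<in> alg_carrier A \<Longrightarrow> y \<in> alg_carrier A \<Longrightarrow> alg_mult A x y \<in> alg_carrier A"
      "\<And>c x. x \<in> alg_carrier A \<Longrightarrow> alg_scale A c x \<in> alg_carrier A"
      "\<And>x. x \<in> alg_carrier A \<Longrightarrow> alg_star A x \<in> alg_carrier A"
  shows "star_isomorphic B A"
proof -
  obtain \<phi> where "star_isomorphism \<phi> A B" using iso by (auto simp: star_isomorphic_def)
  then have bij: "bij_betw \<phi> (alg_carrier A) (alg_carrier B)"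
    and hom: "\<And>x y. x \<in> alg_carrier A \<Longrightarrow> y \<in> alg_carrier A \<Longrightarrow> \<phi> (alg_add A x y) = alg_add B (\<phi> x) (\<phi> y)"
      "\<And>x y. x \<in> alg_carrier A \<Longrightarrow> y \<in> alg_carrier A \<Longrightarrow> \<phi> (alg_mult A x y) = alg_mult B (\<phi> x) (\<phi> y)"
      "\<And>c x. x \<in> alg_carrier A \<Longrightarrow> \<phi> (alg_scale A c x) = alg_scale B c (\<phi> x)"
      "\<And>x. x \<in> alg_carrier A \<Longrightarrow> \<phi> (alg_star A x) = alg_star B (\<phi> x)"
    by (auto simp: star_isomorphism_def)
  define \<psi> where "\<psi> = the_inv_into (alg_carrier A) \<phi>"
  have inj: "inj_on \<phi> (alg_carrier A)" and im: "\<phi> ` alg_carrier A = alg_carrier B"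
    using bij by (auto simp: bij_betw_def)
  have \<psi>: "\<psi> y \<in> alg_carrier A" "\<phi> (\<psi> y) = y" if "y \<in> alg_carrier B" for y
    using that the_inv_into_into[OF inj _ order_refl] f_the_inv_into_f[OF inj] im by (auto simp: \<psi>_def)
  have eq: "\<psi> y = x" if "x \<in> alg_carrier A" "\<phi> x = y" for x y
    using the_inv_into_f_f[OF inj that(1)] that(2) by (simp add: \<psi>_def)
  have "star_isomorphism \<psi> B A"
    unfolding star_isomorphism_def
  proof (intro conjI ballI allI)
    show "bij_betw \<psi> (alg_carrier B) (alg_carrier A)"
      unfolding \<psi>_def by (rule bij_betw_the_inv_into[OF bij])
  qed (auto intro!: eq cl simp: \<psi> hom)
  then show ?thesis by (auto simp: star_isomorphic_def)
qed

lemma star_isomorphic_trans: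
  assumes "star_isomorphic A B" "star_isomorphic B C"
  shows "star_isomorphic A C"
proof -
  obtain \<phi> \<psi> where \<phi>: "star_isomorphism \<phi> A B" and \<psi>: "star_isomorphism \<psi> B C"
    using assms by (auto simp: star_isomorphic_def)
  have "\<phi> x \<in> alg_carrier B" if "x \<in> alg_carrier A" for x
    using \<phi> that by (auto simp: star_isomorphism_def bij_betw_def)
  then have "star_isomorphism (\<psi> \<circ> \<phi>) A C"
    using \<phi> \<psi> by (auto simp: star_isomorphism_def intro: bij_betw_trans)
  then show ?thesis by (auto simp: star_isomorphic_def)
qed

lemma C0_nonzero_at:
  fixes S :: "(complex ^ 'k) set"
  assumes S: "openin (top_of_set torus) S" and z: "z \<in> S"
  shows "\<exists>f\<in>C0 S. f z \<noteq> 0"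
proof -
  obtain \<phi> where \<phi>: "(\<lambda>z. complex_of_real (\<phi> z)) \<in> Cc_smooth S" "\<And>w. w \<in> {z} \<Longrightarrow> \<phi> w \<ge> 1 - 1/2"
    using smooth_cutoff[OF S, of "{z}" "1/2"] z by auto
  show ?thesis
    by (intro bexI[OF _ Cc_smooth_C0[OF S \<phi>(1)]]) (use \<phi>(2)[of z] in auto)
qed

text \<open>\<open>U\<close> is open and closed in \<open>S\<close>, which gives continuity; each
  superlevel set is the old compact one minus an open set.\<close>

lemma C0_restrict:
  fixes S :: "(complex ^ 'k) set"
  assumes S: "openin (top_of_set torus) S" and U: "openin (top_of_set torus) U" "U \<subseteq> S"
    and V: "openin (top_of_set torus) (S - U)" and f: "f \<in> C0 S"
  shows "(\<lambda>z. if z \<in> U then f z else 0) \<in> C0 S"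
proof -
  have c: "continuous_on S f" and K: "\<And>e. e > 0 \<Longrightarrow> compact {z \<in> S. e \<le> cmod (f z)}"
    and z0: "\<And>z. z \<notin> S \<Longrightarrow> f z = 0" using f by (auto simp: C0_def)
  have St: "S \<subseteq> torus" using S openin_imp_subset by blast
  have oU: "openin (top_of_set S) U" "openin (top_of_set S) (S - U)"
    using U V St by (auto intro: openin_subset_trans)
  have "continuous_on (U \<union> (S - U)) (\<lambda>z. if z \<in> U then f z else 0)"
  proof (rule continuous_on_Un_local_open)
    show "openin (top_of_set (U \<union> (S - U))) U" "openin (top_of_set (U \<union> (S - U))) (S - U)"
      using oU U(2) by (simp_all add: Un_absorb1)
    show "continuous_on U (\<lambda>z. if z \<in> U then f z else 0)"
      using continuous_on_subset[OF c U(2)] by (rule continuous_on_eq) simp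
    show "continuous_on (S - U) (\<lambda>z. if z \<in> U then f z else 0)"
      by (rule continuous_on_eq[OF continuous_on_const[of _ 0]]) auto
  qed
  then have "continuous_on S (\<lambda>z. if z \<in> U then f z else 0)" using U(2) by (simp add: Un_absorb1)
  moreover have "compact {z \<in> S. e \<le> cmod (if z \<in> U then f z else 0)}" if e: "e > 0" for e
  proof -
    obtain W where W: "open W" "S - U = torus \<inter> W" using V by (auto simp: openin_open)
    have "compact ({z \<in> S. e \<le> cmod (f z)} - W)" using K[OF e] W(1) by (rule compact_diff)
    also have "{z \<in> S. e \<le> cmod (f z)} - W = {z \<in> S. e \<le> cmod (if z \<in> U then f z else 0)}"
      using W(2) e St U(2) by (auto split: if_splits)
    finally show ?thesis .
  qed
  ultimately show ?thesis using U(2) z0 by (auto simp: C0_def)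
qed

text \<open>A decomposition of \<open>S'\<close> into open pieces splits \<open>C\<^sub>0(S')\<close> into mutually annihilating summands;
  the supports of their preimages split \<open>S\<close> into as many open pieces, and each connected
  subset of \<open>S\<close> lies in only one of them.\<close>

lemma card_le_of_star_isomorphic:
  fixes S S' :: "(complex ^ 'k) set"
  assumes S: "openin (top_of_set torus) S" and S': "openin (top_of_set torus) S'"
    and iso: "star_isomorphic (C0_alg S) (C0_alg S')"
    and I: "finite I" "S = (\<Union>i\<in>I. U i)" "\<And>i. i \<in> I \<Longrightarrow> connected (U i)"
    and J: "finite J" "S' = (\<Union>j\<in>J. W j)" "\<And>j. j \<in> J \<Longrightarrow> W j \<noteq> {}"
      "\<And>j. j \<in> J \<Longrightarrow> openin (top_of_set torus) (W j)" "disjoint_family_on W J"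
  shows "card J \<le> card I"
proof -
  obtain \<phi> where "star_isomorphism \<phi> (C0_alg S) (C0_alg S')" using iso by (auto simp: star_isomorphic_def)
  then have bij: "bij_betw \<phi> (C0 S) (C0 S')"
    and add: "\<And>f g. f \<in> C0 S \<Longrightarrow> g \<in> C0 S \<Longrightarrow> \<phi> (\<lambda>z. f z + g z) = (\<lambda>z. \<phi> f z + \<phi> g z)"
    and mult: "\<And>f g. f \<in> C0 S \<Longrightarrow> g \<in> C0 S \<Longrightarrow> \<phi> (\<lambda>z. f z * g z) = (\<lambda>z. \<phi> f z * \<phi> g z)"
    by (auto simp: star_isomorphism_def C0_alg_def)
  have inj: "\<And>f g. f \<in> C0 S \<Longrightarrow> g \<in> C0 S \<Longrightarrow> \<phi> f = \<phi> g \<Longrightarrow> f = g"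
    and sur: "\<And>g. g \<in> C0 S' \<Longrightarrow> \<exists>f\<in>C0 S. \<phi> f = g"
    and into: "\<And>f. f \<in> C0 S \<Longrightarrow> \<phi> f \<in> C0 S'"
    using bij by (auto simp: bij_betw_def inj_on_def) (metis imageE)
  have zero: "\<phi> (\<lambda>z. 0) = (\<lambda>z. 0)"
  proof
    fix z
    have "\<phi> (\<lambda>z. 0) z = \<phi> (\<lambda>z. 0) z + \<phi> (\<lambda>z. 0) z"
      using fun_cong[OF add[OF C0_closure(1)[OF S] C0_closure(1)[OF S]], of z] by simp
    then show "\<phi> (\<lambda>z. 0) z = 0" by simp
  qed
  have sum: "(\<lambda>z. \<Sum>j\<in>A. f j z) \<in> C0 S \<and> \<phi> (\<lambda>z. \<Sum>j\<in>A. f j z) = (\<lambda>z. \<Sum>j\<in>A. \<phi> (f j) z)"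
    if "finite A" "\<And>j. j \<in> A \<Longrightarrow> f j \<in> C0 S" for A :: "'b set" and f
    using that
  proof (induction A rule: finite_induct)
    case empty
    then show ?case by (simp add: zero C0_closure(1)[OF S])
  next
    case (insert a A)
    then show ?case by (simp add: add C0_closure(2)[OF S])
  qed
  have Wsub: "W j \<subseteq> S'" if "j \<in> J" for j using J(2) that by blast
  have disj: "z \<notin> W k" if "j \<in> J" "k \<in> J" "j \<noteq> k" "z \<in> W j" for j k z
    using J(5) that by (auto simp: disjoint_family_on_def)
  \<comment> \<open>\<open>E j\<close> is the preimage of the ideal of functions supported on
    \<open>W j\<close>, and \<open>V j\<close> is the open part of \<open>S\<close> where some
    member of it is nonzero.\<close>
  define E where "E j = {f \<in> C0 S. \<forall>z. z \<notin> W j \<longrightarrow> \<phi> f z = 0}" for j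
  define V where "V j = (\<Union>f\<in>E j. {z \<in> S. f z \<noteq> 0})" for j
  have V_open: "openin (top_of_set S) (V j)" for j
    unfolding V_def
  proof (intro openin_Union ballI, elim imageE, hypsubst)
    fix f assume "f \<in> E j"
    then have "continuous_on S f" by (auto simp: E_def C0_def)
    from continuous_openin_preimage_gen[OF this open_Compl[OF closed_singleton[of 0]]]
    show "openin (top_of_set S) {z \<in> S. f z \<noteq> 0}" by (simp add: Int_def vimage_def)
  qed
  have V_disj: "V j \<inter> V k = {}" if jk: "j \<in> J" "k \<in> J" "j \<noteq> k" for j k
  proof -
    have "f z = 0 \<or> g z = 0" if "f \<in> E j" "g \<in> E k" for f g z
    proof -
      have fg: "f \<in> C0 S" "g \<in> C0 S" "\<And>z. z \<notin> W j \<Longrightarrow> \<phi> f z = 0" "\<And>z. z \<notin> W k \<Longrightarrow> \<phi> g z = 0"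
        using \<open>f \<in> E j\<close> \<open>g \<in> E k\<close> by (auto simp: E_def)
      have "\<phi> f w * \<phi> g w = 0" for w using fg(3,4)[of w] disj[OF jk, of w] by auto
      then have "\<phi> (\<lambda>z. f z * g z) = \<phi> (\<lambda>z. 0)" unfolding mult[OF fg(1,2)] zero by auto
      then have "(\<lambda>z. f z * g z) = (\<lambda>z. 0)"
        by (rule inj[rotated 2]) (intro C0_closure[OF S] fg)+
      then show ?thesis using fun_cong[of _ _ z] by fastforce
    qed
    then show ?thesis by (auto simp: V_def)
  qed
  have V_ne: "V j \<noteq> {}" if j: "j \<in> J" for j
  proof -
    obtain w where w: "w \<in> W j" using J(3)[OF j] by blast
    obtain g where g: "g \<in> C0 (W j)" "g w \<noteq> 0" using C0_nonzero_at[OF J(4)[OF j] w] by blast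
    have "g \<in> C0 S'" using g(1) Wsub[OF j] unfolding C0_iff[OF S'] C0_iff[OF J(4)[OF j]] by blast
    then obtain f where f: "f \<in> C0 S" "\<phi> f = g" using sur by blast
    have "f \<noteq> (\<lambda>z. 0)" using f(2) g(2) zero by auto
    then obtain z where z: "f z \<noteq> 0" by auto
    moreover have "z \<in> S" using f(1) z by (auto simp: C0_def)
    moreover have "f \<in> E j" using f g(1) by (auto simp: E_def C0_def)
    ultimately show ?thesis by (auto simp: V_def)
  qed
  have V_cover: "S \<subseteq> (\<Union>j\<in>J. V j)"
  proof
    fix x assume x: "x \<in> S"
    obtain a where a: "a \<in> C0 S" "a x \<noteq> 0" using C0_nonzero_at[OF S x] by blast
    \<comment> \<open>The image of \<open>a\<close> is cut to the pieces \<open>W j\<close>; the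
      preimages of the cuts add up to \<open>a\<close>, so at least one of them is nonzero at
      \<open>x\<close>.\<close>
    have "\<exists>f\<in>C0 S. \<phi> f = (\<lambda>z. if z \<in> W j then \<phi> a z else 0)" if j: "j \<in> J" for j
    proof (rule sur[OF C0_restrict[OF S' J(4)[OF j] Wsub[OF j] _ into[OF a(1)]]])
      have "S' - W j = (\<Union>k\<in>J - {j}. W k)" using J(2) disj j by auto
      then show "openin (top_of_set torus) (S' - W j)" using J(4) by (auto intro!: openin_Union)
    qed
    then obtain f where f: "\<And>j. j \<in> J \<Longrightarrow> f j \<in> C0 S"
      "\<And>j. j \<in> J \<Longrightarrow> \<phi> (f j) = (\<lambda>z. if z \<in> W j then \<phi> a z else 0)" by metis
    have "(\<Sum>j\<in>J. if z \<in> W j then \<phi> a z else 0) = \<phi> a z" for z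
    proof (cases "z \<in> S'")
      case True
      then obtain k where k: "k \<in> J" "z \<in> W k" using J(2) by blast
      have "(\<Sum>j\<in>J. if z \<in> W j then \<phi> a z else 0) = (\<Sum>j\<in>J. if j = k then \<phi> a z else 0)"
        by (rule sum.cong) (use k disj in auto)
      then show ?thesis using k J(1) by simp
    next
      case False
      then have "\<phi> a z = 0" using into[OF a(1)] by (auto simp: C0_def)
      then show ?thesis by (simp only: if_cancel sum.neutral_const)
    qed
    then have "\<phi> (\<lambda>z. \<Sum>j\<in>J. f j z) = \<phi> a"
      using sum[OF J(1), of f] f by (auto cong: sum.cong)
    then have "(\<lambda>z. \<Sum>j\<in>J. f j z) = a" using inj[of "\<lambda>z. \<Sum>j\<in>J. f j z" a] sum[OF J(1), of f] f(1) a(1) by blast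
    then have "(\<Sum>j\<in>J. f j x) \<noteq> 0" using a(2) by auto
    then obtain j where "j \<in> J" "f j x \<noteq> 0" by (meson sum.neutral)
    moreover from this have "f j \<in> E j" using f by (auto simp: E_def)
    ultimately show "x \<in> (\<Union>j\<in>J. V j)" using x by (auto simp: V_def)
  qed
  have "\<forall>j. \<exists>x. j \<in> J \<longrightarrow> x \<in> V j" using V_ne by blast
  from choice[OF this] obtain x where x: "\<And>j. j \<in> J \<Longrightarrow> x j \<in> V j" by blast
  have VS: "V j \<subseteq> S" for j by (auto simp: V_def)
  have "\<forall>j. \<exists>i. j \<in> J \<longrightarrow> i \<in> I \<and> x j \<in> U i" using x VS I(2) by blast
  from choice[OF this] obtain c where c: "\<And>j. j \<in> J \<Longrightarrow> c j \<in> I" "\<And>j. j \<in> J \<Longrightarrow> x j \<in> U (c j)" by blast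
  have "inj_on c J"
  proof (rule inj_onI, rule ccontr)
    fix j k assume jk: "j \<in> J" "k \<in> J" "c j = c k" "j \<noteq> k"
    define A where "A = U (c j) \<inter> V j"
    define B where "B = U (c j) \<inter> (\<Union>l\<in>J - {j}. V l)"
    have US: "U (c j) \<subseteq> S" using c(1)[OF jk(1)] I(2) by blast
    have op: "openin (top_of_set (U (c j))) (U (c j) \<inter> Z)" if "openin (top_of_set S) Z" for Z
    proof -
      obtain T where T: "open T" "Z = S \<inter> T" using \<open>openin (top_of_set S) Z\<close> by (auto simp: openin_open)
      have "U (c j) \<inter> Z = U (c j) \<inter> T" using US T(2) by blast
      then show ?thesis using T(1) by (auto simp: openin_open)
    qed
    have "openin (top_of_set (U (c j))) A" unfolding A_def by (rule op[OF V_open])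
    moreover have "openin (top_of_set (U (c j))) B" unfolding B_def
      by (rule op) (intro openin_Union, use V_open in auto)
    moreover have "U (c j) \<subseteq> A \<union> B" using US V_cover jk by (auto simp: A_def B_def)
    moreover have "A \<inter> B = {}" using V_disj[OF jk(1)] by (auto simp: A_def B_def)
    moreover have "x j \<in> A" using x[OF jk(1)] c(2)[OF jk(1)] by (simp add: A_def)
    moreover have "x k \<in> B" using x[OF jk(2)] c(2)[OF jk(2)] jk(2-4) by (auto simp: B_def)
    ultimately show False
      using I(3)[OF c(1)[OF jk(1)]] unfolding connected_openin by blast
  qed
  then show ?thesis using I(1) c(1) by (intro card_inj_on_le[of c]) auto
qed

section \<open>The torus cut along \<open>n\<close> parallel subtori\<close>

definition cut_torus :: "'k \<Rightarrow> nat \<Rightarrow> (complex ^ 'k) set" where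
  "cut_torus i n = {z \<in> torus. (z $ i) ^ n \<noteq> 1}"

text \<open>The part between two consecutive removed subtori, presented as the image of a convex
  strip so that connectedness is immediate.\<close>

definition slab :: "'k \<Rightarrow> nat \<Rightarrow> nat \<Rightarrow> (complex ^ 'k) set" where
  "slab i n j = torus_exp ` {t. real j / real n < t $ i \<and> t $ i < (real j + 1) / real n}"

lemma torus_exp_in_cut_torus: "torus_exp t \<in> cut_torus i n \<longleftrightarrow> real n * t $ i \<notin> \<int>"
proof -
  have "(torus_exp t $ i) ^ n = cis (real n * (2 * pi * t $ i))"
    unfolding torus_exp_def vec_lambda_beta by (rule Complex.DeMoivre)
  then have "(torus_exp t $ i) ^ n = cis (2 * pi * (real n * t $ i))"
    by (simp only: mult_ac)
  then show ?thesis by (simp add: cut_torus_def cis_eq_1_iff)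
qed

lemma cut_torus_eq: assumes n: "n > 0" shows "cut_torus i n = (\<Union>j\<in>{..<n}. slab i n j)"
proof (rule set_eqI, rule iffI)
  fix z assume z: "z \<in> cut_torus i n"
  then have "z \<in> torus_exp ` cbox 0 1" by (simp add: torus_exp_surj cut_torus_def)
  then obtain t where t: "z = torus_exp t" "t \<in> cbox 0 1" by blast
  have ni: "real n * t $ i \<notin> \<int>" using z by (simp add: t torus_exp_in_cut_torus)
  have ti: "0 \<le> t $ i" "t $ i \<le> 1" using t(2) by (auto simp: mem_box_cart)
  \<comment> \<open>Since \<open>real n * t $ i\<close> is not an integer it lies strictly between
    \<open>j\<close> and \<open>j + 1\<close>, and being at most \<open>n\<close> it leaves
    \<open>j < n\<close>.\<close>
  define j where "j = nat \<lfloor>real n * t $ i\<rfloor>"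
  have fl: "real j = of_int \<lfloor>real n * t $ i\<rfloor>" using ti by (simp add: j_def)
  have ne: "real j \<noteq> real n * t $ i" using ni by (metis Ints_of_nat)
  have lt: "real j < real n * t $ i" "real n * t $ i < real j + 1" using ne unfolding fl by linarith+
  have "real n * t $ i \<le> real n" using ti by (simp add: mult_left_le)
  then have "j < n" using lt(1) by linarith
  moreover have "z \<in> slab i n j"
    unfolding slab_def t(1) using lt n by (intro imageI) (simp add: field_simps)
  ultimately show "z \<in> (\<Union>j\<in>{..<n}. slab i n j)" by blast
next
  fix z assume "z \<in> (\<Union>j\<in>{..<n}. slab i n j)"
  then obtain j t where t: "z = torus_exp t" "real j / real n < t $ i" "t $ i < (real j + 1) / real n"
    by (auto simp: slab_def)
  have lt: "real j < real n * t $ i" "real n * t $ i < real j + 1" using t(2,3) n by (simp_all add: field_simps)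
  have "real n * t $ i \<notin> \<int>"
  proof
    assume "real n * t $ i \<in> \<int>"
    then obtain m :: int where "real n * t $ i = of_int m" by (auto elim: Ints_cases)
    then have "of_int (int j) < (of_int m :: real)" "(of_int m :: real) < of_int (int j + 1)" using lt by simp_all
    then show False unfolding of_int_less_iff by linarith
  qed
  then show "z \<in> cut_torus i n" by (simp add: t(1) torus_exp_in_cut_torus)
qed

lemma slab_coordinates:
  assumes n: "j < n" and s: "real j / real n < s $ i" "s $ i < (real j + 1) / real n"
  shows "0 < s $ i" "s $ i < 1"
proof -
  show "0 < s $ i" using s(1) by (rule order_le_less_trans[rotated]) simp
  have "(real j + 1) / real n \<le> 1" using n by (simp add: divide_le_eq)
  then show "s $ i < 1" using s(2) by linarith
qed

text \<open>The complement in the torus is the image of a compact part \<open>C\<close> of the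
  closed cube, hence closed. A lift with coordinate in (0,1) and one in [0,1] differ by an integer
  of absolute value below 1, so their coordinates agree.\<close>

lemma openin_slab:
  fixes i :: "'k::finite"
  assumes n: "j < n" shows "openin (top_of_set torus) (slab i n j)"
proof -
  define C where "C = {t \<in> cbox 0 (1 :: real ^ 'k). t $ i \<le> real j / real n} \<union> {t \<in> cbox 0 1. (real j + 1) / real n \<le> t $ i}"
  have "compact C"
  proof -
    have "closed {t \<in> cbox 0 (1 :: real ^ 'k). t $ i \<le> real j / real n}"
      "closed {t \<in> cbox 0 (1 :: real ^ 'k). (real j + 1) / real n \<le> t $ i}"
      by (intro continuous_on_closed_Collect_le continuous_intros closed_cbox)+
    then have "closed C" by (simp add: C_def closed_Un)
    moreover have "bounded C" by (rule bounded_subset[OF bounded_cbox[of 0 1]]) (auto simp: C_def)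
    ultimately show ?thesis by (simp add: compact_eq_bounded_closed)
  qed
  then have "closed (torus_exp ` C)"
    by (intro compact_imp_closed compact_continuous_image continuous_on_torus_exp)
  moreover have "slab i n j = torus - torus_exp ` C"
  proof (rule set_eqI, rule iffI)
    fix z assume "z \<in> slab i n j"
    then obtain s where s: "z = torus_exp s" "real j / real n < s $ i" "s $ i < (real j + 1) / real n"
      by (auto simp: slab_def)
    note s01 = slab_coordinates[OF n s(2,3)]
    have "z \<noteq> torus_exp t" if t: "t \<in> C" for t
    proof
      assume "z = torus_exp t"
      then obtain m where m: "s = t + (\<chi> i. of_int (m $ i))" using torus_exp_eq_iff s(1) by metis
      have t01: "0 \<le> t $ i" "t $ i \<le> 1" using t by (auto simp: C_def mem_box_cart)
      have "s $ i = t $ i + of_int (m $ i)" by (simp add: m)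
      then have "of_int (m $ i) < (1 :: real)" "of_int (m $ i) > (-1 :: real)" using s01 t01 by linarith+
      then have "m $ i = 0" by linarith
      then have "s $ i = t $ i" by (simp add: m)
      then show False using t s by (auto simp: C_def)
    qed
    then show "z \<in> torus - torus_exp ` C" using s(1) by auto
  next
    fix z assume z: "z \<in> torus - torus_exp ` C"
    then have "z \<in> torus_exp ` cbox 0 1" by (simp add: torus_exp_surj)
    then obtain t where t: "z = torus_exp t" "t \<in> cbox 0 1" by blast
    then have "t \<notin> C" using z by blast
    then show "z \<in> slab i n j" using t by (auto simp: C_def slab_def)
  qed
  ultimately show ?thesis unfolding Diff_eq by (simp add: openin_open_Int open_Compl)
qed

lemma connected_slab: "connected (slab i n j)"
  unfolding slab_def
proof (intro connected_continuous_image continuous_on_torus_exp convex_connected)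
  have "{t :: real ^ 'a. real j / real n < t $ i \<and> t $ i < (real j + 1) / real n}
      = {t. real j / real n < t $ i} \<inter> {t. t $ i < (real j + 1) / real n}" by blast
  then show "convex {t :: real ^ 'a. real j / real n < t $ i \<and> t $ i < (real j + 1) / real n}"
    using convex_halfspace_gt[of "real j / real n" "axis i 1 :: real ^ 'a"]
      convex_halfspace_lt[of "axis i 1 :: real ^ 'a" "(real j + 1) / real n"]
    by (simp add: inner_axis' convex_Int)
qed

lemma slab_nonempty: assumes "n > 0" shows "slab i n j \<noteq> {}"
proof -
  have "(\<chi> l. (real j + 1/2) / real n) \<in> {t :: real ^ 'a. real j / real n < t $ i \<and> t $ i < (real j + 1) / real n}"
    using assms by (simp add: divide_strict_right_mono)
  then show ?thesis unfolding slab_def by blast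
qed

lemma disjoint_slabs: "disjoint_family_on (slab i n) {..<n}"
  unfolding disjoint_family_on_def
proof (intro ballI impI)
  fix j k assume jk: "j \<in> {..<n}" "k \<in> {..<n}" "j \<noteq> k"
  have False if "z \<in> slab i n j" "z \<in> slab i n k" for z
  proof -
    obtain s where s: "z = torus_exp s" "real j / real n < s $ i" "s $ i < (real j + 1) / real n"
      using \<open>z \<in> slab i n j\<close> by (auto simp: slab_def)
    obtain t where t: "z = torus_exp t" "real k / real n < t $ i" "t $ i < (real k + 1) / real n"
      using \<open>z \<in> slab i n k\<close> by (auto simp: slab_def)
    have s01: "0 < s $ i" "s $ i < 1" and t01: "0 < t $ i" "t $ i < 1"
      using slab_coordinates[OF _ s(2,3)] slab_coordinates[OF _ t(2,3)] jk by auto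
    obtain m where m: "s = t + (\<chi> i. of_int (m $ i))" using torus_exp_eq_iff s(1) t(1) by metis
    have "s $ i = t $ i + of_int (m $ i)" by (simp add: m)
    then have "of_int (m $ i) < (1 :: real)" "of_int (m $ i) > (-1 :: real)" using s01 t01 by linarith+
    then have "m $ i = 0" by linarith
    then have st: "s $ i = t $ i" by (simp add: m)
    have n: "real n > 0" using jk by auto
    have "real j < real k + 1" "real k < real j + 1"
      using s(2,3) t(2,3) n unfolding st by (simp_all add: field_simps)
    then show False using jk(3) by linarith
  qed
  then show "slab i n j \<inter> slab i n k = {}" by blast
qed

lemma openin_cut_torus: "n > 0 \<Longrightarrow> openin (top_of_set torus) (cut_torus i n)"
  by (auto simp: cut_torus_eq intro!: openin_Union openin_slab)

text \<open>A countable union of parallel hyperplanes.\<close>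

lemma null_cut:
  fixes i :: "'k::finite"
  assumes n: "n > 0"
  shows "{t :: real ^ 'k. real n * t $ i \<in> \<int>} \<in> null_sets lborel"
proof -
  have h: "{t :: real ^ 'k. t $ i = c} \<in> null_sets lborel" for c
  proof -
    have "{t :: real ^ 'k. t $ i = c} \<in> null_sets lebesgue"
      using negligible_standard_hyperplane[of "axis i 1 :: real ^ 'k" c]
      by (simp add: negligible_iff_null_sets inner_axis axis_in_Basis_iff)
    moreover have "closed {t :: real ^ 'k. t $ i = c}"
      by (intro closed_Collect_eq continuous_intros)
    ultimately show ?thesis by (subst (asm) null_sets_completion_iff) (auto simp: borel_closed)
  qed
  have "{t :: real ^ 'k. real n * t $ i \<in> \<int>} = (\<Union>m::int. {t. t $ i = of_int m / real n})"
    using n by (auto simp: field_simps elim!: Ints_cases)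
  also have "\<dots> \<in> null_sets lborel" by (rule null_sets_UN) (rule h)
  finally show ?thesis .
qed

lemma null_sets_cut_torus:
  fixes i :: "'k::finite"
  assumes n: "n > 0"
  shows "torus - cut_torus i n \<in> null_sets haar_torus"
proof -
  obtain T where T: "open T" "cut_torus i n = torus \<inter> T"
    using openin_cut_torus[OF n] by (auto simp: openin_open)
  have "closed (torus - cut_torus i n)"
    using closed_Diff[OF compact_imp_closed[OF compact_torus] T(1)] T(2) by (simp add: Diff_Int_distrib Diff_Int)
  then have m: "torus - cut_torus i n \<in> sets borel" by (rule borel_closed)
  have "emeasure haar_torus (torus - cut_torus i n)
      = emeasure (restrict_space lborel (cbox 0 1)) (torus_exp -` (torus - cut_torus i n) \<inter> cbox 0 1)"
    unfolding haar_torus_def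
    by (subst emeasure_distr[OF measurable_torus_exp m]) (simp add: space_restrict_space)
  also have "\<dots> = emeasure lborel (torus_exp -` (torus - cut_torus i n) \<inter> cbox 0 1)"
    by (rule emeasure_restrict_space) auto
  also have "\<dots> \<le> emeasure lborel {t :: real ^ 'k. real n * t $ i \<in> \<int>}"
    by (rule emeasure_mono) (use null_cut[OF n, of i] in \<open>auto simp: torus_exp_in_cut_torus\<close>)
  also have "\<dots> = 0" using null_cut[OF n, of i] by auto
  finally show ?thesis using m by (auto simp: haar_torus_def)
qed

lemma cut_torus_star_isomorphic_le:
  fixes i :: "'k::finite"
  assumes "n > 0" "n' > 0" "star_isomorphic (C0_alg (cut_torus i n)) (C0_alg (cut_torus i n'))"
  shows "n' \<le> n"
  using card_le_of_star_isomorphic[OF openin_cut_torus[OF assms(1)] openin_cut_torus[OF assms(2)] assms(3)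
      finite_lessThan cut_torus_eq[OF assms(1)] connected_slab finite_lessThan cut_torus_eq[OF assms(2)]
      slab_nonempty[OF assms(2)] _ disjoint_slabs]
  by (simp add: openin_slab)

theorem mainTheorem6:
  defines "\<rho> \<equiv> (right_regular :: int ^ 'k \<Rightarrow> (int ^ 'k) op)"
  shows "unitary_rep \<rho> \<and>
    (\<forall>S :: (complex ^ 'k) set.
       openin (top_of_set torus) S \<and> torus \<subseteq> closure S \<and> torus - S \<in> null_sets haar_torus \<longrightarrow>
       closure (RS S) = UNIV \<and> relatively_L1 \<rho> (RS S) \<and>
       rieffel_proper (Ad \<rho>) compact_ops (ketbra_span (RS S)) \<and>
       gen_fixed_point_algebra (Ad \<rho>) compact_ops (ketbra_span (RS S)) = Fix \<rho> (RS S) \<and>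
       star_isomorphic (op_alg (Fix \<rho> (RS S))) (C0_alg S)) \<and>
    (\<exists>\<F> :: (int ^ 'k) op set set. infinite \<F> \<and>
       (\<forall>F\<in>\<F>. \<exists>R. rieffel_proper (Ad \<rho>) compact_ops R \<and>
          F = gen_fixed_point_algebra (Ad \<rho>) compact_ops R) \<and>
       pairwise (\<lambda>E F. \<not> star_isomorphic (op_alg E) (op_alg F)) \<F>)"
proof (intro conjI allI impI)
  show "unitary_rep \<rho>" unfolding \<rho>_def by (rule unitary_rep_right_regular)
next
  fix S :: "(complex ^ 'k) set"
  assume "openin (top_of_set torus) S \<and> torus \<subseteq> closure S \<and> torus - S \<in> null_sets haar_torus"
  then have S: "openin (top_of_set torus) S" and null: "torus - S \<in> null_sets haar_torus" by auto
  show dense: "closure (RS S) = UNIV" by (rule RS_dense[OF S null])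
  show L1: "relatively_L1 \<rho> (RS S)" unfolding \<rho>_def by (rule RS_relatively_L1[OF S_torus[OF S]])
  show "rieffel_proper (Ad \<rho>) compact_ops (ketbra_span (RS S))"
    using rieffel_proper_ketbra_span[OF dense] L1 unfolding \<rho>_def by blast
  show "gen_fixed_point_algebra (Ad \<rho>) compact_ops (ketbra_span (RS S)) = Fix \<rho> (RS S)"
    unfolding \<rho>_def gen_fixed_point_algebra_eq[OF S] Fix_eq[OF S] ..
  show "star_isomorphic (op_alg (Fix \<rho> (RS S))) (C0_alg S)"
    unfolding \<rho>_def Fix_eq[OF S] by (rule star_isomorphic_C0_ops[OF S])
next
  \<comment> \<open>Index types are inhabited, which is the condition k >= 1; any coordinate may be
    cut.\<close>
  obtain i :: 'k where True by blast
  \<comment> \<open>The successor avoids the case of exponent 0, where z^0 = 1 would make the set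
    empty.\<close>
  define T where "T n = (cut_torus i (Suc n) :: (complex ^ 'k) set)" for n
  define F where "F n = C0_ops (T n)" for n
  have T: "openin (top_of_set torus) (T n)" "torus - T n \<in> null_sets haar_torus" for n
    unfolding T_def by (auto intro: openin_cut_torus null_sets_cut_torus)
  \<comment> \<open>Each direction of an isomorphism gives one inequality between the numbers of
    components; symmetry supplies the other.\<close>
  have iso_le: "m \<le> n" if iso: "star_isomorphic (op_alg (F n)) (op_alg (F m))" for m n
  proof -
    have sub: "cstar_subalgebra (F n)" unfolding F_def by (rule C0_ops_cstar_subalgebra[OF T(1)])
    have "star_isomorphic (C0_alg (T n)) (op_alg (F n))"
      by (rule star_isomorphic_sym)
         (use sub star_isomorphic_C0_ops[OF T(1)] in
          \<open>auto simp: F_def op_alg_def cstar_subalgebra_def op.subspace_add op.subspace_scale\<close>)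
    have "star_isomorphic (op_alg (F m)) (C0_alg (T m))"
      unfolding F_def by (rule star_isomorphic_C0_ops[OF T(1)])
    then have "star_isomorphic (C0_alg (T n)) (C0_alg (T m))"
      by (rule star_isomorphic_trans[OF star_isomorphic_trans[OF \<open>star_isomorphic (C0_alg (T n)) (op_alg (F n))\<close> iso]])
    then show "m \<le> n" unfolding T_def using cut_torus_star_isomorphic_le[of "Suc n" "Suc m" i] by simp
  qed
  have refl: "star_isomorphic (op_alg E) (op_alg E)" for E :: "(int ^ 'k) op set"
    unfolding star_isomorphic_def star_isomorphism_def by (intro exI[of _ id]) auto
  \<comment> \<open>Equal algebras are isomorphic, so \<open>iso_le\<close> applies in both
    directions.\<close>
  have "inj F"
    using iso_le refl by (metis antisym injI)
  then have "infinite (range F)" by (rule range_inj_infinite)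
  moreover have "\<exists>R. rieffel_proper (Ad \<rho>) compact_ops R \<and> F n = gen_fixed_point_algebra (Ad \<rho>) compact_ops R" for n
    using rieffel_proper_ketbra_span[OF RS_dense[OF T] RS_relatively_L1[OF S_torus[OF T(1)]]]
      gen_fixed_point_algebra_eq[OF T(1), of n]
    unfolding \<rho>_def F_def by (intro exI[of _ "ketbra_span (RS (T n))"]) simp
  moreover have "pairwise (\<lambda>E F. \<not> star_isomorphic (op_alg E) (op_alg F)) (range F)"
    unfolding pairwise_def
  proof (intro ballI impI notI)
    fix E G assume EG: "E \<in> range F" "G \<in> range F" "E \<noteq> G" "star_isomorphic (op_alg E) (op_alg G)"
    then obtain m n where mn: "E = F m" "G = F n" by blast
    then have "F m \<noteq> F n" and iso: "star_isomorphic (op_alg (F m)) (op_alg (F n))" using EG by auto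
    have sub: "cstar_subalgebra (F m)" unfolding F_def by (rule C0_ops_cstar_subalgebra[OF T(1)])
    have "star_isomorphic (op_alg (F n)) (op_alg (F m))"
      by (rule star_isomorphic_sym[OF iso])
         (use sub in \<open>auto simp: op_alg_def cstar_subalgebra_def op.subspace_add op.subspace_scale\<close>)
    then have "m = n" using iso_le iso by (metis antisym)
    then show False using \<open>F m \<noteq> F n\<close> by simp
  qed
  ultimately show "\<exists>\<F> :: (int ^ 'k) op set set. infinite \<F> \<and>
       (\<forall>F\<in>\<F>. \<exists>R. rieffel_proper (Ad \<rho>) compact_ops R \<and>
          F = gen_fixed_point_algebra (Ad \<rho>) compact_ops R) \<and>
       pairwise (\<lambda>E F. \<not> star_isomorphic (op_alg E) (op_alg F)) \<F>"
    by (intro exI[of _ "range F"]) blast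
qed

end
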